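(* Let $i\in\{1,\dots,N\}$, $a,b>0$, $p>1$, $\gamma\ge0$, and let $f:\overline{B_2}\to\mathbb{R}$ be Lipschitz continuous with Lipschitz constant $\Lambda\ge0$, i.e. $|f(x)-f(y)|\le\Lambda|x-y|$ for all $x,y\in\overline{B_2}$. Set $\Lambda_0=\|f\|_\infty$. If $u\in C(\overline{B_2})$ is a viscosity solution of $$-a\lambda_i(D^2u)+b|Du|^p-f(x)+\gamma u=0\quad\text{in }B_2,$$ then $$|u(x)-u(y)|\le L_0|x-y|\quad\text{for all }x,y\in B_{1/2},$$ where the constant $L_0$ depends only on $\gamma\|u\|_\infty$, $p$, $a$, $b$, $\Lambda_0$, $\Lambda$.
   Context: $B_r\subset\mathbb{R}^N$ is the open ball of radius $r$ centered at $0$; $\|\cdot\|_\infty$ is the sup norm on $\overline{B_2}$. For a real symmetric $N\times N$ matrix $X$, $\lambda_1(X)\le\dots\le\lambda_N(X)$ denote its eigenvalues in nondecreasing order. A continuous function $u$ is a viscosity solution of the equation in $B_2$ if, whenever $\varphi$ is $C^2$ and $u-\varphi$ has a local maximum (respectively minimum) at $x\in B_2$, one has $-a\lambda_i(D^2\varphi(x))+b|D\varphi(x)|^p-f(x)+\gamma u(x)\le0$ (respectively $\ge0$). *)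

theory Defs
  imports "HOL-Analysis.Analysis" "Jordan_Normal_Form.Char_Poly"
begin

text \<open>
  The dimension \<open>N\<close> must be a term-level variable, because the Lipschitz constant in the main
  statement has to be chosen before \<open>N\<close>.  So \<open>\<real>\<^sup>N\<close> is the library's \<^const>\<open>Euclidean_space\<close>:
  functions \<open>x :: nat \<Rightarrow> real\<close> with \<open>x k = 0\<close> for \<open>k \<ge> N\<close>.  The product topology on
  \<^typ>\<open>nat \<Rightarrow> real\<close> induces the usual topology there, so \<^const>\<open>continuous_on\<close> has its usual
  meaning on subsets of \<open>\<real>\<^sup>N\<close>.  The type-class \<^const>\<open>dist\<close> on \<^typ>\<open>nat \<Rightarrow> real\<close> is not the
  Euclidean distance, hence the explicit norm and distance below.  Coordinates are numbered from 0.
\<close>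

definition enorm :: "nat \<Rightarrow> (nat \<Rightarrow> real) \<Rightarrow> real" where
  "enorm N x = L2_set x {..<N}"

definition edist :: "nat \<Rightarrow> (nat \<Rightarrow> real) \<Rightarrow> (nat \<Rightarrow> real) \<Rightarrow> real" where
  "edist N x y = enorm N (\<lambda>k. x k - y k)"

definition open_eball :: "nat \<Rightarrow> real \<Rightarrow> (nat \<Rightarrow> real) set" where
  "open_eball N r = {x \<in> topspace (Euclidean_space N). enorm N x < r}"

definition closed_eball :: "nat \<Rightarrow> real \<Rightarrow> (nat \<Rightarrow> real) set" where
  "closed_eball N r = {x \<in> topspace (Euclidean_space N). enorm N x \<le> r}"

definition sup_norm_on :: "(nat \<Rightarrow> real) set \<Rightarrow> ((nat \<Rightarrow> real) \<Rightarrow> real) \<Rightarrow> real" where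
  "sup_norm_on S g = (SUP x\<in>S. \<bar>g x\<bar>)"

definition partial_deriv ::
    "nat \<Rightarrow> ((nat \<Rightarrow> real) \<Rightarrow> real) \<Rightarrow> (nat \<Rightarrow> real) \<Rightarrow> real" where
  "partial_deriv k \<phi> x = deriv (\<lambda>t. \<phi> (x(k := t))) (x k)"

text \<open>
  \<^const>\<open>deriv\<close> is only meaningful where the derivative exists, so existence is required separately.
  These definitions are meant for sets \<open>S\<close> that are open relative to \<open>\<real>\<^sup>N\<close>.
\<close>

definition C1_on :: "nat \<Rightarrow> (nat \<Rightarrow> real) set \<Rightarrow> ((nat \<Rightarrow> real) \<Rightarrow> real) \<Rightarrow> bool" where
  "C1_on N S \<phi> \<longleftrightarrow> continuous_on S \<phi> \<and>
     (\<forall>k<N. (\<forall>x\<in>S. (\<lambda>t. \<phi> (x(k := t))) differentiable (at (x k))) \<and>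
            continuous_on S (partial_deriv k \<phi>))"

definition C2_on :: "nat \<Rightarrow> (nat \<Rightarrow> real) set \<Rightarrow> ((nat \<Rightarrow> real) \<Rightarrow> real) \<Rightarrow> bool" where
  "C2_on N S \<phi> \<longleftrightarrow> C1_on N S \<phi> \<and> (\<forall>k<N. C1_on N S (partial_deriv k \<phi>))"

definition gradient ::
    "nat \<Rightarrow> ((nat \<Rightarrow> real) \<Rightarrow> real) \<Rightarrow> (nat \<Rightarrow> real) \<Rightarrow> (nat \<Rightarrow> real)" where
  "gradient N \<phi> x = (\<lambda>k. if k < N then partial_deriv k \<phi> x else 0)"

definition hessian ::
    "nat \<Rightarrow> ((nat \<Rightarrow> real) \<Rightarrow> real) \<Rightarrow> (nat \<Rightarrow> real) \<Rightarrow> real mat" where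
  "hessian N \<phi> x = Matrix.mat N N (\<lambda>(j, k). partial_deriv j (partial_deriv k \<phi>) x)"

text \<open>
  The \<open>i\<close>-th smallest eigenvalue (\<open>1 \<le> i \<le> N\<close>) of a real symmetric \<open>N \<times> N\<close> matrix, eigenvalues
  being repeated according to multiplicity.
\<close>

definition eigenvalue_nth :: "nat \<Rightarrow> real mat \<Rightarrow> real" where
  "eigenvalue_nth i X = sorted_list_of_multiset (proots (char_poly X)) ! (i - 1)"

definition local_max_at ::
    "nat \<Rightarrow> (nat \<Rightarrow> real) set \<Rightarrow> ((nat \<Rightarrow> real) \<Rightarrow> real) \<Rightarrow> (nat \<Rightarrow> real) \<Rightarrow> bool" where
  "local_max_at N \<Omega> w x \<longleftrightarrow> (\<exists>r>0. \<forall>y\<in>\<Omega>. edist N y x < r \<longrightarrow> w y \<le> w x)"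

definition local_min_at ::
    "nat \<Rightarrow> (nat \<Rightarrow> real) set \<Rightarrow> ((nat \<Rightarrow> real) \<Rightarrow> real) \<Rightarrow> (nat \<Rightarrow> real) \<Rightarrow> bool" where
  "local_min_at N \<Omega> w x \<longleftrightarrow> (\<exists>r>0. \<forall>y\<in>\<Omega>. edist N y x < r \<longrightarrow> w x \<le> w y)"

text \<open>
  Viscosity solutions of \<open>F x (u x) (Du x) (D\<^sup>2u x) = 0\<close> in the relatively open set \<open>\<Omega> \<subseteq> \<real>\<^sup>N\<close>.
\<close>

definition viscosity_solution ::
    "nat \<Rightarrow> ((nat \<Rightarrow> real) \<Rightarrow> real \<Rightarrow> (nat \<Rightarrow> real) \<Rightarrow> real mat \<Rightarrow> real) \<Rightarrow>
     (nat \<Rightarrow> real) set \<Rightarrow> ((nat \<Rightarrow> real) \<Rightarrow> real) \<Rightarrow> bool" where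
  "viscosity_solution N F \<Omega> u \<longleftrightarrow> continuous_on \<Omega> u \<and>
     (\<forall>\<phi>. C2_on N \<Omega> \<phi> \<longrightarrow> (\<forall>x\<in>\<Omega>.
        (local_max_at N \<Omega> (\<lambda>y. u y - \<phi> y) x \<longrightarrow>
           F x (u x) (gradient N \<phi> x) (hessian N \<phi> x) \<le> 0) \<and>
        (local_min_at N \<Omega> (\<lambda>y. u y - \<phi> y) x \<longrightarrow>
           F x (u x) (gradient N \<phi> x) (hessian N \<phi> x) \<ge> 0)))"

end

theory Submission
  imports Defs
begin

text \<open>
  Doubling of variables.  Suppose that \<open>u x - u y - L |x - y| (1 - |x|\<^sup>2 - k |x - y|) powr - (1 / (p - 1))\<close> has a
  positive maximum.  Testing the two Hessians at the maximum with vectors \<open>((1 + s) v, v)\<close> instead of \<open>(v, v)\<close>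
  gives \<open>(1 + s)\<^sup>2 \<lambda>\<^sub>i(D\<^sup>2u(x)) \<le> \<lambda>\<^sub>i(D\<^sup>2u(y)) + S\<close>.  Since the equation makes \<open>\<lambda>\<^sub>i(D\<^sup>2u)\<close> comparable with
  \<open>(b / a) |Du| powr p\<close>, the factor \<open>(1 + s)\<^sup>2\<close> produces a gain of order \<open>s |Du| powr p\<close>, which for large \<open>L\<close>
  beats the error \<open>S\<close>; so the maximum is not positive.  A bound near the diagonal suffices, because segments can be
  subdivided.

  The theorem on sums is replaced by a second-order argument for the two sup-convolutions, which are semiconvex and
  whose sum touches a quadratic from below.  Only a discrete form of Alexandrov's theorem is needed: at some scale and at some point
  of contact with a tilted paraboloid, the function is within \<open>\<eta> r\<^sup>2\<close> of a quadratic on a ball of radius \<open>r\<close>.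
  As \<open>1 / (1 + a)\<close> is convex, its mean over the averaged second differences \<open>a \<ge> 0\<close> grows under refinement of
  the scale; being bounded it is almost stationary at some scale, so the second differences are almost constant on most
  cells, while contact points meet a fixed fraction of them because the tilt is a Lipschitz function of the contact point.
  Of the functions \<open>\<lambda>\<^sub>i\<close> only \<open>\<lambda>\<^sub>i(t A + d I) = t \<lambda>\<^sub>i(A) + d\<close> for \<open>t > 0\<close> is used.
\<close>

subsection \<open>Euclidean norm, inner product and quadratic forms\<close>

text \<open>A single eigenvalue is a degenerate function of the Hessian, in general neither convex
  nor concave, so a concave modulus of |x - y| yields no strict gain at the doubled maximum. With
  equal test vectors the first-order term yields none either: the gradients at the two points almost
  coincide and the equations cancel. Unequal vectors break this symmetry. Their price is the
  curvature of the norm, of size s^2 / |x - y|; with \<open>s = k * \<beta> * r0 / F\<close> it is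
  of order s, like the gain.

  The exponent \<beta> = 1 / (p - 1) satisfies \<beta> p = \<beta> + 1, so the p-th power of the
  gradient of the penalty and its second derivatives blow up at the same rate; the first carries L
  powr p and the second only L. The factor k keeps the gradient error caused by the cut-off |x|^2
  small compared with s. At a positive maximum \<gamma> (u x - u y) has the favourable sign, so u
  enters only through \<gamma> |u|.

  L must not depend on the dimension. The second-order argument has constants depending on N, but
  they only control tolerances that tend to 0, and the inequality it produces is free of N.\<close>

definition ip :: "nat \<Rightarrow> (nat \<Rightarrow> real) \<Rightarrow> (nat \<Rightarrow> real) \<Rightarrow> real" where
  "ip N x y = (\<Sum>k<N. x k * y k)"

definition qf :: "nat \<Rightarrow> (nat \<Rightarrow> nat \<Rightarrow> real) \<Rightarrow> (nat \<Rightarrow> real) \<Rightarrow> real" where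
  "qf N A x = (\<Sum>j<N. \<Sum>k<N. A j k * x j * x k)"

lemma enorm_sq: "(enorm N x)\<^sup>2 = ip N x x"
  by (simp add: enorm_def L2_set_def ip_def sum_nonneg power2_eq_square)

lemma enorm_nonneg [simp]: "0 \<le> enorm N x"
  by (simp add: enorm_def)

lemma ip_le: "\<bar>ip N x y\<bar> \<le> enorm N x * enorm N y"
  unfolding ip_def enorm_def
  by (rule order_trans[OF sum_abs]) (simp add: abs_mult L2_set_mult_ineq)

lemma enorm_triangle: "enorm N (\<lambda>k. x k + y k) \<le> enorm N x + enorm N y"
  unfolding enorm_def by (rule L2_set_triangle_ineq)

lemma enorm_scale: "enorm N (\<lambda>k. c * x k) = \<bar>c\<bar> * enorm N x"
  unfolding enorm_def using L2_set_left_distrib[of "\<bar>c\<bar>" x "{..<N}"]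
  by (simp add: L2_set_def power_mult_distrib sum_distrib_left[symmetric] real_sqrt_mult)

lemma enorm_minus: "enorm N (\<lambda>k. - x k) = enorm N x"
  using enorm_scale[of N "-1" x] by simp

lemma enorm_diff_le: "enorm N (\<lambda>k. x k - y k) \<le> enorm N x + enorm N y"
  using enorm_triangle[of N x "\<lambda>k. - y k"] by (simp add: enorm_minus)

lemma enorm_le_add_diff: "enorm N x \<le> enorm N y + enorm N (\<lambda>k. x k - y k)"
  using enorm_triangle[of N y "\<lambda>k. x k - y k"] by simp

lemma enorm_zero [simp]: "enorm N (\<lambda>k. 0) = 0"
  by (simp add: enorm_def L2_set_def)

lemma abs_le_enorm: "k < N \<Longrightarrow> \<bar>x k\<bar> \<le> enorm N x"
  unfolding enorm_def L2_set_def by (rule real_le_rsqrt) (simp add: member_le_sum[of k "{..<N}" "\<lambda>k. (x k)\<^sup>2", simplified])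

lemma enorm_le_sum: "(\<And>k. k < N \<Longrightarrow> \<bar>x k\<bar> \<le> B) \<Longrightarrow> enorm N x \<le> real N * B"
  unfolding enorm_def
  by (rule order_trans[OF L2_set_le_sum_abs]) (rule order_trans[OF sum_mono[of _ _ "\<lambda>_. B"]], auto)

lemma enorm_cong: "(\<And>k. k < N \<Longrightarrow> x k = y k) \<Longrightarrow> enorm N x = enorm N y"
  unfolding enorm_def by (rule L2_set_cong) auto

lemma ip_add_right: "ip N x (\<lambda>k. y k + z k) = ip N x y + ip N x z"
  by (simp add: ip_def distrib_left sum.distrib)

lemma ip_diff_right: "ip N x (\<lambda>k. y k - z k) = ip N x y - ip N x z"
  by (simp add: ip_def right_diff_distrib sum_subtractf)

lemma ip_add_left: "ip N (\<lambda>k. y k + z k) x = ip N y x + ip N z x"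
  by (simp add: ip_def distrib_right sum.distrib)

lemma ip_diff_left: "ip N (\<lambda>k. y k - z k) x = ip N y x - ip N z x"
  by (simp add: ip_def left_diff_distrib sum_subtractf)

lemma ip_scale_right: "ip N x (\<lambda>k. c * y k) = c * ip N x y"
  by (simp add: ip_def sum_distrib_left mult_ac)

lemma ip_scale_left: "ip N (\<lambda>k. c * x k) y = c * ip N x y"
  by (simp add: ip_def sum_distrib_left mult_ac)

lemma ip_minus_right: "ip N x (\<lambda>k. - y k) = - ip N x y"
  by (simp add: ip_def sum_negf)

lemma ip_zero_right: "ip N x (\<lambda>k. 0) = 0" by (simp add: ip_def)

lemma ip_commute: "ip N x y = ip N y x" by (simp add: ip_def mult.commute)

lemma enorm_add_sq: "(enorm N (\<lambda>k. x k + y k))\<^sup>2 = (enorm N x)\<^sup>2 + 2 * ip N x y + (enorm N y)\<^sup>2"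
  by (simp add: enorm_sq ip_add_left ip_add_right ip_commute[of N y x])

lemma enorm_diff_sq: "(enorm N (\<lambda>k. x k - y k))\<^sup>2 = (enorm N x)\<^sup>2 - 2 * ip N x y + (enorm N y)\<^sup>2"
  by (simp add: enorm_sq ip_diff_left ip_diff_right ip_commute[of N y x])

lemma enorm_scale_sq: "(enorm N (\<lambda>k. c * x k))\<^sup>2 = c\<^sup>2 * (enorm N x)\<^sup>2"
  by (simp add: enorm_scale power_mult_distrib)

lemma enorm_minus_commute: "enorm N (\<lambda>k. x k - y k) = enorm N (\<lambda>k. y k - x k)"
  using enorm_minus[of N "\<lambda>k. x k - y k"] by simp

subsection \<open>Averaged second differences and their energy\<close>

definition nbox :: "nat \<Rightarrow> nat \<Rightarrow> (nat \<Rightarrow> nat) set" where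
  "nbox N n = {v. (\<forall>k<N. v k < n) \<and> (\<forall>k\<ge>N. v k = 0)}"

lemma nbox_Suc: "bij_betw (\<lambda>(v, a). v(N := a)) (nbox N n \<times> {..<n}) (nbox (Suc N) n)"
proof (rule bij_betw_byWitness[where f' = "\<lambda>v. (v(N := 0), v N)"])
  show "\<forall>p\<in>nbox N n \<times> {..<n}. (((case p of (v, a) \<Rightarrow> v(N := a))(N := 0)), (case p of (v, a) \<Rightarrow> v(N := a)) N) = p"
    by (auto simp: nbox_def fun_eq_iff)
qed (auto simp: nbox_def less_Suc_eq)

lemma finite_card_nbox: "finite (nbox N n) \<and> card (nbox N n) = n ^ N"
proof (induction N)
  case 0
  have "nbox 0 n = {\<lambda>_. 0}" by (auto simp: nbox_def)
  then show ?case by simp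
next
  case (Suc N)
  then show ?case
    using bij_betw_finite[OF nbox_Suc[of N n]] bij_betw_same_card[OF nbox_Suc[of N n]]
    by (simp add: card_cartesian_product mult.commute)
qed

lemma finite_nbox [simp]: "finite (nbox N n)" and card_nbox [simp]: "card (nbox N n) = n ^ N"
  using finite_card_nbox by auto

lemma nbox_mono: "n \<le> m \<Longrightarrow> nbox N n \<subseteq> nbox N m"
  by (force simp: nbox_def)

lemma nbox_add: "v \<in> nbox N n \<Longrightarrow> (\<And>k. k < N \<Longrightarrow> s k + n \<le> m) \<Longrightarrow> (\<And>k. k \<ge> N \<Longrightarrow> s k = 0)
  \<Longrightarrow> (\<lambda>k. v k + s k) \<in> nbox N m"
proof -
  assume a: "v \<in> nbox N n" "\<And>k. k < N \<Longrightarrow> s k + n \<le> m" "\<And>k. k \<ge> N \<Longrightarrow> s k = 0"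
  have "v k + s k < m" if "k < N" for k
  proof -
    have "v k < n" using a(1) that by (auto simp: nbox_def)
    then show ?thesis using a(2)[OF that] by linarith
  qed
  then show ?thesis using a by (auto simp: nbox_def)
qed

lemma sum_nbox_shift:
  fixes g :: "(nat \<Rightarrow> nat) \<Rightarrow> real"
  assumes "\<And>v. 0 \<le> g v" "\<And>k. k < N \<Longrightarrow> s k + n \<le> m" "\<And>k. k \<ge> N \<Longrightarrow> s k = 0"
  shows "(\<Sum>v\<in>nbox N n. g (\<lambda>k. v k + s k)) \<le> (\<Sum>v\<in>nbox N m. g v)"
proof -
  have inj: "inj_on (\<lambda>v. (\<lambda>k. v k + s k)) (nbox N n)"
    by (auto simp: inj_on_def fun_eq_iff)
  have "(\<Sum>v\<in>nbox N n. g (\<lambda>k. v k + s k)) = sum g ((\<lambda>v. (\<lambda>k. v k + s k)) ` nbox N n)"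
    by (simp add: sum.reindex[OF inj])
  also have "\<dots> \<le> (\<Sum>v\<in>nbox N m. g v)"
    by (rule sum_mono2) (auto simp: assms(1) intro: nbox_add assms(2,3))
  finally show ?thesis .
qed

text \<open>Division with remainder by \<open>l\<close> in every coordinate: the large box is cut
  into M^N boxes of side \<open>l\<close>, indexed by the quotients.\<close>

lemma nbox_mult: "0 < l \<Longrightarrow> bij_betw (\<lambda>(t, w). (\<lambda>k. l * t k + w k)) (nbox N M \<times> nbox N l) (nbox N (M * l))"
proof (rule bij_betw_byWitness[where f' = "\<lambda>v. ((\<lambda>k. v k div l), (\<lambda>k. v k mod l))"])
  assume l: "0 < l"
  have "l * t + w < M * l" if "t < M" "w < l" for t w
  proof -
    have "l * t + w < l * Suc t" using that by simp
    also have "\<dots> \<le> l * M" using that by (intro mult_le_mono) auto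
    finally show ?thesis by (simp add: mult.commute)
  qed
  then show "(\<lambda>(t, w). (\<lambda>k. l * t k + w k)) ` (nbox N M \<times> nbox N l) \<subseteq> nbox N (M * l)"
    by (auto simp: nbox_def)
  show "(\<lambda>v. ((\<lambda>k. v k div l), (\<lambda>k. v k mod l))) ` nbox N (M * l) \<subseteq> nbox N M \<times> nbox N l"
    using l by (auto simp: nbox_def less_mult_imp_div_less)
  have *: "(l * t + w) div l = t" "(l * t + w) mod l = w" if "w < l" for t w
    using that by auto
  have w: "w k < l" if "w \<in> nbox N l" for w k
    using that l by (cases "k < N") (auto simp: nbox_def)
  show "\<forall>p\<in>nbox N M \<times> nbox N l. (\<lambda>v. ((\<lambda>k. v k div l), (\<lambda>k. v k mod l)))
      ((\<lambda>(t, w). (\<lambda>k. l * t k + w k)) p) = p"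
  proof
    fix p assume "p \<in> nbox N M \<times> nbox N l"
    then obtain t u where p: "p = (t, u)" and u: "u \<in> nbox N l" by auto
    have "(\<lambda>k. (l * t k + u k) div l) = t" "(\<lambda>k. (l * t k + u k) mod l) = u"
      using *[OF w[OF u]] by blast+
    then show "(\<lambda>v. ((\<lambda>k. v k div l), (\<lambda>k. v k mod l))) ((\<lambda>(t, w). (\<lambda>k. l * t k + w k)) p) = p"
      by (simp add: p)
  qed
qed auto

section \<open>Second differences and box averages at different scales\<close>

definition D2 :: "nat \<Rightarrow> (nat \<Rightarrow> nat) \<Rightarrow> ((nat \<Rightarrow> nat) \<Rightarrow> real) \<Rightarrow> (nat \<Rightarrow> nat) \<Rightarrow> real" where
  "D2 l e f v = f (\<lambda>k. v k + 2 * l * e k) - 2 * f (\<lambda>k. v k + l * e k) + f v"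

definition bavg :: "nat \<Rightarrow> nat \<Rightarrow> ((nat \<Rightarrow> nat) \<Rightarrow> real) \<Rightarrow> (nat \<Rightarrow> nat) \<Rightarrow> real" where
  "bavg N l f v = (\<Sum>t\<in>nbox N l. f (\<lambda>k. v k + t k)) / real l ^ N"

text \<open>The step and the averaging box have the same side, so this is the lattice form of a
  second derivative mollified at scale \<open>l\<close>. The division by l^2 makes different scales
  comparable.\<close>

definition ad2 :: "nat \<Rightarrow> nat \<Rightarrow> (nat \<Rightarrow> nat) \<Rightarrow> ((nat \<Rightarrow> nat) \<Rightarrow> real) \<Rightarrow> (nat \<Rightarrow> nat) \<Rightarrow> real" where
  "ad2 N l e f v = bavg N l (D2 l e f) v / (real l)\<^sup>2"

lemma second_difference_telescope:
  fixes g :: "nat \<Rightarrow> real"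
  shows "g (2 * M) - 2 * g M + g 0 = (\<Sum>i<M. \<Sum>i'<M. g (i + i' + 2) - 2 * g (i + i' + 1) + g (i + i'))"
proof -
  have inner: "(\<Sum>i'<M. g (i + i' + 2) - 2 * g (i + i' + 1) + g (i + i'))
     = (g (i + M + 1) - g (i + M)) - (g (i + 1) - g i)" for i
  proof (induction M)
    case (Suc M) then show ?case by (simp add: algebra_simps)
  qed simp
  have "(\<Sum>i<n. (g (i + M + 1) - g (i + M)) - (g (i + 1) - g i)) = g (n + M) - g M - g n + g 0" for n
    by (induction n) auto
  from this[of M] have "(\<Sum>i<M. \<Sum>i'<M. g (i + i' + 2) - 2 * g (i + i' + 1) + g (i + i')) = g (M + M) - g M - g M + g 0"
    by (simp only: inner)
  then show ?thesis by (simp only: mult_2 diff_diff_eq)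
qed

lemma D2_refine:
  "D2 (M * l) e f v = (\<Sum>i<M. \<Sum>i'<M. D2 l e f (\<lambda>k. v k + l * ((i + i') * e k)))"
proof -
  define g where "g i = f (\<lambda>k. v k + l * (i * e k))" for i
  have "D2 (M * l) e f v = g (2 * M) - 2 * g M + g 0"
    by (simp add: D2_def g_def mult_ac)
  also have "\<dots> = (\<Sum>i<M. \<Sum>i'<M. g (i + i' + 2) - 2 * g (i + i' + 1) + g (i + i'))"
    by (rule second_difference_telescope)
  also have "\<dots> = (\<Sum>i<M. \<Sum>i'<M. D2 l e f (\<lambda>k. v k + l * ((i + i') * e k)))"
  proof (intro sum.cong refl)
    fix i i'
    have "v k + l * ((i + i' + 2) * e k) = v k + l * ((i + i') * e k) + 2 * l * e k"
      "v k + l * ((i + i' + 1) * e k) = v k + l * ((i + i') * e k) + l * e k" for k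
      by (simp_all add: distrib_left distrib_right)
    then show "g (i + i' + 2) - 2 * g (i + i' + 1) + g (i + i') = D2 l e f (\<lambda>k. v k + l * ((i + i') * e k))"
      by (simp only: D2_def g_def)
  qed
  finally show ?thesis .
qed

lemma bavg_refine:
  assumes "0 < l"
  shows "bavg N (M * l) f v = (\<Sum>t\<in>nbox N M. bavg N l f (\<lambda>k. v k + l * t k)) / real M ^ N"
proof -
  let ?F = "\<lambda>t. f (\<lambda>k. v k + t k)"
  have "sum ?F (nbox N (M * l)) = (\<Sum>p\<in>nbox N M \<times> nbox N l. ?F (case p of (t, w) \<Rightarrow> (\<lambda>k. l * t k + w k)))"
    by (rule sum.reindex_bij_betw[OF nbox_mult[OF assms], symmetric])
  also have "\<dots> = (\<Sum>t\<in>nbox N M. \<Sum>w\<in>nbox N l. ?F (\<lambda>k. l * t k + w k))"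
    unfolding sum.cartesian_product by (rule sum.cong[OF refl]) (simp only: split_paired_all case_prod_conv)
  also have "\<dots> = (\<Sum>t\<in>nbox N M. \<Sum>w\<in>nbox N l. f (\<lambda>k. v k + l * t k + w k))"
    by (simp only: add.assoc)
  finally have e: "sum ?F (nbox N (M * l)) = (\<Sum>t\<in>nbox N M. \<Sum>w\<in>nbox N l. f (\<lambda>k. v k + l * t k + w k))" .
  show ?thesis
    unfolding bavg_def e by (simp only: sum_divide_distrib[symmetric] of_nat_mult power_mult_distrib divide_divide_eq_left mult.commute)
qed

text \<open>In (i, i', t) the first two entries are the positions in the double telescoping sum of a
  second difference, and \<open>t\<close> is the subcell of the averaging box.\<close>

definition idx :: "nat \<Rightarrow> nat \<Rightarrow> (nat \<times> nat \<times> (nat \<Rightarrow> nat)) set" where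
  "idx N M = {..<M} \<times> {..<M} \<times> nbox N M"

definition idx_shift :: "nat \<Rightarrow> (nat \<Rightarrow> nat) \<Rightarrow> nat \<times> nat \<times> (nat \<Rightarrow> nat) \<Rightarrow> nat \<Rightarrow> nat" where
  "idx_shift l e s = (\<lambda>k. l * ((fst s + fst (snd s)) * e k + snd (snd s) k))"

lemma finite_idx [simp]: "finite (idx N M)" and card_idx: "card (idx N M) = M * (M * M ^ N)"
  by (auto simp: idx_def card_cartesian_product)

lemma idx_ne: "0 < M \<Longrightarrow> idx N M \<noteq> {}"
  using card_idx[of N M] by fastforce

text \<open>A difference of step \<open>M * l\<close> is a sum of M^2 differences of step
  \<open>l\<close>, and the averaging box splits into M^N boxes. The factor M^2 is exactly the
  change of normalization, so the coarse value is a plain mean of fine values and Jensen's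
  inequality can compare the two scales.\<close>

lemma ad2_refine:
  assumes "0 < l" "0 < M"
  shows "ad2 N (M * l) e f v = (\<Sum>s\<in>idx N M. ad2 N l e f (\<lambda>k. v k + idx_shift l e s k)) / card (idx N M)"
proof -
  have "bavg N (M * l) (D2 (M * l) e f) v
      = (\<Sum>t\<in>nbox N M. bavg N l (\<lambda>v. \<Sum>i<M. \<Sum>i'<M. D2 l e f (\<lambda>k. v k + l * ((i + i') * e k))) (\<lambda>k. v k + l * t k)) / real M ^ N"
    using bavg_refine[OF assms(1), of N M "D2 (M * l) e f" v]
    by (simp only: D2_refine[of M l e f, abs_def])
  also have "\<dots> = (\<Sum>t\<in>nbox N M. \<Sum>i<M. \<Sum>i'<M. bavg N l (D2 l e f) (\<lambda>k. v k + idx_shift l e (i, i', t) k)) / real M ^ N"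
  proof -
    have "bavg N l (\<lambda>v. \<Sum>i<M. \<Sum>i'<M. D2 l e f (\<lambda>k. v k + l * ((i + i') * e k))) w
      = (\<Sum>i<M. \<Sum>i'<M. bavg N l (D2 l e f) (\<lambda>k. w k + l * ((i + i') * e k)))" for w
    proof -
      have "(\<Sum>t\<in>nbox N l. \<Sum>i<M. \<Sum>i'<M. D2 l e f (\<lambda>k. w k + t k + l * ((i + i') * e k)))
         = (\<Sum>i<M. \<Sum>i'<M. \<Sum>t\<in>nbox N l. D2 l e f (\<lambda>k. w k + l * ((i + i') * e k) + t k))"
        by (subst sum.swap, rule sum.cong[OF refl], subst sum.swap) (simp add: add_ac)
      then show ?thesis by (simp add: bavg_def sum_divide_distrib)
    qed
    then show ?thesis by (simp add: idx_shift_def algebra_simps)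
  qed
  also have "(\<Sum>t\<in>nbox N M. \<Sum>i<M. \<Sum>i'<M. bavg N l (D2 l e f) (\<lambda>k. v k + idx_shift l e (i, i', t) k))
     = (\<Sum>s\<in>idx N M. bavg N l (D2 l e f) (\<lambda>k. v k + idx_shift l e s k))"
  proof -
    have "(\<Sum>t\<in>nbox N M. \<Sum>i<M. \<Sum>i'<M. g i i' t) = (\<Sum>i<M. \<Sum>i'<M. \<Sum>t\<in>nbox N M. g i i' t)"
      for g :: "nat \<Rightarrow> nat \<Rightarrow> (nat \<Rightarrow> nat) \<Rightarrow> real"
      by (subst sum.swap, rule sum.cong[OF refl], rule sum.swap)
    moreover have "sum H (idx N M) = (\<Sum>i<M. \<Sum>i'<M. \<Sum>t\<in>nbox N M. H (i, i', t))" for H :: "_ \<Rightarrow> real"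
      unfolding idx_def by (simp only: sum.cartesian_product')
    ultimately show ?thesis by simp
  qed
  finally have *: "bavg N (M * l) (D2 (M * l) e f) v
     = (\<Sum>s\<in>idx N M. bavg N l (D2 l e f) (\<lambda>k. v k + idx_shift l e s k)) / real M ^ N" .
  show ?thesis
    unfolding ad2_def * sum_divide_distrib[symmetric] card_idx
    using assms by (simp add: field_simps power2_eq_square)
qed

text \<open>The defect in Jensen's inequality for 1 / (1 + a). This convex function takes values in
  [0, 1] for a \<ge> 0, so the total energy is bounded by the number of points without any upper
  bound on second differences, which semiconvex functions do not have.\<close>

definition gap :: "'s set \<Rightarrow> ('s \<Rightarrow> real) \<Rightarrow> real" where
  "gap S a = (\<Sum>s\<in>S. 1 / (1 + a s)) / card S - 1 / (1 + (\<Sum>s\<in>S. a s) / card S)"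

text \<open>From each term the tangent at the mean \<open>b\<close> is subtracted; the linear parts
  cancel in the sum and squares over positive denominators remain.\<close>

lemma gap_eq:
  assumes "finite S" "S \<noteq> {}" "\<And>s. s \<in> S \<Longrightarrow> 0 \<le> a s"
  defines "b \<equiv> (\<Sum>s\<in>S. a s) / card S"
  shows "gap S a = (\<Sum>s\<in>S. (a s - b)\<^sup>2 / ((1 + a s) * (1 + b)\<^sup>2)) / card S"
proof -
  have b0: "0 \<le> b" by (simp add: b_def sum_nonneg assms)
  have c: "real (card S) > 0" using assms by (simp add: card_gt_0_iff)
  have *: "(a s - b)\<^sup>2 / ((1 + a s) * (1 + b)\<^sup>2) = 1 / (1 + a s) - 1 / (1 + b) + (a s - b) / (1 + b)\<^sup>2"
    if "s \<in> S" for s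
  proof -
    have "1 + a s \<noteq> 0" "1 + b \<noteq> 0" using assms(3)[OF that] b0 by auto
    then show ?thesis by (simp add: divide_simps) (simp add: algebra_simps power2_eq_square)
  qed
  have "(\<Sum>s\<in>S. (a s - b)\<^sup>2 / ((1 + a s) * (1 + b)\<^sup>2))
      = (\<Sum>s\<in>S. 1 / (1 + a s)) - card S * (1 / (1 + b)) + ((\<Sum>s\<in>S. a s) - card S * b) / (1 + b)\<^sup>2"
    by (simp add: * sum.distrib sum_subtractf sum_divide_distrib[symmetric] cong: sum.cong)
  also have "(\<Sum>s\<in>S. a s) - card S * b = 0" using c by (simp add: b_def)
  finally show ?thesis using c unfolding gap_def b_def[symmetric] by (simp add: field_simps)
qed

lemma gap_nonneg:
  assumes "finite S" "S \<noteq> {}" "\<And>s. s \<in> S \<Longrightarrow> 0 \<le> a s"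
  shows "0 \<le> gap S a"
  by (subst gap_eq[OF assms]) (auto intro!: divide_nonneg_nonneg sum_nonneg mult_nonneg_nonneg simp: assms)

text \<open>A single summand of \<open>gap_eq\<close> is at most \<open>card S\<close> times the
  gap, and a nonnegative value is at most \<open>card S\<close> times the mean, which bounds the
  denominators. The bound \<open>B\<close> on the mean will come from the pinching at contact
  points.\<close>

lemma gap_small:
  fixes B \<epsilon> :: real
  assumes "finite S" "S \<noteq> {}" "\<And>s. s \<in> S \<Longrightarrow> 0 \<le> a s"
    and b: "(\<Sum>s\<in>S. a s) / card S \<le> B" and g: "gap S a \<le> \<epsilon>" and s: "s \<in> S"
  shows "(a s - (\<Sum>s\<in>S. a s) / card S)\<^sup>2 \<le> card S * \<epsilon> * (1 + card S * B) * (1 + B)\<^sup>2"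
proof -
  define b where "b = (\<Sum>s\<in>S. a s) / card S"
  have b0: "0 \<le> b" by (simp add: b_def sum_nonneg assms)
  have bB: "b \<le> B" using b by (simp add: b_def)
  have c: "real (card S) > 0" using assms by (simp add: card_gt_0_iff)
  have "a s \<le> (\<Sum>s\<in>S. a s)" by (rule member_le_sum) (use assms in auto)
  also have "\<dots> = card S * b" using c by (simp add: b_def)
  also have "\<dots> \<le> card S * B" using bB c by (intro mult_left_mono) auto
  finally have as: "a s \<le> card S * B" .
  have as0: "0 \<le> a s" using assms by auto
  let ?t = "\<lambda>s. (a s - b)\<^sup>2 / ((1 + a s) * (1 + b)\<^sup>2)"
  have "?t s \<le> (\<Sum>s\<in>S. ?t s)"
    by (rule member_le_sum) (use assms b0 in auto)
  also have "\<dots> = card S * gap S a"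
    using c by (subst gap_eq[OF assms(1-3)]) (auto simp: b_def)
  also have "\<dots> \<le> card S * \<epsilon>" using g by (intro mult_left_mono) auto
  finally have "?t s \<le> card S * \<epsilon>" .
  moreover have pos: "0 < (1 + a s) * (1 + b)\<^sup>2" using as0 b0 by (intro mult_pos_pos) auto
  ultimately have 1: "(a s - b)\<^sup>2 \<le> card S * \<epsilon> * ((1 + a s) * (1 + b)\<^sup>2)"
    by (simp add: pos_divide_le_eq)
  have "0 \<le> ?t s" using pos by auto
  then have e: "0 \<le> card S * \<epsilon>" using \<open>?t s \<le> card S * \<epsilon>\<close> by linarith
  have "(1 + a s) * (1 + b)\<^sup>2 \<le> (1 + card S * B) * (1 + B)\<^sup>2"
    using as as0 b0 bB by (intro mult_mono power_mono) auto
  then have "card S * \<epsilon> * ((1 + a s) * (1 + b)\<^sup>2) \<le> card S * \<epsilon> * ((1 + card S * B) * (1 + B)\<^sup>2)"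
    using e by (rule mult_left_mono)
  then show ?thesis using 1 unfolding b_def[symmetric] by (simp only: mult.assoc)
qed

lemma ad2_nonneg:
  assumes "\<And>v. 0 \<le> D2 l e f v" shows "0 \<le> ad2 N l e f v"
  by (auto simp: ad2_def bavg_def intro!: divide_nonneg_nonneg sum_nonneg assms)

text \<open>By \<open>ad2_refine\<close> the left side is exactly the mean, over all shifts, of the
  fine energies on shifted boxes. A shift moves a coordinate by at most \<open>3 * (M * l)\<close>:
  twice \<open>M * l\<close> from the differences and once from the averaging box, so all shifted
  boxes lie in the larger one.\<close>

lemma energy_step:
  assumes "0 < l" "0 < M" and D: "\<And>v. 0 \<le> D2 l e f v"
    and e: "\<And>k. e k \<le> 1" "\<And>k. N \<le> k \<Longrightarrow> e k = 0"
    and n: "n + 3 * (M * l) \<le> n'"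
  shows "(\<Sum>v\<in>nbox N n. 1 / (1 + ad2 N (M * l) e f v))
      + (\<Sum>v\<in>nbox N n. gap (idx N M) (\<lambda>s. ad2 N l e f (\<lambda>k. v k + idx_shift l e s k)))
      \<le> (\<Sum>v\<in>nbox N n'. 1 / (1 + ad2 N l e f v))"
proof -
  have c: "0 < real (card (idx N M))" using assms(2) by (simp add: card_idx)
  have "(\<Sum>v\<in>nbox N n. 1 / (1 + ad2 N (M * l) e f v)) + (\<Sum>v\<in>nbox N n. gap (idx N M) (\<lambda>s. ad2 N l e f (\<lambda>k. v k + idx_shift l e s k)))
    = (\<Sum>v\<in>nbox N n. (\<Sum>s\<in>idx N M. 1 / (1 + ad2 N l e f (\<lambda>k. v k + idx_shift l e s k))) / card (idx N M))"
    unfolding sum.distrib[symmetric]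
    by (intro sum.cong refl) (simp add: gap_def ad2_refine[OF assms(1,2)])
  also have "\<dots> = (\<Sum>s\<in>idx N M. \<Sum>v\<in>nbox N n. 1 / (1 + ad2 N l e f (\<lambda>k. v k + idx_shift l e s k))) / card (idx N M)"
    by (subst sum.swap) (simp add: sum_divide_distrib)
  also have "\<dots> \<le> (\<Sum>s\<in>idx N M. \<Sum>v\<in>nbox N n'. 1 / (1 + ad2 N l e f v)) / card (idx N M)"
  proof (intro divide_right_mono sum_mono)
    fix s assume s: "s \<in> idx N M"
    show "(\<Sum>v\<in>nbox N n. 1 / (1 + ad2 N l e f (\<lambda>k. v k + idx_shift l e s k))) \<le> (\<Sum>v\<in>nbox N n'. 1 / (1 + ad2 N l e f v))"
    proof (rule sum_nbox_shift[where g = "\<lambda>v. 1 / (1 + ad2 N l e f v)"])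
      show "0 \<le> 1 / (1 + ad2 N l e f v)" for v using ad2_nonneg[of l e f N v] D by auto
      fix k
      obtain i i' t where st: "s = (i, i', t)" by (cases s) auto
      have i: "i < M" "i' < M" "t \<in> nbox N M" using s st by (auto simp: idx_def)
      show "idx_shift l e s k + n \<le> n'" if "k < N"
      proof -
        have "(i + i') * e k \<le> (M + M) * 1" using i e(1)[of k] by (intro mult_le_mono) auto
        then have "(i + i') * e k \<le> 2 * M" by (simp add: mult_2)
        moreover have "t k < M" using i(3) that by (auto simp: nbox_def)
        ultimately have "(i + i') * e k + t k \<le> 3 * M" by linarith
        then have "l * ((i + i') * e k + t k) \<le> l * (3 * M)" by (rule mult_le_mono2)
        moreover have "l * (3 * M) = 3 * (M * l)" by simp
        ultimately show ?thesis using n unfolding idx_shift_def st fst_conv snd_conv by linarith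
      qed
      show "idx_shift l e s k = 0" if "N \<le> k"
        using i that e(2) by (auto simp: idx_shift_def st nbox_def)
    qed
  qed auto
  also have "\<dots> = (\<Sum>v\<in>nbox N n'. 1 / (1 + ad2 N l e f v))"
    using c by (subst sum_constant) (rule nonzero_mult_div_cancel_left, linarith)
  finally show ?thesis .
qed

text \<open>The energies at the scales \<open>M ^ 0, \<dots>, M ^ J\<close> telescope, so that one of the \<open>J\<close> increments is a fraction
  \<open>1 / J\<close> of the total.\<close>

lemma energy_pigeonhole:
  assumes M: "2 \<le> M" and J: "0 < J" and Es: "finite Es"
    and D: "\<And>l e v. e \<in> Es \<Longrightarrow> 0 \<le> D2 l e f v"
    and e: "\<And>e k. e \<in> Es \<Longrightarrow> e k \<le> 1" "\<And>e k. e \<in> Es \<Longrightarrow> N \<le> k \<Longrightarrow> e k = 0"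
  shows "\<exists>k<J. (\<Sum>v\<in>nbox N (b * M ^ J). \<Sum>e\<in>Es. gap (idx N M)
      (\<lambda>s. ad2 N (M ^ (J - Suc k)) e f (\<lambda>j. v j + idx_shift (M ^ (J - Suc k)) e s j)))
      \<le> card Es * (real (b + 6) * real M ^ J) ^ N / J"
proof (rule ccontr)
  define G where "G k v = (\<Sum>e\<in>Es. gap (idx N M)
      (\<lambda>s. ad2 N (M ^ (J - Suc k)) e f (\<lambda>j. v j + idx_shift (M ^ (J - Suc k)) e s j)))" for k v
  \<comment> \<open>The boxes grow as the scale shrinks: \<open>n (Suc k)\<close> exceeds
    \<open>n k\<close> by 6 (M^(J-k) - M^(J-k-1)), which is at least three times the coarser scale
    because M \<ge> 2, and \<open>n 0\<close> is \<open>b * M ^ J\<close>.\<close>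
  define n where "n k = (b + 6) * M ^ J - 6 * M ^ (J - k)" for k
  define F where "F k = (\<Sum>e\<in>Es. \<Sum>v\<in>nbox N (n k). 1 / (1 + ad2 N (M ^ (J - k)) e f v))" for k
  define W where "W = card Es * (real (b + 6) * real M ^ J) ^ N"
  have ai: "0 \<le> ad2 N l e f v" if "e \<in> Es" for l e v using ad2_nonneg D that by blast
  have G0: "0 \<le> G k v" for k v
    unfolding G_def by (intro sum_nonneg gap_nonneg) (use M ai idx_ne in auto)
  assume "\<not> ?thesis"
  then have neg: "W / J < (\<Sum>v\<in>nbox N (b * M ^ J). G k v)" if "k < J" for k
    using that by (auto simp: not_le G_def W_def)
  have step: "F k + W / J < F (Suc k)" if k: "k < J" for k
  proof -
    let ?l = "M ^ (J - Suc k)"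
    have l: "M ^ (J - k) = M * ?l" using k by (metis Suc_diff_Suc power_Suc)
    have nn: "n k + 3 * (M * ?l) \<le> n (Suc k)"
    proof -
      have "2 * ?l \<le> M * ?l" using M by simp
      moreover have "M * ?l \<le> M ^ J" using power_increasing[of "J - k" J M] M unfolding l by simp
      moreover have "(b + 6) * M ^ J = b * M ^ J + 6 * M ^ J" by (simp add: algebra_simps)
      ultimately show ?thesis unfolding n_def l by linarith
    qed
    have "F k + (\<Sum>v\<in>nbox N (n k). G k v) \<le> F (Suc k)"
      unfolding F_def G_def l
      by (subst sum.swap[of _ _ "nbox N (n k)"], subst sum.distrib[symmetric],
        rule sum_mono, rule energy_step) (use M D e nn in auto)
    moreover have "(\<Sum>v\<in>nbox N (b * M ^ J). G k v) \<le> (\<Sum>v\<in>nbox N (n k). G k v)"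
    proof (intro sum_mono2 nbox_mono)
      have "M ^ (J - k) \<le> M ^ J" using M by (intro power_increasing) auto
      then show "b * M ^ J \<le> n k" unfolding n_def by (simp add: algebra_simps)
    qed (auto simp: G0)
    ultimately show ?thesis using neg[OF k] by linarith
  qed
  have "real k * (W / J) + F 0 \<le> F k" if "k \<le> J" for k
    using that
  proof (induction k)
    case (Suc k) then show ?case using step[of k] by (simp add: algebra_simps add_divide_distrib)
  qed simp
  from this[of "J - 1"] have "real (J - 1) * (W / J) + F 0 \<le> F (J - 1)" by simp
  moreover have "F (J - 1) + W / J < F J" using step[of "J - 1"] J by simp
  moreover have "real (J - 1) * (W / J) + W / J = W" using J by (simp add: field_simps of_nat_diff)
  moreover have "0 \<le> F 0" unfolding F_def by (intro sum_nonneg) (auto simp: ai)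
  ultimately have "W < F J" by linarith
  moreover have "F J \<le> W"
  proof -
    have "(\<Sum>v\<in>nbox N (n J). 1 / (1 + ad2 N (M ^ (J - J)) e f v)) \<le> (real (b + 6) * real M ^ J) ^ N" if "e \<in> Es" for e
    proof -
      have "(\<Sum>v\<in>nbox N (n J). 1 / (1 + ad2 N (M ^ (J - J)) e f v)) \<le> (\<Sum>v\<in>nbox N (n J). 1)"
        by (intro sum_mono) (use ai[OF that] in \<open>auto simp: divide_le_eq\<close>)
      also have "\<dots> = real (n J) ^ N" by simp
      also have "\<dots> \<le> (real ((b + 6) * M ^ J)) ^ N"
        unfolding n_def by (intro power_mono) (auto simp del: of_nat_mult of_nat_add)
      finally show ?thesis by simp
    qed
    then have "F J \<le> (\<Sum>e\<in>Es. (real (b + 6) * real M ^ J) ^ N)" unfolding F_def by (intro sum_mono)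
    then show ?thesis by (simp add: W_def)
  qed
  ultimately show False by linarith
qed

subsection \<open>Functions with nearly constant second differences\<close>

definition unit_vec :: "nat \<Rightarrow> nat \<Rightarrow> nat" where
  "unit_vec j = (\<lambda>i. if i = j then 1 else 0)"

definition fd :: "nat \<Rightarrow> ((nat \<Rightarrow> nat) \<Rightarrow> real) \<Rightarrow> (nat \<Rightarrow> nat) \<Rightarrow> real" where
  "fd j g o' = g (o'(j := Suc (o' j))) - g o'"

lemma fd_commute: "fd j (fd k g) = fd k (fd j g)"
  by (cases "j = k") (auto simp: fd_def fun_eq_iff fun_upd_twist)

lemma D2_unit: "D2 1 (unit_vec j) g v = fd j (fd j g) v"
proof -
  have "(\<lambda>k. v k + 2 * 1 * unit_vec j k) = v(j := Suc (Suc (v j)))"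
    "(\<lambda>k. v k + 1 * unit_vec j k) = v(j := Suc (v j))"
    by (auto simp: unit_vec_def fun_eq_iff)
  then show ?thesis by (simp add: D2_def fd_def)
qed

definition unit_sum :: "nat \<Rightarrow> nat \<Rightarrow> nat \<Rightarrow> nat" where
  "unit_sum j k = (\<lambda>i. unit_vec j i + unit_vec k i)"

lemma third_difference_pure:
  assumes "\<bar>fd j (fd j g) v - c\<bar> \<le> \<tau>" "\<bar>fd j (fd j g) (v(l := Suc (v l))) - c\<bar> \<le> \<tau>"
  shows "\<bar>fd l (fd j (fd j g)) v\<bar> \<le> 2 * \<tau>"
  using assms unfolding fd_def[of l] by linarith

text \<open>Polarization on the lattice: twice the mixed difference equals
  \<open>djk - dj 2 + dk 0 - 2 * dk 1\<close>, a combination of second differences in three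
  directions. Each of these is within \<tau> of a constant for c = 0 and c = 1, so the constants
  cancel when the two mixed differences are subtracted. The factor 15 is generous.\<close>

lemma third_difference_mixed:
  fixes G :: "nat \<Rightarrow> nat \<Rightarrow> nat \<Rightarrow> real"
  assumes J: "\<And>a b c. a \<le> 3 \<Longrightarrow> b \<le> 3 \<Longrightarrow> c \<le> 3 \<Longrightarrow> \<bar>G (a + 2) b c - 2 * G (a + 1) b c + G a b c - cj\<bar> \<le> \<tau>"
    and K: "\<And>a b c. a \<le> 3 \<Longrightarrow> b \<le> 3 \<Longrightarrow> c \<le> 3 \<Longrightarrow> \<bar>G a (b + 2) c - 2 * G a (b + 1) c + G a b c - ck\<bar> \<le> \<tau>"
    and JK: "\<And>a b c. a \<le> 3 \<Longrightarrow> b \<le> 3 \<Longrightarrow> c \<le> 3 \<Longrightarrow> \<bar>G (a + 2) (b + 2) c - 2 * G (a + 1) (b + 1) c + G a b c - cjk\<bar> \<le> \<tau>"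
  shows "\<bar>(G 1 1 1 - G 1 0 1 - G 0 1 1 + G 0 0 1) - (G 1 1 0 - G 1 0 0 - G 0 1 0 + G 0 0 0)\<bar> \<le> 15 * \<tau>"
    and "\<bar>G 1 1 0 - G 1 0 0 - G 0 1 0 + G 0 0 0\<bar> \<le> (\<bar>cj\<bar> + \<bar>ck\<bar> + \<bar>cjk\<bar>) / 2 + 15 * \<tau>"
proof -
  define dj where "dj b c = G 2 b c - 2 * G 1 b c + G 0 b c" for b c
  define dk where "dk a c = G a 2 c - 2 * G a 1 c + G a 0 c" for a c
  define djk where "djk c = G 2 2 c - 2 * G 1 1 c + G 0 0 c" for c
  have J': "cj - \<tau> \<le> dj b c" "dj b c \<le> cj + \<tau>" if "b \<le> 2" "c \<le> 1" for b c
    using J[of 0 b c] that unfolding dj_def by (auto simp: numeral_2_eq_2 abs_le_iff)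
  have K': "ck - \<tau> \<le> dk a c" "dk a c \<le> ck + \<tau>" if "a \<le> 2" "c \<le> 1" for a c
    using K[of a 0 c] that unfolding dk_def by (auto simp: numeral_2_eq_2 abs_le_iff)
  have JK': "cjk - \<tau> \<le> djk c" "djk c \<le> cjk + \<tau>" if "c \<le> 1" for c
    using JK[of 0 0 c] that unfolding djk_def by (auto simp: numeral_2_eq_2 abs_le_iff)
  have t0: "0 \<le> \<tau>" using JK'[of 0] by simp
  have id': "2 * (G 1 1 c - G 1 0 c - G 0 1 c + G 0 0 c) = djk c - dj 2 c + dk 0 c - 2 * dk 1 c" for c
    unfolding dj_def dk_def djk_def by (simp add: algebra_simps)
  define X where "X c = G 1 1 c - G 1 0 c - G 0 1 c + G 0 0 c" for c
  have X: "X c = (djk c - dj 2 c + dk 0 c) / 2 - dk 1 c" for c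
    using id'[of c] unfolding X_def by (simp add: field_simps)
  have lin: "\<bar>((a' - b' + c') / 2 - d') - ((a - b + c) / 2 - d)\<bar> \<le> 15 * t"
    if "\<bar>a' - a\<bar> \<le> 2 * t" "\<bar>b' - b\<bar> \<le> 2 * t" "\<bar>c' - c\<bar> \<le> 2 * t" "\<bar>d' - d\<bar> \<le> 2 * t" for a b c d a' b' c' d' t :: real
  proof -
    have "((a' - b' + c') / 2 - d') - ((a - b + c) / 2 - d) = ((a' - a) - (b' - b) + (c' - c)) / 2 - (d' - d)"
      by (simp add: field_simps)
    then show ?thesis using that by (simp add: abs_le_iff field_simps)
  qed
  have "\<bar>X 1 - X 0\<bar> \<le> 15 * \<tau>" unfolding X
  proof (rule lin)
    show "\<bar>djk 1 - djk 0\<bar> \<le> 2 * \<tau>" using JK'[of 0] JK'[of 1] by simp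
    show "\<bar>dj 2 1 - dj 2 0\<bar> \<le> 2 * \<tau>" using J'[of 2 0] J'[of 2 1] by simp
    show "\<bar>dk 0 1 - dk 0 0\<bar> \<le> 2 * \<tau>" using K'[of 0 0] K'[of 0 1] by simp
    show "\<bar>dk 1 1 - dk 1 0\<bar> \<le> 2 * \<tau>" using K'[of 1 0] K'[of 1 1] by simp
  qed
  then show "\<bar>(G 1 1 1 - G 1 0 1 - G 0 1 1 + G 0 0 1) - (G 1 1 0 - G 1 0 0 - G 0 1 0 + G 0 0 0)\<bar> \<le> 15 * \<tau>"
    by (simp only: X_def)
  have lin2: "\<bar>(a - b + c) / 2 - d\<bar> \<le> (\<bar>cj\<bar> + \<bar>ck\<bar> + \<bar>cjk\<bar>) / 2 + 15 * t"
    if "\<bar>a - cjk\<bar> \<le> t" "\<bar>b - cj\<bar> \<le> t" "\<bar>c - ck\<bar> \<le> t" "\<bar>d - ck\<bar> \<le> t" for a b c d t :: real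
  proof -
    have "(a - b + c) / 2 - d = (cjk - cj - ck) / 2 + ((a - cjk) - (b - cj) + (c - ck)) / 2 - (d - ck)"
      by (simp add: field_simps)
    moreover have "\<bar>(cjk - cj - ck) / 2\<bar> \<le> (\<bar>cj\<bar> + \<bar>ck\<bar> + \<bar>cjk\<bar>) / 2" by simp
    moreover have "\<bar>((a - cjk) - (b - cj) + (c - ck)) / 2 - (d - ck)\<bar> \<le> 15 * t"
      using that by (simp add: abs_le_iff field_simps)
    ultimately show ?thesis by linarith
  qed
  have "\<bar>X 0\<bar> \<le> (\<bar>cj\<bar> + \<bar>ck\<bar> + \<bar>cjk\<bar>) / 2 + 15 * \<tau>" unfolding X
    by (rule lin2) (use J'[of 2 0] K'[of 0 0] K'[of 1 0] JK'[of 0] in \<open>auto simp: abs_le_iff\<close>)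
  then show "\<bar>G 1 1 0 - G 1 0 0 - G 0 1 0 + G 0 0 0\<bar> \<le> (\<bar>cj\<bar> + \<bar>ck\<bar> + \<bar>cjk\<bar>) / 2 + 15 * \<tau>"
    by (simp only: X_def)
qed

lemma nbox_upd: "v \<in> nbox N n \<Longrightarrow> j < N \<Longrightarrow> v(j := Suc (v j)) \<in> nbox N (Suc n)"
  by (auto simp: nbox_def less_Suc_eq)

text \<open>The reserve 7 = 3 + 3 + 1 is the furthest that the base points a, b, e can move in one
  coordinate when the directions j, k, l coincide there. Equal indices are a pure second difference;
  distinct ones need the direction \<open>unit_sum j k\<close>.\<close>

lemma second_differences_nearly_constant:
  assumes D: "\<And>j v. j < N \<Longrightarrow> v \<in> nbox N (n + 7) \<Longrightarrow> \<bar>D2 1 (unit_vec j) g v - c j\<bar> \<le> \<tau>"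
    and DD: "\<And>j k v. j < N \<Longrightarrow> k < N \<Longrightarrow> j \<noteq> k \<Longrightarrow> v \<in> nbox N (n + 7) \<Longrightarrow> \<bar>D2 1 (unit_sum j k) g v - c' j k\<bar> \<le> \<tau>"
    and c: "\<And>j. j < N \<Longrightarrow> \<bar>c j\<bar> \<le> B" "\<And>j k. j < N \<Longrightarrow> k < N \<Longrightarrow> \<bar>c' j k\<bar> \<le> B"
    and jkl: "j < N" "k < N" "l < N" and v: "v \<in> nbox N n"
  shows "\<bar>fd l (fd j (fd k g)) v\<bar> \<le> 15 * \<tau>" "\<bar>fd j (fd k g) v\<bar> \<le> 2 * B + 15 * \<tau>"
proof -
  have t0: "0 \<le> \<tau>"
    using D[OF jkl(1), of v] v nbox_mono[of n "n + 7" N] by force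
  have v7: "v \<in> nbox N (n + 7)" "\<And>i. i < N \<Longrightarrow> v(i := Suc (v i)) \<in> nbox N (n + 7)"
    using v nbox_mono[of n "n + 7" N] nbox_mono[of "Suc n" "n + 7" N] nbox_upd[OF v] by auto
  have pure: "\<bar>fd b (fd a (fd a g)) v\<bar> \<le> 15 * \<tau>" if "a < N" "b < N" for a b
  proof -
    have "\<bar>fd b (fd a (fd a g)) v\<bar> \<le> 2 * \<tau>"
      using D[OF that(1) v7(1)] D[OF that(1) v7(2)[OF that(2)]] unfolding D2_unit
      by (rule third_difference_pure)
    then show ?thesis using t0 by linarith
  qed
  define G where "G a b e = g (\<lambda>i. v i + a * unit_vec j i + b * unit_vec k i + e * unit_vec l i)" for a b e
  have inbox: "(\<lambda>i. v i + a * unit_vec j i + b * unit_vec k i + e * unit_vec l i) \<in> nbox N (n + 7)"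
    if "a \<le> 3" "b \<le> 3" "e \<le> 1" for a b e
  proof -
    define d where "d = (\<lambda>i. a * unit_vec j i + b * unit_vec k i + e * unit_vec l i)"
    have "a * unit_vec j i \<le> 3" "b * unit_vec k i \<le> 3" "e * unit_vec l i \<le> 1" for i
      using that by (auto simp: unit_vec_def)
    then have "d i \<le> 7" for i unfolding d_def by (rule order_trans[OF add_mono[OF add_mono]]) auto
    moreover have "d i = 0" if "N \<le> i" for i
      using that jkl by (auto simp: unit_vec_def d_def)
    ultimately have "(\<lambda>i. v i + d i) \<in> nbox N (n + 7)"
      by (intro nbox_add[OF v]) auto
    then show ?thesis by (simp only: d_def add.assoc)
  qed
  have mixed: "\<bar>fd l (fd j (fd k g)) v\<bar> \<le> 15 * \<tau> \<and> \<bar>fd j (fd k g) v\<bar> \<le> (B + B + B) / 2 + 15 * \<tau>" if ne: "j \<noteq> k"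
  proof -
    have J: "\<bar>G (a + 2) b e - 2 * G (a + 1) b e + G a b e - c j\<bar> \<le> \<tau>" if "a \<le> 3" "b \<le> 3" "e \<le> 1" for a b e
      using D[OF jkl(1) inbox[OF that]] unfolding D2_def G_def by (simp add: algebra_simps)
    have K: "\<bar>G a (b + 2) e - 2 * G a (b + 1) e + G a b e - c k\<bar> \<le> \<tau>" if "a \<le> 3" "b \<le> 3" "e \<le> 1" for a b e
      using D[OF jkl(2) inbox[OF that]] unfolding D2_def G_def by (simp add: algebra_simps)
    have JK: "\<bar>G (a + 2) (b + 2) e - 2 * G (a + 1) (b + 1) e + G a b e - c' j k\<bar> \<le> \<tau>" if "a \<le> 3" "b \<le> 3" "e \<le> 1" for a b e
      using DD[OF jkl(1,2) ne inbox[OF that]] unfolding D2_def G_def unit_sum_def by (simp add: algebra_simps)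
    have e: "fd j (fd k g) v = G 1 1 0 - G 1 0 0 - G 0 1 0 + G 0 0 0"
    proof -
      have "G 1 1 0 = g ((v(j := Suc (v j)))(k := Suc ((v(j := Suc (v j))) k)))"
        "G 1 0 0 = g (v(j := Suc (v j)))" "G 0 1 0 = g (v(k := Suc (v k)))" "G 0 0 0 = g v"
        unfolding G_def by (rule arg_cong[of _ _ g], use ne in \<open>auto simp: unit_vec_def fun_eq_iff\<close>)+
      then show ?thesis unfolding fd_def by linarith
    qed
    have e1: "fd j (fd k g) (v(l := Suc (v l))) = G 1 1 1 - G 1 0 1 - G 0 1 1 + G 0 0 1"
    proof -
      define w where "w = v(l := Suc (v l))"
      have "G 1 1 1 = g ((w(j := Suc (w j)))(k := Suc ((w(j := Suc (w j))) k)))"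
        "G 1 0 1 = g (w(j := Suc (w j)))" "G 0 1 1 = g (w(k := Suc (w k)))" "G 0 0 1 = g w"
        unfolding G_def w_def by (rule arg_cong[of _ _ g], use ne in \<open>auto simp: unit_vec_def fun_eq_iff\<close>)+
      then show ?thesis unfolding w_def[symmetric] unfolding fd_def by linarith
    qed
    \<comment> \<open>Truncating the third argument by \<open>min e 1\<close> reduces the hypotheses
      for c \<le> 3 to the two layers e = 0 and e = 1 that lie in the box.\<close>
    note T = third_difference_mixed[of "\<lambda>a b e. G a b (min e 1)" "c j" \<tau> "c k" "c' j k"]
    have "\<bar>(G 1 1 1 - G 1 0 1 - G 0 1 1 + G 0 0 1) - (G 1 1 0 - G 1 0 0 - G 0 1 0 + G 0 0 0)\<bar> \<le> 15 * \<tau>"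
      "\<bar>G 1 1 0 - G 1 0 0 - G 0 1 0 + G 0 0 0\<bar> \<le> (\<bar>c j\<bar> + \<bar>c k\<bar> + \<bar>c' j k\<bar>) / 2 + 15 * \<tau>"
      using T J K JK by simp_all
    moreover have "(\<bar>c j\<bar> + \<bar>c k\<bar> + \<bar>c' j k\<bar>) / 2 \<le> (B + B + B) / 2"
      using c(1)[OF jkl(1)] c(1)[OF jkl(2)] c(2)[OF jkl(1,2)] by simp
    ultimately show ?thesis unfolding e fd_def[of l "fd j (fd k g)"] e1 by linarith
  qed
  have B0: "0 \<le> B" using c(1)[OF jkl(1)] by linarith
  show "\<bar>fd l (fd j (fd k g)) v\<bar> \<le> 15 * \<tau>"
    using mixed pure[OF jkl(1,3)] by (cases "j = k") auto
  show "\<bar>fd j (fd k g) v\<bar> \<le> 2 * B + 15 * \<tau>"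
  proof (cases "j = k")
    case True
    then show ?thesis using D[OF jkl(1) v7(1)] c(1)[OF jkl(1)] B0 t0 unfolding D2_unit by simp
  next
    case False
    then show ?thesis using mixed B0 by simp
  qed
qed

text \<open>Integration along a monotone lattice path from the origin to \<open>v\<close>, which has
  at most \<open>N * n\<close> unit steps.\<close>

lemma nbox_path_bound:
  assumes 0: "w (\<lambda>_. 0) = (0::real)" and st: "\<And>j v. j < N \<Longrightarrow> v \<in> nbox N n \<Longrightarrow> \<bar>fd j w v\<bar> \<le> B"
    and v: "v \<in> nbox N n"
  shows "\<bar>w v\<bar> \<le> B * real (N * n)"
proof -
  have "\<bar>w v\<bar> \<le> B * real (\<Sum>k<N. v k)" using v
  proof (induction "\<Sum>k<N. v k" arbitrary: v)
    case 0
    then have "v k = 0" if "k < N" for k using that by auto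
    then have "v k = 0" for k using 0 by (cases "k < N") (auto simp: nbox_def)
    then have "v = (\<lambda>_. 0)" by auto
    then show ?case using assms(1) by simp
  next
    case (Suc m)
    then obtain j where j: "j < N" "v j \<noteq> 0" by (metis lessThan_iff nat.distinct(1) sum.neutral)
    define v' where "v' = v(j := v j - 1)"
    have v'b: "v' \<in> nbox N n" using Suc.prems j by (auto simp: v'_def nbox_def less_imp_diff_less)
    have vv: "v = v'(j := Suc (v' j))" using j by (auto simp: v'_def)
    have "(\<Sum>k<N. v k) = v j + (\<Sum>k\<in>{..<N} - {j}. v k)" "(\<Sum>k<N. v' k) = v' j + (\<Sum>k\<in>{..<N} - {j}. v' k)"
      using j by (auto intro: sum.remove)
    moreover have "(\<Sum>k\<in>{..<N} - {j}. v' k) = (\<Sum>k\<in>{..<N} - {j}. v k)" by (rule sum.cong) (auto simp: v'_def)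
    ultimately have s: "(\<Sum>k<N. v k) = Suc (\<Sum>k<N. v' k)" using j by (simp add: v'_def)
    have "\<bar>w v'\<bar> \<le> B * real (\<Sum>k<N. v' k)" by (rule Suc.hyps(1)) (use s Suc.hyps(2) v'b in auto)
    moreover have "\<bar>w v - w v'\<bar> \<le> B" using st[OF j(1) v'b] vv by (simp add: fd_def)
    ultimately show ?case unfolding s by (simp add: algebra_simps)
  qed
  moreover have "0 \<le> B \<or> N = 0" using st[OF _ v] by (metis abs_ge_zero gr0I order_trans)
  moreover have "(\<Sum>k<N. v k) \<le> N * n"
    using sum_bounded_above[of "{..<N}" v n] v by (auto simp: nbox_def less_imp_le)
  then have "real (\<Sum>k<N. v k) \<le> real (N * n)" by (rule of_nat_mono)
  ultimately show ?thesis by (smt (verit) mult_left_mono mult_is_0 of_nat_0 lessThan_0 sum.empty)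
qed

section \<open>Quadratic interpolation on the lattice\<close>

definition newton :: "nat \<Rightarrow> ((nat \<Rightarrow> nat) \<Rightarrow> real) \<Rightarrow> (nat \<Rightarrow> real) \<Rightarrow> real" where
  "newton N g x = g (\<lambda>_. 0) + ip N (\<lambda>j. fd j g (\<lambda>_. 0) - fd j (fd j g) (\<lambda>_. 0) / 2) x
     + qf N (\<lambda>j k. fd j (fd k g) (\<lambda>_. 0)) x / 2"

lemma qf_add_unit:
  assumes "j < N" "\<And>i k. A i k = A k i"
  shows "qf N A (x(j := x j + 1)) = qf N A x + 2 * (\<Sum>k<N. A j k * x k) + A j j"
proof -
  have r: "(\<Sum>k<N. B k * (x(j := x j + 1)) k) = (\<Sum>k<N. B k * x k) + B j" for B :: "nat \<Rightarrow> real"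
  proof -
    have "(\<Sum>k<N. B k * (x(j := x j + 1)) k) = (\<Sum>k<N. B k * x k + (if k = j then B k else 0))"
      by (rule sum.cong) (auto simp: algebra_simps)
    also have "\<dots> = (\<Sum>k<N. B k * x k) + B j" using assms(1) by (simp add: sum.distrib sum.delta)
    finally show ?thesis .
  qed
  have q: "qf N A y = (\<Sum>i<N. (\<Sum>k<N. A i k * y k) * y i)" for y
    by (simp add: qf_def sum_distrib_right sum_distrib_left mult_ac)
  have "qf N A (x(j := x j + 1)) = (\<Sum>i<N. ((\<Sum>k<N. A i k * x k) + A i j) * (x(j := x j + 1)) i)"
    unfolding q r ..
  also have "\<dots> = (\<Sum>i<N. ((\<Sum>k<N. A i k * x k) + A i j) * x i) + ((\<Sum>k<N. A j k * x k) + A j j)"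
    by (fact r[of "\<lambda>i. (\<Sum>k<N. A i k * x k) + A i j"])
  also have "\<dots> = qf N A x + (\<Sum>i<N. A j i * x i) + ((\<Sum>k<N. A j k * x k) + A j j)"
  proof -
    have "(\<Sum>i<N. A i j * x i) = (\<Sum>i<N. A j i * x i)" by (rule sum.cong[OF refl], rule arg_cong2[where f = "(*)", OF assms(2) refl])
    then show ?thesis unfolding q by (simp only: distrib_right sum.distrib)
  qed
  finally show ?thesis by simp
qed

text \<open>\<open>newton\<close> is Newton's forward interpolation polynomial of degree two; its
  correction by half of the pure second differences comes from the diagonal terms x (x - 1) / 2.
  Hence the remainder vanishes at the origin together with its first and second differences, and its
  third differences are those of \<open>g\<close>. Three integrations along paths cost the factor
  \<open>N * n\<close> each.\<close>

lemma newton_approx: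
  assumes T: "\<And>j k l v. j < N \<Longrightarrow> k < N \<Longrightarrow> l < N \<Longrightarrow> v \<in> nbox N n \<Longrightarrow> \<bar>fd l (fd j (fd k g)) v\<bar> \<le> \<tau>"
    and v: "v \<in> nbox N n"
  shows "\<bar>g v - newton N g (\<lambda>k. real (v k))\<bar> \<le> \<tau> * real (N * n) ^ 3"
proof -
  define A where "A j k = fd j (fd k g) (\<lambda>_. 0)" for j k
  have sym: "A j k = A k j" for j k unfolding A_def using fd_commute[of j k g] by simp
  define w where "w v = g v - newton N g (\<lambda>k. real (v k))" for v
  have up: "(\<lambda>k. real ((v(j := Suc (v j))) k)) = (\<lambda>k. real (v k))(j := real (v j) + 1)" for v j by auto
  have f1: "fd j w v = fd j g v - (fd j g (\<lambda>_. 0) + (\<Sum>k<N. A j k * v k))" if "j < N" for j v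
  proof -
    have "ip N a (x(j := x j + 1)) = ip N a x + a j" for a x
    proof -
      have "ip N a (x(j := x j + 1)) = (\<Sum>k<N. a k * x k + (if k = j then a k else 0))"
        unfolding ip_def by (rule sum.cong) (auto simp: algebra_simps)
      also have "\<dots> = ip N a x + a j" using that by (simp add: ip_def sum.distrib sum.delta)
      finally show ?thesis .
    qed
    from this[of _ "\<lambda>k. real (v k)"] qf_add_unit[OF that, of A "\<lambda>k. real (v k)"] sym
    show ?thesis unfolding fd_def[of j w] w_def newton_def up A_def[symmetric]
      by (simp add: fd_def[of j g v] A_def[of j j, symmetric] field_simps)
  qed
  have f2: "fd k (fd j w) v = fd k (fd j g) v - A j k" if "j < N" "k < N" for j k v
  proof -
    have "(\<Sum>i<N. A j i * real ((v(k := Suc (v k))) i)) = (\<Sum>i<N. A j i * real (v i) + (if i = k then A j i else 0))"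
      by (rule sum.cong) (auto simp: algebra_simps)
    also have "\<dots> = (\<Sum>i<N. A j i * real (v i)) + A j k" using that by (simp add: sum.distrib sum.delta)
    finally show ?thesis unfolding fd_def[of k] f1[OF that(1)] by simp
  qed
  have f3: "fd l (fd k (fd j w)) v = fd l (fd k (fd j g)) v" if "j < N" "k < N" for j k l v
    unfolding fd_def[of l] f2[OF that] by simp
  have z: "(\<lambda>_. 0) \<in> nbox N n" using v by (auto simp: nbox_def)
  have b2: "\<bar>fd k (fd j w) v\<bar> \<le> \<tau> * real (N * n)" if j: "j < N" and k: "k < N" and v: "v \<in> nbox N n" for j k v
  proof (rule nbox_path_bound[where w = "fd k (fd j w)", OF _ _ v])
    show "fd k (fd j w) (\<lambda>_. 0) = 0" unfolding f2[OF j k] A_def by (simp only: fd_commute[of j k g] diff_self)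
    fix l v assume "l < N" "v \<in> nbox N n"
    then show "\<bar>fd l (fd k (fd j w)) v\<bar> \<le> \<tau>" unfolding f3[OF j k] by (rule T[OF k j])
  qed
  have b1: "\<bar>fd j w v\<bar> \<le> \<tau> * real (N * n) * real (N * n)" if j: "j < N" and v: "v \<in> nbox N n" for j v
  proof (rule nbox_path_bound[where w = "fd j w", OF _ _ v])
    show "fd j w (\<lambda>_. 0) = 0" unfolding f1[OF j] by simp
  qed (rule b2[OF j])
  have "\<bar>w v\<bar> \<le> \<tau> * real (N * n) * real (N * n) * real (N * n)"
  proof (rule nbox_path_bound[where w = w, OF _ b1 v])
    show "w (\<lambda>_. 0) = 0" by (simp add: w_def newton_def qf_def ip_def)
  qed
  then show ?thesis by (simp add: w_def power3_eq_cube mult.assoc)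
qed

text \<open>Serves to pass from a lattice point to a real point of the same cell, which is why the
  coordinates differ by at most 1.\<close>

lemma newton_lipschitz:
  assumes G: "\<And>j. j < N \<Longrightarrow> \<bar>fd j g (\<lambda>_. 0)\<bar> \<le> G"
    and A: "\<And>j k. j < N \<Longrightarrow> k < N \<Longrightarrow> \<bar>fd j (fd k g) (\<lambda>_. 0)\<bar> \<le> A"
    and x: "\<And>k. k < N \<Longrightarrow> \<bar>x k\<bar> \<le> S" "\<And>k. k < N \<Longrightarrow> \<bar>y k\<bar> \<le> S" "\<And>k. k < N \<Longrightarrow> \<bar>x k - y k\<bar> \<le> 1"
  shows "\<bar>newton N g x - newton N g y\<bar> \<le> real N * (G + A / 2) + (real N)\<^sup>2 * A * S"
proof -
  let ?a = "\<lambda>j. fd j g (\<lambda>_. 0) - fd j (fd j g) (\<lambda>_. 0) / 2" and ?A = "\<lambda>j k. fd j (fd k g) (\<lambda>_. 0)"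
  have "\<bar>ip N ?a x - ip N ?a y\<bar> \<le> (\<Sum>k<N. (G + A / 2))"
    unfolding ip_diff_right[symmetric] unfolding ip_def
  proof (rule order_trans[OF sum_abs sum_mono])
    fix k assume "k \<in> {..<N}"
    then have k: "k < N" by simp
    have "\<bar>?a k\<bar> \<le> G + A / 2" using G[OF k] A[OF k k] by linarith
    then have "\<bar>?a k\<bar> * \<bar>x k - y k\<bar> \<le> (G + A / 2) * 1" using x(3)[OF k] by (intro mult_mono) auto
    then show "\<bar>?a k * (x k - y k)\<bar> \<le> G + A / 2" by (simp add: abs_mult)
  qed
  then have 1: "\<bar>ip N ?a x - ip N ?a y\<bar> \<le> real N * (G + A / 2)" by simp
  have "\<bar>qf N ?A x - qf N ?A y\<bar> \<le> (\<Sum>j<N. \<Sum>k<N. A * (2 * S))"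
    unfolding qf_def sum_subtractf[symmetric]
  proof (rule order_trans[OF sum_abs sum_mono], rule order_trans[OF sum_abs sum_mono])
    fix j k assume "j \<in> {..<N}" "k \<in> {..<N}"
    then have jk: "j < N" "k < N" by auto
    have "\<bar>x j * x k - y j * y k\<bar> = \<bar>x j * (x k - y k) + (x j - y j) * y k\<bar>" by (simp add: algebra_simps)
    also have "\<dots> \<le> \<bar>x j\<bar> * \<bar>x k - y k\<bar> + \<bar>x j - y j\<bar> * \<bar>y k\<bar>"
      by (metis abs_mult abs_triangle_ineq)
    also have "\<dots> \<le> S * 1 + 1 * S" by (intro add_mono mult_mono) (use x jk in \<open>auto intro: order_trans[OF abs_ge_zero]\<close>)
    finally have "\<bar>?A j k\<bar> * \<bar>x j * x k - y j * y k\<bar> \<le> A * (2 * S)"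
      using A[OF jk] by (intro mult_mono) (auto intro: order_trans[OF abs_ge_zero])
    then show "\<bar>?A j k * x j * x k - ?A j k * y j * y k\<bar> \<le> A * (2 * S)"
      by (simp add: abs_mult[symmetric] right_diff_distrib mult.assoc)
  qed
  then have 2: "\<bar>qf N ?A x - qf N ?A y\<bar> \<le> 2 * ((real N)\<^sup>2 * A * S)" by (simp add: power2_eq_square mult_ac)
  have "newton N g x - newton N g y = (ip N ?a x - ip N ?a y) + (qf N ?A x - qf N ?A y) / 2"
    by (simp add: newton_def field_simps)
  moreover have "\<bar>a + b / 2\<bar> \<le> P + Q" if "\<bar>a\<bar> \<le> P" "\<bar>b\<bar> \<le> 2 * Q" for a b P Q :: real
    using that by (simp add: abs_le_iff)
  ultimately show ?thesis using 1 2 by (simp only:)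
qed

text \<open>By polarization, second differences in these directions control all mixed ones.\<close>

definition dirs :: "nat \<Rightarrow> (nat \<Rightarrow> nat) set" where
  "dirs N = unit_vec ` {..<N} \<union> (\<lambda>(j, k). unit_sum j k) ` {(j, k) \<in> {..<N} \<times> {..<N}. j \<noteq> k}"

lemma finite_dirs [simp]: "finite (dirs N)"
proof -
  have "finite {(j, k) \<in> {..<N} \<times> {..<N}. j \<noteq> k}" by (rule finite_subset[of _ "{..<N} \<times> {..<N}"]) auto
  then show ?thesis by (simp add: dirs_def)
qed

lemma dirs_le: "e \<in> dirs N \<Longrightarrow> e k \<le> 1" and dirs_supp: "e \<in> dirs N \<Longrightarrow> N \<le> k \<Longrightarrow> e k = 0"
  by (auto simp: dirs_def unit_sum_def unit_vec_def split: if_splits)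

text \<open>A step of length \<open>R\<close> from \<open>a\<close> along its subgradient raises
  \<open>Ut\<close> by at least \<open>R\<close> times the norm of the subgradient, while
  \<open>Ut\<close> stays between 0 and M (2 R)^2. So subgradients on the smaller ball are at most
  \<open>4 * M * R\<close>.\<close>

lemma subgradient_lipschitz:
  assumes sub: "\<And>z. \<exists>g. \<forall>y. Ut y \<ge> Ut z + ip N g (\<lambda>k. y k - z k)"
    and up: "\<And>y. enorm N (\<lambda>k. y k - z0 k) \<le> 2 * R \<Longrightarrow> Ut y \<le> M * (enorm N (\<lambda>k. y k - z0 k))\<^sup>2"
    and lo: "\<And>y. enorm N (\<lambda>k. y k - z0 k) \<le> 2 * R \<Longrightarrow> 0 \<le> Ut y"
    and R: "0 < R" and M: "0 \<le> M"
    and y: "enorm N (\<lambda>k. y k - z0 k) \<le> R" and y': "enorm N (\<lambda>k. y' k - z0 k) \<le> R"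
  shows "\<bar>Ut y - Ut y'\<bar> \<le> 4 * M * R * enorm N (\<lambda>k. y k - y' k)"
proof -
  have one: "Ut a - Ut b \<le> 4 * M * R * enorm N (\<lambda>k. a k - b k)"
    if a: "enorm N (\<lambda>k. a k - z0 k) \<le> R" for a b
  proof -
    obtain g where g: "\<And>y. Ut y \<ge> Ut a + ip N g (\<lambda>k. y k - a k)" using sub by blast
    have gn: "enorm N g \<le> 4 * M * R"
    proof (cases "enorm N g = 0")
      case True then show ?thesis using M R by simp
    next
      case False
      define w where "w = (\<lambda>k. a k + (R / enorm N g) * g k)"
      have wa: "(\<lambda>k. w k - a k) = (\<lambda>k. (R / enorm N g) * g k)" by (auto simp: w_def)
      have "enorm N (\<lambda>k. w k - z0 k) \<le> enorm N (\<lambda>k. a k - z0 k) + enorm N (\<lambda>k. w k - a k)"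
        using enorm_triangle[of N "\<lambda>k. a k - z0 k" "\<lambda>k. w k - a k"] by (simp add: algebra_simps)
      also have "enorm N (\<lambda>k. w k - a k) = R" unfolding wa enorm_scale using False R by simp
      finally have w2: "enorm N (\<lambda>k. w k - z0 k) \<le> 2 * R" using a by simp
      have "ip N g (\<lambda>k. w k - a k) = R * enorm N g"
        unfolding wa ip_scale_right enorm_sq[symmetric] using False by (simp add: power2_eq_square)
      then have "R * enorm N g \<le> Ut w - Ut a" using g[of w] by simp
      also have "\<dots> \<le> M * (enorm N (\<lambda>k. w k - z0 k))\<^sup>2"
        using up[OF w2] lo[of a] a R by simp
      also have "\<dots> \<le> M * (2 * R)\<^sup>2" using w2 M by (intro mult_left_mono power_mono) auto
      also have "\<dots> = R * (4 * M * R)" by (simp add: power2_eq_square)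
      finally show ?thesis using R by simp
    qed
    have "Ut a - Ut b \<le> - ip N g (\<lambda>k. b k - a k)" using g[of b] by simp
    also have "\<dots> \<le> enorm N g * enorm N (\<lambda>k. b k - a k)" using ip_le[of N g "\<lambda>k. b k - a k"] by linarith
    also have "\<dots> \<le> 4 * M * R * enorm N (\<lambda>k. b k - a k)" by (intro mult_right_mono gn) auto
    finally show ?thesis by (simp only: enorm_minus_commute[of N a b])
  qed
  have "Ut y' - Ut y \<le> 4 * M * R * enorm N (\<lambda>k. y k - y' k)"
    using one[OF y', of y] by (simp only: enorm_minus_commute[of N y y'])
  then show ?thesis using one[OF y, of y'] by linarith
qed

lemma bavg_abs_le:
  assumes "\<And>t. t \<in> nbox N l \<Longrightarrow> \<bar>f (\<lambda>k. v k + t k)\<bar> \<le> B" "0 < l"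
  shows "\<bar>bavg N l f v\<bar> \<le> B"
proof -
  have "\<bar>\<Sum>t\<in>nbox N l. f (\<lambda>k. v k + t k)\<bar> \<le> (\<Sum>t\<in>nbox N l. B)"
    by (rule order_trans[OF sum_abs sum_mono]) (use assms in auto)
  then show ?thesis unfolding bavg_def using assms(2) by (simp add: abs_divide divide_le_eq mult.commute)
qed

lemma bavg_diff: "bavg N l f v - bavg N l g w = bavg N l (\<lambda>t. f (\<lambda>k. v k + t k) - g (\<lambda>k. w k + t k)) (\<lambda>_. 0)"
  by (simp add: bavg_def sum_subtractf diff_divide_distrib)

lemma bavg_const: "0 < l \<Longrightarrow> bavg N l (\<lambda>_. c) v = c"
  by (simp add: bavg_def)

lemma D2_bavg: "D2 1 e (\<lambda>t. bavg N l f (\<lambda>k. l * t k) / c) t = bavg N l (D2 l e f) (\<lambda>k. l * t k) / c"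
proof -
  have "(\<lambda>k. l * (t k + 2 * 1 * e k) + u k) = (\<lambda>k. (l * t k + u k) + 2 * l * e k)"
    "(\<lambda>k. l * (t k + 1 * e k) + u k) = (\<lambda>k. (l * t k + u k) + l * e k)" for u
    by (auto simp: algebra_simps)
  then show ?thesis
    unfolding D2_def bavg_def
    by (simp only: sum.distrib sum_subtractf sum_distrib_left[symmetric] add_divide_distrib diff_divide_distrib times_divide_eq_right)
qed

text \<open>All values involved lie between 0 and M R^2 / h^2, and the radius R is 3 N times the
  length \<open>h * l\<close> of one step. Dividing 2 M R^2 / h^2 by l^2 leaves 2 M (3 N)^2.\<close>

lemma ad2_bound:
  assumes m: "0 < m" and l': "0 < l'" and h: "0 < h" and M: "0 \<le> M"
    and up: "\<And>y. enorm N (\<lambda>k. y k - z0 k) \<le> real (24 * N * m * l') * h \<Longrightarrow> Ut y \<le> M * (enorm N (\<lambda>k. y k - z0 k))\<^sup>2"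
    and lo: "\<And>y. enorm N (\<lambda>k. y k - z0 k) \<le> real (24 * N * m * l') * h \<Longrightarrow> 0 \<le> Ut y"
    and z0: "\<And>k. k < N \<Longrightarrow> real (m * l') * h \<le> z0 k - c k" "\<And>k. k < N \<Longrightarrow> z0 k - c k \<le> 3 * real (m * l') * h"
    and e: "e \<in> dirs N"
  shows "\<bar>ad2 N (8 * m * l') e (\<lambda>w. Ut (\<lambda>k. c k + h * real (w k)) / h\<^sup>2) (\<lambda>_. 0)\<bar> \<le> 18 * M * (real N)\<^sup>2"
proof -
  let ?f = "\<lambda>w. Ut (\<lambda>k. c k + h * real (w k)) / h\<^sup>2"
  define R where "R = real (24 * N * m * l') * h"
  define l where "l = 8 * m * l'"
  have l0: "0 < l" using m l' by (simp add: l_def)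
  have f: "0 \<le> ?f w \<and> ?f w \<le> M * R\<^sup>2 / h\<^sup>2" if w: "\<And>k. k < N \<Longrightarrow> w k \<le> 24 * m * l'" for w
  proof -
    have "enorm N (\<lambda>k. (c k + h * real (w k)) - z0 k) \<le> real N * (real (24 * m * l') * h)"
    proof (rule enorm_le_sum)
      fix k assume k: "k < N"
      have "h * real (w k) \<le> h * real (24 * m * l')" using w[OF k] h by (intro mult_left_mono of_nat_mono) auto
      moreover have "0 \<le> h * real (w k)" using h by simp
      moreover have "0 \<le> real (m * l') * h" using h by simp
      ultimately show "\<bar>(c k + h * real (w k)) - z0 k\<bar> \<le> real (24 * m * l') * h"
        using z0[OF k] by (simp add: abs_le_iff algebra_simps)
    qed
    then have n: "enorm N (\<lambda>k. (c k + h * real (w k)) - z0 k) \<le> R" by (simp add: R_def mult_ac)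
    have "Ut (\<lambda>k. c k + h * real (w k)) \<le> M * (enorm N (\<lambda>k. (c k + h * real (w k)) - z0 k))\<^sup>2"
      using up n by (simp add: R_def)
    also have "\<dots> \<le> M * R\<^sup>2" using n M by (intro mult_left_mono power_mono) auto
    finally show ?thesis using lo n by (simp add: R_def divide_right_mono)
  qed
  have "\<bar>D2 l e ?f (\<lambda>k. 0 + t k)\<bar> \<le> 2 * (M * R\<^sup>2 / h\<^sup>2)" if t: "t \<in> nbox N l" for t
  proof -
    have tk: "t k < l" if "k < N" for k using t that by (auto simp: nbox_def)
    have ek: "l * e k \<le> l" for k using dirs_le[OF e, of k] by simp
    have b: "t k \<le> 24 * m * l'" "t k + l * e k \<le> 24 * m * l'" "t k + 2 * l * e k \<le> 24 * m * l'" if "k < N" for k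
    proof -
      have "t k + 2 * (l * e k) \<le> 3 * l" using tk[OF that] ek[of k] by linarith
      then show "t k \<le> 24 * m * l'" "t k + l * e k \<le> 24 * m * l'" "t k + 2 * l * e k \<le> 24 * m * l'"
        by (simp_all add: l_def)
    qed
    have 1: "0 \<le> ?f t \<and> ?f t \<le> M * R\<^sup>2 / h\<^sup>2" by (rule f) (rule b)
    have 2: "0 \<le> ?f (\<lambda>k. t k + l * e k) \<and> ?f (\<lambda>k. t k + l * e k) \<le> M * R\<^sup>2 / h\<^sup>2" by (rule f) (rule b)
    have 3: "0 \<le> ?f (\<lambda>k. t k + 2 * l * e k) \<and> ?f (\<lambda>k. t k + 2 * l * e k) \<le> M * R\<^sup>2 / h\<^sup>2" by (rule f) (rule b)
    have "\<bar>a - 2 * b + c\<bar> \<le> 2 * B" if "0 \<le> a \<and> a \<le> B" "0 \<le> b \<and> b \<le> B" "0 \<le> c \<and> c \<le> B" for a b c B :: real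
      using that by auto
    from this[OF 3 2 1] show ?thesis unfolding D2_def by simp
  qed
  then have "\<bar>bavg N l (D2 l e ?f) (\<lambda>_. 0)\<bar> \<le> 2 * (M * R\<^sup>2 / h\<^sup>2)" by (rule bavg_abs_le) (use l0 in auto)
  then have "\<bar>ad2 N l e ?f (\<lambda>_. 0)\<bar> \<le> 2 * (M * R\<^sup>2 / h\<^sup>2) / (real l)\<^sup>2"
    unfolding ad2_def abs_divide using l0 by (simp only: abs_power2) (intro divide_right_mono, auto)
  also have "\<dots> = 18 * M * (real N)\<^sup>2"
    using l0 h m l' by (simp add: R_def l_def power2_eq_square field_simps)
  finally show ?thesis by (simp add: l_def)
qed

text \<open>The averages over cells of side r = \<open>real l' * h\<close> have nearly constant
  second differences and hence are nearly quadratic. Replacing \<open>Ut\<close> by its average over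
  a cell costs its Lipschitz constant, of order m r, times r. This error is linear in m, while the
  squared radius of the ball is m^2 r^2; so m can be taken large first and \<tau> small
  afterwards.\<close>

lemma nearly_quadratic:
  assumes N: "0 < N" and m: "2 \<le> m" and l': "0 < l'" and h: "0 < h" and M: "0 \<le> M" and \<tau>: "0 < \<tau>" "\<tau> \<le> 1"
    and sub: "\<And>z. \<exists>g. \<forall>y. Ut y \<ge> Ut z + ip N g (\<lambda>k. y k - z k)"
    and up: "\<And>y. enorm N (\<lambda>k. y k - z0 k) \<le> 2 * (real (24 * N * m * l') * h) \<Longrightarrow> Ut y \<le> M * (enorm N (\<lambda>k. y k - z0 k))\<^sup>2"
    and lo: "\<And>y. enorm N (\<lambda>k. y k - z0 k) \<le> 2 * (real (24 * N * m * l') * h) \<Longrightarrow> 0 \<le> Ut y"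
    and z0: "\<And>k. k < N \<Longrightarrow> real (m * l') * h \<le> z0 k - c k" "\<And>k. k < N \<Longrightarrow> z0 k - c k \<le> 3 * real (m * l') * h"
  defines "f \<equiv> \<lambda>w. Ut (\<lambda>k. c k + h * real (w k)) / h\<^sup>2"
  assumes nc: "\<And>e t. e \<in> dirs N \<Longrightarrow> t \<in> nbox N (8 * m) \<Longrightarrow>
      \<bar>ad2 N l' e f (\<lambda>k. l' * t k) - ad2 N (8 * m * l') e f (\<lambda>_. 0)\<bar> \<le> \<tau>"
  defines "B \<equiv> 2 * (18 * M * (real N)\<^sup>2) + 15"
  shows "\<exists>c0 g A. (\<forall>j k. A j k = A k j) \<and> (\<forall>y. enorm N (\<lambda>k. y k - z0 k) \<le> real (m * l') * h \<longrightarrow>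
     \<bar>Ut y - (c0 + ip N g (\<lambda>k. y k - c k) + qf N A (\<lambda>k. y k - c k) / 2)\<bar>
       \<le> (15 * \<tau> * real (8 * m * N) ^ 3 + (96 * M * (real N)\<^sup>2 + 96 * M * real N ^ 3 + real N * B + 4 * (real N)\<^sup>2 * B) * real m) * (real l' * h)\<^sup>2)"
proof -
  define r where "r = real l' * h"
  define R where "R = real (24 * N * m * l') * h"
  have r0: "0 < r" using l' h by (simp add: r_def)
  have R0: "0 < R" using l' h m N by (simp add: R_def)
  have RR: "R = 24 * real N * real m * r" by (simp add: R_def r_def)
  have mr: "real (m * l') * h = real m * r" by (simp add: r_def)
  have N1: "1 \<le> real N" using N by simp
  have m1: "1 \<le> real m" using m by simp
  note z0' = z0[unfolded mult.assoc mr]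
  have up': "Ut y \<le> M * (enorm N (\<lambda>k. y k - z0 k))\<^sup>2" and lo': "0 \<le> Ut y"
    if "enorm N (\<lambda>k. y k - z0 k) \<le> 2 * R" for y using up lo that by (auto simp: R_def)
  have lip: "\<bar>Ut y - Ut y'\<bar> \<le> 96 * M * real N * real m * r * (real N * r)"
    if "enorm N (\<lambda>k. y k - z0 k) \<le> R" "enorm N (\<lambda>k. y' k - z0 k) \<le> R" "\<And>k. k < N \<Longrightarrow> \<bar>y k - y' k\<bar> \<le> r" for y y'
  proof -
    have "\<bar>Ut y - Ut y'\<bar> \<le> 4 * M * R * enorm N (\<lambda>k. y k - y' k)"
      by (rule subgradient_lipschitz[where ?z0.0 = z0]) (use sub up' lo' R0 M that in auto)
    also have "\<dots> \<le> 4 * M * R * (real N * r)"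
      using enorm_le_sum[of N "\<lambda>k. y k - y' k" r] that(3) M R0 by (intro mult_left_mono) auto
    finally show ?thesis by (simp add: RR mult_ac)
  qed
  \<comment> \<open>Cell averages in units where a cell has side 1. By \<open>D2_bavg\<close> the
    unit second differences of \<open>gg\<close> are the averaged second differences of
    \<open>f\<close> at scale \<open>l'\<close>.\<close>
  define gg where "gg t = bavg N l' f (\<lambda>k. l' * t k) / (real l')\<^sup>2" for t
  define Av where "Av e = ad2 N (8 * m * l') e f (\<lambda>_. 0)" for e
  define M0 where "M0 = 18 * M * (real N)\<^sup>2"
  have Av: "\<bar>Av e\<bar> \<le> M0" if "e \<in> dirs N" for e
    unfolding Av_def f_def M0_def
  proof (rule ad2_bound[where ?z0.0 = z0])
    fix y assume "enorm N (\<lambda>k. y k - z0 k) \<le> real (24 * N * m * l') * h"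
    then have "enorm N (\<lambda>k. y k - z0 k) \<le> 2 * R" unfolding R_def[symmetric] using R0 by linarith
    then show "Ut y \<le> M * (enorm N (\<lambda>k. y k - z0 k))\<^sup>2" "0 \<le> Ut y" by (rule up', rule lo')
  qed (use m l' h M z0 that in auto)
  have D: "\<bar>D2 1 e gg t - Av e\<bar> \<le> \<tau>" if "e \<in> dirs N" "t \<in> nbox N (8 * m)" for e t
    using nc[OF that] unfolding gg_def D2_bavg Av_def by (simp add: ad2_def)
  \<comment> \<open>Seven lattice steps are reserved for polarization. The points of the ball have
    lattice coordinates at most 4 m, which is below \<open>n\<close> because m \<ge> 2.\<close>
  define n where "n = 8 * m - 7"
  have n7: "n + 7 = 8 * m" using m by (simp add: n_def)
  have dv: "j < N \<Longrightarrow> unit_vec j \<in> dirs N" and ds: "j < N \<Longrightarrow> k < N \<Longrightarrow> j \<noteq> k \<Longrightarrow> unit_sum j k \<in> dirs N" for j k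
    by (auto simp: dirs_def)
  have M00: "0 \<le> M0" using M by (simp add: M0_def)
  have td: "\<bar>fd l (fd j (fd k gg)) v\<bar> \<le> 15 * \<tau>" and sd: "\<bar>fd j (fd k gg) v\<bar> \<le> B"
    if "j < N" "k < N" "l < N" "v \<in> nbox N n" for j k l v
  proof -
    note X = second_differences_nearly_constant[of N n gg "\<lambda>j. Av (unit_vec j)" \<tau>
        "\<lambda>j k. if j = k then 0 else Av (unit_sum j k)" M0 j k l v, unfolded n7]
    have "\<bar>fd l (fd j (fd k gg)) v\<bar> \<le> 15 * \<tau> \<and> \<bar>fd j (fd k gg) v\<bar> \<le> 2 * M0 + 15 * \<tau>"
      by (intro conjI X) (use that D Av dv ds M00 in auto)
    then show "\<bar>fd l (fd j (fd k gg)) v\<bar> \<le> 15 * \<tau>" "\<bar>fd j (fd k gg) v\<bar> \<le> B"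
      using \<tau> by (auto simp: B_def M0_def)
  qed
  have z_n: "(\<lambda>_. 0) \<in> nbox N n" using m by (auto simp: nbox_def n_def)
  have B0: "0 \<le> B" using M by (simp add: B_def)
  have ft: "enorm N (\<lambda>k. (c k + h * real (w k)) - z0 k) \<le> R" if w: "\<And>k. k < N \<Longrightarrow> w k \<le> 24 * m * l'" for w
  proof -
    have "enorm N (\<lambda>k. (c k + h * real (w k)) - z0 k) \<le> real N * (real (24 * m * l') * h)"
    proof (rule enorm_le_sum)
      fix k assume k: "k < N"
      have "h * real (w k) \<le> h * real (24 * m * l')" using w[OF k] h by (intro mult_left_mono of_nat_mono) auto
      moreover have "0 \<le> h * real (w k)" using h by simp
      moreover have "0 \<le> real (m * l') * h" using h by simp
      ultimately show "\<bar>(c k + h * real (w k)) - z0 k\<bar> \<le> real (24 * m * l') * h"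
        using z0[OF k] by (simp add: abs_le_iff algebra_simps)
    qed
    then show ?thesis by (simp add: R_def mult_ac)
  qed
  have near: "\<bar>Ut y / r\<^sup>2 - gg t\<bar> \<le> 96 * M * (real N)\<^sup>2 * real m"
    if y: "enorm N (\<lambda>k. y k - z0 k) \<le> R" and t: "\<And>k. k < N \<Longrightarrow> t k \<le> 23 * m"
      and yt: "\<And>k. k < N \<Longrightarrow> r * real (t k) \<le> y k - c k \<and> y k - c k \<le> r * (real (t k) + 1)" for y t
  proof -
    have "\<bar>bavg N l' (\<lambda>_. Ut y / h\<^sup>2) (\<lambda>_. 0) - bavg N l' f (\<lambda>k. l' * t k)\<bar> \<le> 96 * M * real N * real m * r * (real N * r) / h\<^sup>2"
      unfolding bavg_diff
    proof (rule bavg_abs_le)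
      fix u assume u: "u \<in> nbox N l'"
      have "\<bar>Ut y - Ut (\<lambda>k. c k + h * real (l' * t k + u k))\<bar> \<le> 96 * M * real N * real m * r * (real N * r)"
      proof (rule lip[OF y ft])
        fix k assume k: "k < N"
        have uk: "u k < l'" using u k by (auto simp: nbox_def)
        have "l' * t k + u k \<le> l' * (23 * m) + l' * 1" using t[OF k] uk by (intro add_mono mult_le_mono) auto
        also have "\<dots> = l' * (23 * m + 1)" by simp
        also have "\<dots> \<le> l' * (24 * m)" using m by (intro mult_le_mono) auto
        finally show "l' * t k + u k \<le> 24 * m * l'" by (simp add: mult_ac)
        have "h * real (u k) \<le> r" using uk h by (simp add: r_def mult.commute mult_right_mono)
        moreover have "0 \<le> h * real (u k)" using h by simp
        moreover have "h * real (l' * t k + u k) = r * real (t k) + h * real (u k)" by (simp add: r_def algebra_simps)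
        moreover have "r * (real (t k) + 1) = r * real (t k) + r" by (simp add: algebra_simps)
        ultimately show "\<bar>y k - (c k + h * real (l' * t k + u k))\<bar> \<le> r"
          using yt[OF k] unfolding abs_le_iff by linarith
      qed
      then show "\<bar>Ut y / h\<^sup>2 - f (\<lambda>k. l' * t k + (0 + u k))\<bar> \<le> 96 * M * real N * real m * r * (real N * r) / h\<^sup>2"
        using h by (simp add: f_def diff_divide_distrib[symmetric] abs_divide divide_right_mono)
    qed (use l' in auto)
    then have "\<bar>Ut y / h\<^sup>2 - bavg N l' f (\<lambda>k. l' * t k)\<bar> \<le> 96 * M * real N * real m * r * (real N * r) / h\<^sup>2"
      by (simp only: bavg_const[OF l'])
    then have "\<bar>Ut y / h\<^sup>2 - bavg N l' f (\<lambda>k. l' * t k)\<bar> / (real l')\<^sup>2 \<le> 96 * M * real N * real m * r * (real N * r) / h\<^sup>2 / (real l')\<^sup>2"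
      by (rule divide_right_mono) simp
    moreover have "\<bar>Ut y / h\<^sup>2 - bavg N l' f (\<lambda>k. l' * t k)\<bar> / (real l')\<^sup>2 = \<bar>Ut y / r\<^sup>2 - gg t\<bar>"
    proof -
      have "Ut y / r\<^sup>2 - gg t = (Ut y / h\<^sup>2 - bavg N l' f (\<lambda>k. l' * t k)) / (real l')\<^sup>2"
        by (simp add: gg_def r_def power_mult_distrib diff_divide_distrib mult.commute)
      then show ?thesis by (simp only: abs_divide abs_power2)
    qed
    moreover have "96 * M * real N * real m * r * (real N * r) / h\<^sup>2 / (real l')\<^sup>2 = 96 * M * (real N)\<^sup>2 * real m"
      using l' h by (simp add: r_def power2_eq_square field_simps)
    ultimately show ?thesis by simp
  qed
  have gr: "\<bar>fd j gg (\<lambda>_. 0)\<bar> \<le> 96 * M * (real N) * real m * real N" if j: "j < N" for j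
  proof -
    have e: "(\<lambda>_. 0)(j := Suc 0) = unit_vec j" by (auto simp: unit_vec_def)
    have "\<bar>bavg N l' f (\<lambda>k. l' * unit_vec j k) - bavg N l' f (\<lambda>k. l' * 0)\<bar> \<le> 96 * M * real N * real m * r * (real N * r) / h\<^sup>2"
      unfolding bavg_diff
    proof (rule bavg_abs_le)
      fix u assume u: "u \<in> nbox N l'"
      have "\<bar>Ut (\<lambda>k. c k + h * real (l' * unit_vec j k + u k)) - Ut (\<lambda>k. c k + h * real (l' * 0 + u k))\<bar> \<le> 96 * M * real N * real m * r * (real N * r)"
      proof (rule lip[OF ft ft])
        fix k assume k: "k < N"
        have uk: "u k < l'" using u k by (auto simp: nbox_def)
        have "l' * unit_vec j k + u k \<le> l' * 1 + l' * 1" using uk by (intro add_mono mult_le_mono) (auto simp: unit_vec_def)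
        also have "\<dots> = l' * 2" by simp
        also have "\<dots> \<le> l' * (24 * m)" using m by (intro mult_le_mono) auto
        finally show "l' * unit_vec j k + u k \<le> 24 * m * l'" by (simp add: mult_ac)
        then show "l' * 0 + u k \<le> 24 * m * l'" by simp
        show "\<bar>c k + h * real (l' * unit_vec j k + u k) - (c k + h * real (l' * 0 + u k))\<bar> \<le> r"
          using h r0 by (auto simp: r_def unit_vec_def algebra_simps)
      qed
      then show "\<bar>f (\<lambda>k. l' * unit_vec j k + (0 + u k)) - f (\<lambda>k. l' * 0 + (0 + u k))\<bar> \<le> 96 * M * real N * real m * r * (real N * r) / h\<^sup>2"
        using h by (simp add: f_def diff_divide_distrib[symmetric] abs_divide divide_right_mono)
    qed (use l' in auto)
    then have "\<bar>bavg N l' f (\<lambda>k. l' * unit_vec j k) - bavg N l' f (\<lambda>k. l' * 0)\<bar> / (real l')\<^sup>2 \<le> 96 * M * real N * real m * r * (real N * r) / h\<^sup>2 / (real l')\<^sup>2"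
      by (rule divide_right_mono) simp
    moreover have "96 * M * real N * real m * r * (real N * r) / h\<^sup>2 / (real l')\<^sup>2 = 96 * M * (real N) * real m * real N"
      using l' h by (simp add: r_def power2_eq_square field_simps)
    moreover have "fd j gg (\<lambda>_. 0) = (bavg N l' f (\<lambda>k. l' * unit_vec j k) - bavg N l' f (\<lambda>k. l' * 0)) / (real l')\<^sup>2"
      unfolding fd_def gg_def using e by (simp add: diff_divide_distrib)
    ultimately show ?thesis by (simp add: abs_divide)
  qed
  define A where "A j k = fd j (fd k gg) (\<lambda>_. 0)" for j k
  define ga where "ga j = r * (fd j gg (\<lambda>_. 0) - fd j (fd j gg) (\<lambda>_. 0) / 2)" for j
  define c0 where "c0 = r\<^sup>2 * gg (\<lambda>_. 0)"
  have sym: "\<forall>j k. A j k = A k j" unfolding A_def by (metis fd_commute)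
  have qs: "qf N A (\<lambda>k. a * x k) = a\<^sup>2 * qf N A x" for a x A
    by (simp add: qf_def sum_distrib_left power2_eq_square mult_ac)
  have nw: "c0 + ip N ga (\<lambda>k. y k - c k) + qf N A (\<lambda>k. y k - c k) / 2 = r\<^sup>2 * newton N gg (\<lambda>k. (1 / r) * (y k - c k))" for y
    unfolding newton_def A_def[symmetric] qs ip_scale_right c0_def ga_def[abs_def] ip_scale_left
    using r0 by (simp add: power2_eq_square field_simps)
  let ?E = "15 * \<tau> * real (8 * m * N) ^ 3 + (96 * M * (real N)\<^sup>2 + 96 * M * real N ^ 3 + real N * B + 4 * (real N)\<^sup>2 * B) * real m"
  have "\<bar>Ut y - (c0 + ip N ga (\<lambda>k. y k - c k) + qf N A (\<lambda>k. y k - c k) / 2)\<bar> \<le> ?E * (real l' * h)\<^sup>2"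
    if y: "enorm N (\<lambda>k. y k - z0 k) \<le> real (m * l') * h" for y
  proof -
    define x where "x = (\<lambda>k. (1 / r) * (y k - c k))"
    have yk: "\<bar>y k - z0 k\<bar> \<le> real m * r" if "k < N" for k
      using abs_le_enorm[OF that, of "\<lambda>k. y k - z0 k"] y unfolding mr by linarith
    have xk: "0 \<le> x k" "x k \<le> 4 * real m" if "k < N" for k
    proof -
      have "real m * r \<le> z0 k - c k" "z0 k - c k \<le> 3 * (real m * r)" using z0'[OF that] by (simp_all add: mult.assoc)
      then have "0 \<le> y k - c k" "y k - c k \<le> 4 * (real m * r)" using yk[OF that] by (simp_all add: abs_le_iff)
      then show "0 \<le> x k" "x k \<le> 4 * real m" using r0 by (simp_all add: x_def field_simps)
    qed
    define t where "t k = (if k < N then nat \<lfloor>x k\<rfloor> else 0)" for k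
    have tk: "real (t k) \<le> x k" "x k \<le> real (t k) + 1" if "k < N" for k
    proof -
      have "0 \<le> \<lfloor>x k\<rfloor>" using xk(1)[OF that] by simp
      then have "real (t k) = of_int \<lfloor>x k\<rfloor>" using that by (simp add: t_def)
      then show "real (t k) \<le> x k" "x k \<le> real (t k) + 1" by linarith+
    qed
    have t4: "t k \<le> 4 * m" if "k < N" for k
    proof -
      have "real (t k) \<le> real (4 * m)" using tk[OF that] xk[OF that] by simp
      then show ?thesis by (simp only: of_nat_le_iff)
    qed
    have tn: "t \<in> nbox N n"
    proof -
      have "4 * m < n" using m by (simp add: n_def)
      then show ?thesis using t4 by (fastforce simp: nbox_def t_def)
    qed
    have e1: "\<bar>Ut y / r\<^sup>2 - gg t\<bar> \<le> 96 * M * (real N)\<^sup>2 * real m"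
    proof (rule near)
      have "1 * (real m * r) \<le> (24 * real N) * (real m * r)"
        by (rule mult_right_mono) (use N1 r0 in auto)
      then show "enorm N (\<lambda>k. y k - z0 k) \<le> R" using y unfolding mr RR by (simp only: mult.assoc mult_1)
      show "t k \<le> 23 * m" if "k < N" for k using t4[OF that] by simp
      show "r * real (t k) \<le> y k - c k \<and> y k - c k \<le> r * (real (t k) + 1)" if "k < N" for k
        using tk[OF that] r0 by (simp add: x_def field_simps)
    qed
    have e2: "\<bar>gg t - newton N gg (\<lambda>k. real (t k))\<bar> \<le> 15 * \<tau> * real (8 * m * N) ^ 3"
    proof -
      have "\<bar>gg t - newton N gg (\<lambda>k. real (t k))\<bar> \<le> 15 * \<tau> * real (N * n) ^ 3"
        by (rule newton_approx[OF td tn]) auto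
      also have "\<dots> \<le> 15 * \<tau> * real (8 * m * N) ^ 3"
      proof -
        have "N * n \<le> 8 * m * N" by (simp add: n_def mult.commute)
        then show ?thesis using \<tau> by (intro mult_left_mono power_mono of_nat_mono) auto
      qed
      finally show ?thesis .
    qed
    have e3: "\<bar>newton N gg (\<lambda>k. real (t k)) - newton N gg x\<bar> \<le> real N * (96 * M * (real N) * real m * real N + B / 2) + (real N)\<^sup>2 * B * (4 * real m)"
    proof (rule newton_lipschitz)
      show "\<bar>fd j gg (\<lambda>_. 0)\<bar> \<le> 96 * M * (real N) * real m * real N" if "j < N" for j by (rule gr[OF that])
      show "\<bar>fd j (fd k gg) (\<lambda>_. 0)\<bar> \<le> B" if "j < N" "k < N" for j k using sd[OF that that(1) z_n] .
      fix k assume k: "k < N"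
      show "\<bar>real (t k)\<bar> \<le> 4 * real m" "\<bar>x k\<bar> \<le> 4 * real m" "\<bar>real (t k) - x k\<bar> \<le> 1"
        using tk[OF k] xk[OF k] t4[OF k] by auto
    qed
    have "real N * B * (1 / 2) \<le> real N * B * real m" using m1 B0 by (intro mult_left_mono) auto
    moreover have "\<bar>Ut y / r\<^sup>2 - newton N gg x\<bar> \<le> 96 * M * (real N)\<^sup>2 * real m + 15 * \<tau> * real (8 * m * N) ^ 3
        + (real N * (96 * M * (real N) * real m * real N + B / 2) + (real N)\<^sup>2 * B * (4 * real m))"
      using e1 e2 e3 by linarith
    ultimately have "\<bar>Ut y / r\<^sup>2 - newton N gg x\<bar> \<le> ?E"
      by (simp add: algebra_simps power2_eq_square power3_eq_cube)
    then have "\<bar>Ut y / r\<^sup>2 - newton N gg x\<bar> * r\<^sup>2 \<le> ?E * r\<^sup>2" by (rule mult_right_mono) simp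
    moreover have "\<bar>Ut y / r\<^sup>2 - newton N gg x\<bar> * r\<^sup>2 = \<bar>(Ut y / r\<^sup>2 - newton N gg x) * r\<^sup>2\<bar>" by (simp add: abs_mult)
    moreover have "(Ut y / r\<^sup>2 - newton N gg x) * r\<^sup>2 = Ut y - r\<^sup>2 * newton N gg x" using r0 by (simp add: field_simps)
    ultimately show ?thesis unfolding nw x_def[symmetric] r_def[symmetric] by (simp only:)
  qed
  then show ?thesis using sym by blast
qed

lemma ad2_shift: "ad2 N l e f (\<lambda>k. v k + w k) = ad2 N l e (\<lambda>t. f (\<lambda>k. v k + t k)) w"
  by (simp add: ad2_def bavg_def D2_def add.assoc)

lemma D2_nonneg_of_subgradient:
  assumes sub: "\<And>z. \<exists>g. \<forall>y. Uc y \<ge> Uc z + ip N g (\<lambda>k. y k - z k)"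
  shows "0 \<le> D2 l e (\<lambda>v. Uc (\<lambda>k. zb k + h * real (v k)) / h\<^sup>2) v"
proof -
  let ?p = "\<lambda>i k. zb k + h * real (v k + i * l * e k)"
  obtain g where g: "\<And>y. Uc y \<ge> Uc (?p 1) + ip N g (\<lambda>k. y k - ?p 1 k)" using sub by blast
  have "(\<lambda>k. ?p 0 k - ?p 1 k) = (\<lambda>k. - (h * real (l * e k)))"
    "(\<lambda>k. ?p 2 k - ?p 1 k) = (\<lambda>k. h * real (l * e k))"
    by (auto simp: algebra_simps)
  then have "Uc (?p 2) + Uc (?p 0) \<ge> 2 * Uc (?p 1)"
    using g[of "?p 0"] g[of "?p 2"] by (simp add: ip_minus_right)
  then have "0 \<le> (Uc (?p 2) - 2 * Uc (?p 1) + Uc (?p 0)) / h\<^sup>2" by simp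
  then show ?thesis by (simp add: D2_def diff_divide_distrib add_divide_distrib)
qed

text \<open>Second differences annihilate affine functions; at a contact point the supporting affine
  function can therefore be removed without changing what the energy controls.\<close>

lemma ad2_minus_affine:
  "ad2 N l e (\<lambda>t. (Uc (\<lambda>k. c k + h * real (t k)) - (c0 + ip N g (\<lambda>k. c k + h * real (t k) - z k))) / H) w
   = ad2 N l e (\<lambda>t. Uc (\<lambda>k. c k + h * real (t k)) / H) w"
proof -
  have "D2 l e (\<lambda>t. (Uc (\<lambda>k. c k + h * real (t k)) - (c0 + ip N g (\<lambda>k. c k + h * real (t k) - z k))) / H)
      = D2 l e (\<lambda>t. Uc (\<lambda>k. c k + h * real (t k)) / H)"
  proof
    fix v
    have "ip N g (\<lambda>k. c k + h * real (v k + 2 * l * e k) - z k) - 2 * ip N g (\<lambda>k. c k + h * real (v k + l * e k) - z k)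
      + ip N g (\<lambda>k. c k + h * real (v k) - z k) = 0"
      unfolding ip_def sum_distrib_left sum.distrib[symmetric] sum_subtractf[symmetric]
      by (rule sum.neutral) (simp add: algebra_simps)
    then have "(c0 + ip N g (\<lambda>k. c k + h * real (v k + 2 * l * e k) - z k)) - 2 * (c0 + ip N g (\<lambda>k. c k + h * real (v k + l * e k) - z k))
      + (c0 + ip N g (\<lambda>k. c k + h * real (v k) - z k)) = 0" by (simp add: algebra_simps)
    moreover have "(a - a') / H - 2 * ((b - b') / H) + (d - d') / H = a / H - 2 * (b / H) + d / H"
      if "a' - 2 * b' + d' = 0" for a b d a' b' d'
    proof -
      have "(a - a') / H - 2 * ((b - b') / H) + (d - d') / H = a / H - 2 * (b / H) + d / H - (a' - 2 * b' + d') / H"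
        by (simp add: diff_divide_distrib add_divide_distrib)
      then show ?thesis using that by simp
    qed
    ultimately show "D2 l e (\<lambda>t. (Uc (\<lambda>k. c k + h * real (t k)) - (c0 + ip N g (\<lambda>k. c k + h * real (t k) - z k))) / H) v
      = D2 l e (\<lambda>t. Uc (\<lambda>k. c k + h * real (t k)) / H) v"
      unfolding D2_def by blast
  qed
  then show ?thesis by (simp add: ad2_def)
qed

lemma exists_le_average:
  fixes G :: "'a \<Rightarrow> real"
  assumes "finite S" "S \<noteq> {}" "sum G S \<le> W"
  shows "\<exists>x\<in>S. G x \<le> W / card S"
proof (rule ccontr)
  assume "\<not> ?thesis"
  then have "(\<Sum>x\<in>S. W / card S) < sum G S" using assms(1,2) by (intro sum_strict_mono) (auto simp: not_le)
  then show False using assms by (simp add: card_gt_0_iff)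
qed

subsection \<open>Contact points\<close>

text \<open>The tilts in a cube of side \<open>\<pi>0\<close> have contact points in at least \<open>(\<pi>0 / (4 C N h)) ^ N\<close> different cells, since
  the tilts with contact point in a common cell are close to each other.\<close>

lemma contact_cell_pigeonhole:
  fixes G :: "(nat \<Rightarrow> nat) \<Rightarrow> real" and z :: "(nat \<Rightarrow> real) \<Rightarrow> nat \<Rightarrow> real"
  assumes N: "0 < N" and q: "0 < q" and h: "0 < h" and C: "0 < C" and \<pi>0: "0 < \<pi>0"
    and small: "2 * C * real N * (real q * h) \<le> \<pi>0"
    and z: "\<And>\<pi> k. (\<And>k. k < N \<Longrightarrow> 0 \<le> \<pi> k \<and> \<pi> k \<le> \<pi>0) \<Longrightarrow> k < N \<Longrightarrow> 2 * real q * h \<le> z \<pi> k - zb k \<and> z \<pi> k - zb k \<le> real n * h"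
    and lip: "\<And>\<pi> \<pi>'. (\<And>k. k < N \<Longrightarrow> 0 \<le> \<pi> k \<and> \<pi> k \<le> \<pi>0) \<Longrightarrow> (\<And>k. k < N \<Longrightarrow> 0 \<le> \<pi>' k \<and> \<pi>' k \<le> \<pi>0) \<Longrightarrow>
        enorm N (\<lambda>k. \<pi> k - \<pi>' k) \<le> C * enorm N (\<lambda>k. z \<pi> k - z \<pi>' k)"
    and G0: "\<And>v. 0 \<le> G v" and GW: "(\<Sum>v\<in>nbox N n. G v) \<le> W"
  shows "\<exists>\<pi> v. (\<forall>k<N. 0 \<le> \<pi> k \<and> \<pi> k \<le> \<pi>0) \<and> G v \<le> W * (4 * C * real N * h / \<pi>0) ^ N \<and>
     (\<forall>k<N. real q * h \<le> z \<pi> k - (zb k + h * real (v k)) \<and> z \<pi> k - (zb k + h * real (v k)) \<le> 3 * (real q * h))"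
proof -
  \<comment> \<open>Spacing of the sampled tilts: contact points in a common cell of side
    \<open>real q * h\<close> are at most N q h apart, so their tilts differ by at most s / 2 and
    must coincide.\<close>
  define s where "s = 2 * C * real N * (real q * h)"
  have s0: "0 < s" using C N q h by (simp add: s_def)
  define n\<pi> where "n\<pi> = nat \<lfloor>\<pi>0 / s\<rfloor>"
  have s1: "1 \<le> \<pi>0 / s" using small s0 by (simp add: s_def)
  then have fl: "1 \<le> \<lfloor>\<pi>0 / s\<rfloor>" by simp
  then have nr: "real n\<pi> = of_int \<lfloor>\<pi>0 / s\<rfloor>" by (simp add: n\<pi>_def)
  have n1: "1 \<le> n\<pi>" using fl by (simp add: n\<pi>_def le_nat_iff)
  have n2: "real n\<pi> \<le> \<pi>0 / s" "\<pi>0 / s < real n\<pi> + 1" unfolding nr by linarith+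
  have n3: "\<pi>0 / (2 * s) \<le> real n\<pi>"
  proof -
    have "\<pi>0 / s \<le> 2 * real n\<pi>" using n2 n1 by simp
    then show ?thesis using s0 by (simp add: field_simps)
  qed
  define P where "P v = (\<lambda>k. s * real (v k))" for v :: "nat \<Rightarrow> nat"
  have P: "0 \<le> P v k \<and> P v k \<le> \<pi>0" if "v \<in> nbox N n\<pi>" "k < N" for v k
  proof -
    have "real (v k) \<le> \<pi>0 / s" using that n2 by (auto simp: nbox_def intro: order_trans[OF less_imp_le])
    then show ?thesis using s0 by (simp add: P_def field_simps)
  qed
  define y where "y v k = (z (P v) k - zb k) / (real q * h)" for v k
  have qh: "0 < real q * h" using q h by simp
  have y: "2 \<le> y v k" "y v k * real q \<le> real n" if "v \<in> nbox N n\<pi>" "k < N" for v k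
  proof -
    have "2 * real q * h \<le> z (P v) k - zb k \<and> z (P v) k - zb k \<le> real n * h"
      by (rule z) (use P[OF that(1)] that in auto)
    moreover have "y v k * real q = (z (P v) k - zb k) / h" using q h by (simp add: y_def)
    ultimately show "2 \<le> y v k" "y v k * real q \<le> real n"
      using qh q h by (simp_all add: y_def pos_le_divide_eq pos_divide_le_eq mult.assoc)
  qed
  \<comment> \<open>The cell index is lowered by 2 so that, after an offset t < q is added, the
    corner still lies between one and three coarse cells below the contact point.\<close>
  define c where "c v k = (if k < N then nat (\<lfloor>y v k\<rfloor> - 2) else 0)" for v k
  have c: "real (c v k) + 2 \<le> y v k" "y v k < real (c v k) + 3" if "v \<in> nbox N n\<pi>" "k < N" for v k
  proof -
    have "2 \<le> \<lfloor>y v k\<rfloor>" using y(1)[OF that] by (simp add: le_floor_iff)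
    then have "real (c v k) = of_int \<lfloor>y v k\<rfloor> - 2" using that by (simp add: c_def)
    then show "real (c v k) + 2 \<le> y v k" "y v k < real (c v k) + 3" by linarith+
  qed
  \<comment> \<open>Every tilt contributes q^N base points, one for each offset. As \<open>s\<close>
    is proportional to \<open>q\<close>, the resulting count has a lower bound that does not depend
    on \<open>q\<close>, that is, on the scale selected by the energy.\<close>
  define V where "V = (\<lambda>(v, t). (\<lambda>k. q * c v k + t k))"
  define S where "S = nbox N n\<pi> \<times> nbox N q"
  have inj: "inj_on V S"
  proof (rule inj_onI, clarsimp simp: S_def V_def)
    fix v t v' t'
    assume a: "v \<in> nbox N n\<pi>" "t \<in> nbox N q" "v' \<in> nbox N n\<pi>" "t' \<in> nbox N q"
      and eq: "(\<lambda>k. q * c v k + t k) = (\<lambda>k. q * c v' k + t' k)"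
    have tq: "t k < q" "t' k < q" for k
      using a q by (cases "k < N"; force simp: nbox_def)+
    have eqk: "q * c v k + t k = q * c v' k + t' k" for k using fun_cong[OF eq] .
    have cc: "c v k = c v' k" for k
    proof -
      have "(q * c v k + t k) div q = c v k" "(q * c v' k + t' k) div q = c v' k" using tq q by auto
      then show ?thesis using eqk[of k] by simp
    qed
    then have tt: "t = t'" using eqk by (auto simp: fun_eq_iff)
    have "enorm N (\<lambda>k. z (P v) k - z (P v') k) \<le> real N * (real q * h)"
    proof (rule enorm_le_sum)
      fix k assume k: "k < N"
      have "\<bar>y v k - y v' k\<bar> \<le> 1" using c[OF a(1) k] c[OF a(3) k] cc[of k] by linarith
      moreover have "z (P v) k - z (P v') k = (y v k - y v' k) * (real q * h)"
      proof -
        have "z (P w) k = y w k * (real q * h) + zb k" for w using q h unfolding y_def by simp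
        then show ?thesis by (simp add: algebra_simps)
      qed
      ultimately show "\<bar>z (P v) k - z (P v') k\<bar> \<le> real q * h"
        using mult_right_mono[of "\<bar>y v k - y v' k\<bar>" 1 "real q * h"] qh h by (simp add: abs_mult)
    qed
    then have "C * enorm N (\<lambda>k. z (P v) k - z (P v') k) \<le> C * (real N * (real q * h))" using C by (intro mult_left_mono) auto
    then have "enorm N (\<lambda>k. P v k - P v' k) \<le> C * (real N * (real q * h))"
      using lip[of "P v" "P v'"] P[OF a(1)] P[OF a(3)] by (meson order_trans)
    also have "\<dots> = s / 2" by (simp add: s_def)
    finally have en: "enorm N (\<lambda>k. P v k - P v' k) \<le> s / 2" .
    have "v k = v' k" for k
    proof (cases "k < N")
      case True
      have "\<bar>P v k - P v' k\<bar> \<le> s / 2" using abs_le_enorm[OF True, of "\<lambda>k. P v k - P v' k"] en by simp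
      then have "s * \<bar>real (v k) - real (v' k)\<bar> \<le> s * (1 / 2)"
        using s0 by (simp add: P_def abs_mult right_diff_distrib[symmetric])
      then have "\<bar>real (v k) - real (v' k)\<bar> \<le> 1 / 2" using s0 by (subst (asm) mult_le_cancel_left_pos)
      then have "\<bar>int (v k) - int (v' k)\<bar> < 1" by linarith
      then show ?thesis by simp
    next
      case False then show ?thesis using a by (auto simp: nbox_def)
    qed
    then show "v = v' \<and> t = t'" using tt by auto
  qed
  have sub: "V ` S \<subseteq> nbox N n"
  proof (clarsimp simp: S_def V_def)
    fix v t assume a: "v \<in> nbox N n\<pi>" "t \<in> nbox N q"
    show "(\<lambda>k. q * c v k + t k) \<in> nbox N n"
      unfolding nbox_def
    proof (intro CollectI conjI allI impI)
      fix k assume k: "k < N"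
      have "t k < q" using a k by (auto simp: nbox_def)
      then have "real (q * c v k + t k) < real q * (real (c v k) + 2)" by (simp add: algebra_simps)
      also have "\<dots> \<le> real q * y v k" using c[OF a(1) k] q by (intro mult_left_mono) auto
      also have "\<dots> \<le> real n" using y(2)[OF a(1) k] by (simp add: mult.commute)
      finally show "q * c v k + t k < n" by (simp only: of_nat_less_iff)
    next
      fix k assume "N \<le> k" then show "q * c v k + t k = 0" using a by (simp add: c_def nbox_def)
    qed
  qed
  have "sum (G \<circ> V) S = sum G (V ` S)" by (rule sum.reindex[OF inj, symmetric])
  also have "\<dots> \<le> sum G (nbox N n)" by (rule sum_mono2) (use sub G0 in auto)
  finally have "sum (G \<circ> V) S \<le> W" using GW by simp
  moreover have fS: "finite S" by (simp add: S_def)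
  moreover have cS: "card S = n\<pi> ^ N * q ^ N" by (simp add: S_def card_cartesian_product)
  moreover have ne: "S \<noteq> {}" using cS n1 q by (metis card.empty mult_is_0 not_one_le_zero power_not_zero neq0_conv)
  ultimately obtain p where p: "p \<in> S" "(G \<circ> V) p \<le> W / card S" using exists_le_average[of S "G \<circ> V" W] by blast
  obtain v t where pvt: "p = (v, t)" by (cases p)
  have a: "v \<in> nbox N n\<pi>" "t \<in> nbox N q" using p(1) by (auto simp: S_def pvt)
  have W0: "0 \<le> W" using GW G0 by (meson order_trans sum_nonneg)
  have "W / card S \<le> W * (4 * C * real N * h / \<pi>0) ^ N"
  proof -
    have "0 < \<pi>0 / (2 * s) * real q" using \<pi>0 s0 q by simp
    moreover have "\<pi>0 / (2 * s) * real q \<le> real n\<pi> * real q" using n3 by (intro mult_right_mono) auto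
    ultimately have "(\<pi>0 / (2 * s) * real q) ^ N \<le> (real n\<pi> * real q) ^ N" "0 < (\<pi>0 / (2 * s) * real q) ^ N"
      by (auto intro: power_mono)
    then have "W / card S \<le> W / (\<pi>0 / (2 * s) * real q) ^ N"
      unfolding cS using W0 by (intro divide_left_mono mult_pos_pos) (auto simp: power_mult_distrib)
    also have "\<dots> = W * (1 / (\<pi>0 / (2 * s) * real q)) ^ N" by (simp add: power_divide)
    also have "1 / (\<pi>0 / (2 * s) * real q) = 4 * C * real N * h / \<pi>0"
      using \<pi>0 s0 q C N h by (simp add: s_def field_simps)
    finally show ?thesis .
  qed
  then have "G (V p) \<le> W * (4 * C * real N * h / \<pi>0) ^ N" using p(2) by simp
  moreover have "real q * h \<le> z (P v) k - (zb k + h * real (V p k)) \<and> z (P v) k - (zb k + h * real (V p k)) \<le> 3 * (real q * h)" if k: "k < N" for k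
  proof -
    have tk: "t k < q" using a k by (auto simp: nbox_def)
    have e: "z (P v) k - zb k = y v k * (real q * h)" using q h unfolding y_def by simp
    define X where "X = real (c v k) * (real q * h)"
    define Y where "Y = y v k * (real q * h)"
    define T where "T = h * real (t k)"
    have V: "h * real (V p k) = X + T" by (simp add: V_def pvt X_def T_def algebra_simps)
    have T: "0 \<le> T" "T \<le> real q * h" using tk h by (auto simp: T_def mult.commute mult_right_mono)
    have "(real (c v k) + 2) * (real q * h) \<le> Y" "Y \<le> (real (c v k) + 3) * (real q * h)"
      using c[OF a(1) k] qh unfolding Y_def by (intro mult_right_mono; simp)+
    then have "X + 2 * (real q * h) \<le> Y" "Y \<le> X + 3 * (real q * h)" unfolding X_def by (simp_all only: distrib_right)
    moreover have "z (P v) k - (zb k + (X + T)) = Y - X - T" using e by (simp add: Y_def)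
    ultimately show ?thesis unfolding V using T by simp
  qed
  ultimately show ?thesis using P[OF a(1)] by blast
qed

text \<open>The order of the choices is essential: m absorbs the error linear in m, \<tau> the
  interpolation error for this m, and \<epsilon> is the gap that forces second differences to be
  \<tau>-close to their mean. Only then are the coarsest scale, the number J of scales and the mesh
  fixed. The selected scale is not under control, but only a positive radius r is needed.\<close>

lemma quadratic_approx_at_contact:
  fixes z :: "(nat \<Rightarrow> real) \<Rightarrow> nat \<Rightarrow> real"
  assumes N: "0 < N" and C: "0 < C" and \<pi>0: "0 < \<pi>0" and \<rho>: "0 < \<rho>" and \<rho>1: "0 < \<rho>1" and M: "0 \<le> M" and \<eta>: "0 < \<eta>"
    and sub: "\<And>z. \<exists>g. \<forall>y. Uc y \<ge> Uc z + ip N g (\<lambda>k. y k - z k)"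
    and z: "\<And>\<pi> k. (\<And>k. k < N \<Longrightarrow> 0 \<le> \<pi> k \<and> \<pi> k \<le> \<pi>0) \<Longrightarrow> k < N \<Longrightarrow> \<bar>z \<pi> k\<bar> \<le> \<rho>"
    and pinch: "\<And>\<pi>. (\<And>k. k < N \<Longrightarrow> 0 \<le> \<pi> k \<and> \<pi> k \<le> \<pi>0) \<Longrightarrow> \<exists>g. \<forall>y. enorm N (\<lambda>k. y k - z \<pi> k) \<le> \<rho>1 \<longrightarrow>
        0 \<le> Uc y - Uc (z \<pi>) - ip N g (\<lambda>k. y k - z \<pi> k) \<and>
        Uc y - Uc (z \<pi>) - ip N g (\<lambda>k. y k - z \<pi> k) \<le> M * (enorm N (\<lambda>k. y k - z \<pi> k))\<^sup>2"
    and lip: "\<And>\<pi> \<pi>'. (\<And>k. k < N \<Longrightarrow> 0 \<le> \<pi> k \<and> \<pi> k \<le> \<pi>0) \<Longrightarrow> (\<And>k. k < N \<Longrightarrow> 0 \<le> \<pi>' k \<and> \<pi>' k \<le> \<pi>0) \<Longrightarrow>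
        enorm N (\<lambda>k. \<pi> k - \<pi>' k) \<le> C * enorm N (\<lambda>k. z \<pi> k - z \<pi>' k)"
  shows "\<exists>\<pi> r c c0 g A. (\<forall>k<N. 0 \<le> \<pi> k \<and> \<pi> k \<le> \<pi>0) \<and> 0 < r \<and> r \<le> \<rho>1 \<and> (\<forall>j k. A j k = A k j) \<and>
     (\<forall>y. enorm N (\<lambda>k. y k - z \<pi> k) \<le> r \<longrightarrow>
       \<bar>Uc y - (c0 + ip N g (\<lambda>k. y k - c k) + qf N A (\<lambda>k. y k - c k) / 2)\<bar> \<le> \<eta> * r\<^sup>2)"
proof -
  define B where "B = 2 * (18 * M * (real N)\<^sup>2) + 15"
  define K where "K = 96 * M * (real N)\<^sup>2 + 96 * M * real N ^ 3 + real N * B + 4 * (real N)\<^sup>2 * B"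
  have B0: "0 \<le> B" using M by (simp add: B_def)
  have K0: "0 \<le> K" using M B0 by (simp add: K_def)
  define m where "m = nat \<lceil>2 * K / \<eta>\<rceil> + 2"
  have m2: "2 \<le> m" by (simp add: m_def)
  have "2 * K / \<eta> \<le> real m" unfolding m_def by linarith
  then have "2 * K \<le> \<eta> * real m" using \<eta> by (simp add: field_simps)
  then have "2 * K * real m \<le> \<eta> * real m * real m" by (rule mult_right_mono) simp
  then have Km: "K * real m \<le> \<eta> * (real m)\<^sup>2 / 2" by (simp add: power2_eq_square)
  define T where "T = 15 * real (8 * m * N) ^ 3"
  have T0: "0 < T" using N m2 by (simp add: T_def)
  define \<tau> where "\<tau> = min 1 (\<eta> * (real m)\<^sup>2 / (2 * T))"
  have \<tau>: "0 < \<tau>" "\<tau> \<le> 1" using \<eta> m2 T0 by (auto simp: \<tau>_def)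
  have "\<tau> * T \<le> \<eta> * (real m)\<^sup>2 / (2 * T) * T" using T0 by (intro mult_right_mono) (auto simp: \<tau>_def)
  then have \<tau>T: "\<tau> * T \<le> \<eta> * (real m)\<^sup>2 / 2" using T0 by simp
  define Mr where "Mr = 8 * m"
  have Mr2: "2 \<le> Mr" using m2 by (simp add: Mr_def)
  define M0 where "M0 = 18 * M * (real N)\<^sup>2"
  have M00: "0 \<le> M0" using M by (simp add: M0_def)
  define ci where "ci = real (card (idx N Mr))"
  have ci0: "0 < ci" using Mr2 by (simp add: ci_def card_idx)
  define D where "D = ci * (1 + ci * M0) * (1 + M0)\<^sup>2"
  have D0: "0 < D" using ci0 M00 by (auto simp: D_def intro!: mult_pos_pos add_pos_nonneg)
  \<comment> \<open>With this tolerance the bound of \<open>gap_small\<close> becomes exactly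
    \<tau>^2.\<close>
  define \<epsilon> where "\<epsilon> = \<tau>\<^sup>2 / D"
  have \<epsilon>0: "0 < \<epsilon>" using \<tau> D0 by (simp add: \<epsilon>_def)
  \<comment> \<open>The coarsest scale. The first bound keeps every point that is evaluated within
    the pinching radius \<rho>1, the second makes the spacing of tilts at most \<pi>0.\<close>
  define \<rho>s where "\<rho>s = min (\<rho>1 / (6 * real N)) (\<pi>0 / (C * real N))"
  have \<rho>s0: "0 < \<rho>s" using \<rho>1 \<pi>0 C N by (simp add: \<rho>s_def)
  have \<rho>s1: "6 * real N * \<rho>s \<le> \<rho>1"
  proof -
    have "6 * real N * \<rho>s \<le> 6 * real N * (\<rho>1 / (6 * real N))" by (intro mult_left_mono) (auto simp: \<rho>s_def)
    then show ?thesis using N by simp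
  qed
  have \<rho>s2: "C * real N * \<rho>s \<le> \<pi>0"
  proof -
    have "C * real N * \<rho>s \<le> C * real N * (\<pi>0 / (C * real N))" using C by (intro mult_left_mono) (auto simp: \<rho>s_def)
    then show ?thesis using N C by simp
  qed
  define b where "b = nat \<lceil>2 * \<rho> / \<rho>s\<rceil> + 1"
  have "2 * \<rho> / \<rho>s + 1 \<le> real b" unfolding b_def by linarith
  then have b: "2 * \<rho> + \<rho>s \<le> real b * \<rho>s" using \<rho>s0 by (simp add: field_simps)
  \<comment> \<open>\<Omega> / J bounds the gap at a selected base point. Since h Mr^J = \<rho>s,
    the mesh has cancelled from \<Omega>, so J can be chosen from \<Omega> and the mesh from J
    without circularity.\<close>
  define \<Omega> where "\<Omega> = card (dirs N) * (real (b + 6) * (4 * C * real N * \<rho>s / \<pi>0)) ^ N"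
  define J where "J = nat \<lceil>\<Omega> / \<epsilon>\<rceil> + 1"
  have J0: "0 < J" by (simp add: J_def)
  have "\<Omega> / \<epsilon> \<le> real J" unfolding J_def by linarith
  then have \<Omega>J: "\<Omega> / J \<le> \<epsilon>" using \<epsilon>0 J0 by (simp add: field_simps)
  define h where "h = \<rho>s / real Mr ^ J"
  have h0: "0 < h" using \<rho>s0 Mr2 by (simp add: h_def)
  have hM: "h * real Mr ^ J = \<rho>s" using Mr2 by (simp add: h_def)
  \<comment> \<open>The additional \<rho>s provides the margin of two cells below every contact
    point that the cell count requires.\<close>
  define zb where "zb = (\<lambda>k::nat. - \<rho> - \<rho>s)"
  define f where "f v = Uc (\<lambda>k. zb k + h * real (v k)) / h\<^sup>2" for v
  have Dpos: "0 \<le> D2 l e f v" for l e v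
    unfolding f_def by (rule D2_nonneg_of_subgradient[OF sub])
  obtain k where k: "k < J" and pk: "(\<Sum>v\<in>nbox N (b * Mr ^ J). \<Sum>e\<in>dirs N. gap (idx N Mr)
      (\<lambda>s. ad2 N (Mr ^ (J - Suc k)) e f (\<lambda>j. v j + idx_shift (Mr ^ (J - Suc k)) e s j)))
      \<le> card (dirs N) * (real (b + 6) * real Mr ^ J) ^ N / J"
    using energy_pigeonhole[of Mr J "dirs N" f N b] Mr2 J0 Dpos dirs_le dirs_supp by auto
  define l' where "l' = Mr ^ (J - Suc k)"
  have l'0: "0 < l'" using Mr2 by (simp add: l'_def)
  define q where "q = m * l'"
  have q0: "0 < q" using m2 l'0 by (simp add: q_def)
  have ql: "8 * q \<le> Mr ^ J"
  proof -
    have "8 * q = Mr ^ Suc (J - Suc k)" by (simp add: q_def l'_def Mr_def)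
    also have "\<dots> \<le> Mr ^ J" using Mr2 k by (intro power_increasing) auto
    finally show ?thesis .
  qed
  have qh: "8 * (real q * h) \<le> \<rho>s"
  proof -
    have "real (8 * q) * h \<le> real (Mr ^ J) * h" using ql h0 by (intro mult_right_mono of_nat_mono) auto
    then show ?thesis using hM by (simp add: mult_ac)
  qed
  define G where "G v = (\<Sum>e\<in>dirs N. gap (idx N Mr) (\<lambda>s. ad2 N l' e f (\<lambda>j. v j + idx_shift l' e s j)))" for v
  have ai: "0 \<le> ad2 N l e f v" for l e v by (rule ad2_nonneg) (rule Dpos)
  have ine: "idx N Mr \<noteq> {}" using Mr2 by (simp add: idx_ne)
  have gp: "0 \<le> gap (idx N Mr) (\<lambda>s. ad2 N l' e f (\<lambda>j. v j + idx_shift l' e s j))" for e v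
    by (rule gap_nonneg) (use ine ai in auto)
  have "\<exists>\<pi> v. (\<forall>k<N. 0 \<le> \<pi> k \<and> \<pi> k \<le> \<pi>0) \<and>
      G v \<le> card (dirs N) * (real (b + 6) * real Mr ^ J) ^ N / J * (4 * C * real N * h / \<pi>0) ^ N \<and>
     (\<forall>k<N. real q * h \<le> z \<pi> k - (zb k + h * real (v k)) \<and> z \<pi> k - (zb k + h * real (v k)) \<le> 3 * (real q * h))"
  proof (rule contact_cell_pigeonhole[OF N q0 h0 C \<pi>0 _ _ lip])
    have "2 * C * real N * (real q * h) \<le> 2 * C * real N * (\<rho>s / 8)" using qh C by (intro mult_left_mono) auto
    also have "\<dots> \<le> C * real N * \<rho>s" using C \<rho>s0 by simp
    finally show "2 * C * real N * (real q * h) \<le> \<pi>0" using \<rho>s2 by simp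
    show "2 * real q * h \<le> z \<pi> k - zb k \<and> z \<pi> k - zb k \<le> real (b * Mr ^ J) * h"
      if "\<And>k. k < N \<Longrightarrow> 0 \<le> \<pi> k \<and> \<pi> k \<le> \<pi>0" "k < N" for \<pi> k
    proof -
      have "\<bar>z \<pi> k\<bar> \<le> \<rho>" by (rule z) (use that in auto)
      moreover have "real (b * Mr ^ J) * h = real b * \<rho>s" using hM by (simp add: mult_ac)
      moreover have "0 < real q * h" using q0 h0 by simp
      then have "2 * real q * h \<le> \<rho>s" using qh by linarith
      ultimately show ?thesis using b unfolding zb_def abs_le_iff
        by (intro conjI) (elim conjE, linarith)+
    qed
    show "0 \<le> G v" for v unfolding G_def by (intro sum_nonneg gp)
  qed (use pk in \<open>auto simp: G_def l'_def\<close>)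
  then obtain \<pi> v where \<pi>: "\<forall>k<N. 0 \<le> \<pi> k \<and> \<pi> k \<le> \<pi>0"
    and Gv: "G v \<le> card (dirs N) * (real (b + 6) * real Mr ^ J) ^ N / J * (4 * C * real N * h / \<pi>0) ^ N"
    and loc: "\<And>k. k < N \<Longrightarrow> real q * h \<le> z \<pi> k - (zb k + h * real (v k))"
      "\<And>k. k < N \<Longrightarrow> z \<pi> k - (zb k + h * real (v k)) \<le> 3 * (real q * h)" by blast
  have "card (dirs N) * (real (b + 6) * real Mr ^ J) ^ N / J * (4 * C * real N * h / \<pi>0) ^ N = \<Omega> / J"
  proof -
    have "(real (b + 6) * real Mr ^ J) * (4 * C * real N * h / \<pi>0) = real (b + 6) * (4 * C * real N * (h * real Mr ^ J) / \<pi>0)" by simp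
    then have "(real (b + 6) * real Mr ^ J) ^ N * (4 * C * real N * h / \<pi>0) ^ N = (real (b + 6) * (4 * C * real N * \<rho>s / \<pi>0)) ^ N"
      unfolding hM power_mult_distrib[symmetric] by (rule arg_cong)
    then show ?thesis by (simp add: \<Omega>_def)
  qed
  then have G\<epsilon>: "G v \<le> \<epsilon>" using Gv \<Omega>J by linarith
  define c where "c = (\<lambda>k. zb k + h * real (v k))"
  define z0 where "z0 = z \<pi>"
  obtain g where g: "\<And>y. enorm N (\<lambda>k. y k - z0 k) \<le> \<rho>1 \<Longrightarrow>
        0 \<le> Uc y - Uc z0 - ip N g (\<lambda>k. y k - z0 k) \<and>
        Uc y - Uc z0 - ip N g (\<lambda>k. y k - z0 k) \<le> M * (enorm N (\<lambda>k. y k - z0 k))\<^sup>2"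
    unfolding z0_def using pinch[of \<pi>] \<pi> by blast
  define Ut where "Ut y = Uc y - (Uc z0 + ip N g (\<lambda>k. y k - z0 k))" for y
  define ft where "ft = (\<lambda>w. Ut (\<lambda>k. c k + h * real (w k)) / h\<^sup>2)"
  have R: "2 * (real (24 * N * m * l') * h) \<le> \<rho>1"
  proof -
    have "2 * (real (24 * N * m * l') * h) = 6 * real N * (8 * (real q * h))" by (simp add: q_def)
    also have "\<dots> \<le> 6 * real N * \<rho>s" using qh by (intro mult_left_mono) auto
    also note \<rho>s1
    finally show ?thesis .
  qed
  have R1: "real (24 * N * m * l') * h \<le> \<rho>1"
    using R h0 by (smt (verit) mult_nonneg_nonneg of_nat_0_le_iff)
  have up: "Ut y \<le> M * (enorm N (\<lambda>k. y k - z0 k))\<^sup>2" and lo: "0 \<le> Ut y" if "enorm N (\<lambda>k. y k - z0 k) \<le> \<rho>1" for y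
    using g[OF that] by (auto simp: Ut_def)
  have subt: "\<exists>g. \<forall>y. Ut y \<ge> Ut z + ip N g (\<lambda>k. y k - z k)" for z
  proof -
    obtain g' where g': "\<And>y. Uc y \<ge> Uc z + ip N g' (\<lambda>k. y k - z k)" using sub by blast
    have "Ut y \<ge> Ut z + ip N (\<lambda>k. g' k - g k) (\<lambda>k. y k - z k)" for y
      using g'[of y] by (simp add: Ut_def ip_diff_left ip_diff_right)
    then show ?thesis by blast
  qed
  have adf: "ad2 N l e ft w = ad2 N l e f (\<lambda>k. v k + w k)" for l e w
  proof -
    have "ad2 N l e f (\<lambda>k. v k + w k) = ad2 N l e (\<lambda>t. Uc (\<lambda>k. c k + h * real (t k)) / h\<^sup>2) w"
      unfolding ad2_shift by (simp add: f_def c_def algebra_simps)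
    then show ?thesis unfolding ft_def Ut_def ad2_minus_affine by simp
  qed
  have z0c: "real (m * l') * h \<le> z0 k - c k" "z0 k - c k \<le> 3 * real (m * l') * h" if "k < N" for k
    using loc[OF that] by (simp_all add: z0_def c_def q_def mult.assoc)
  have nc: "\<bar>ad2 N l' e ft (\<lambda>k. l' * t k) - ad2 N (8 * m * l') e ft (\<lambda>_. 0)\<bar> \<le> \<tau>"
    if e: "e \<in> dirs N" and t: "t \<in> nbox N (8 * m)" for e t
  proof -
    let ?a = "\<lambda>s. ad2 N l' e f (\<lambda>j. v j + idx_shift l' e s j)"
    have av: "(\<Sum>s\<in>idx N Mr. ?a s) / card (idx N Mr) = ad2 N (Mr * l') e f v"
      using ad2_refine[OF l'0, of Mr N e f v] Mr2 by simp
    have e0: "ad2 N (8 * m * l') e ft (\<lambda>_. 0) = ad2 N (Mr * l') e f v" by (simp add: adf Mr_def)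
    have "\<bar>ad2 N (8 * m * l') e ft (\<lambda>_. 0)\<bar> \<le> M0"
      unfolding ft_def M0_def
      by (rule ad2_bound[where ?z0.0 = z0]) (use m2 l'0 h0 M z0c e up lo R1 order_trans in \<open>auto simp del: of_nat_mult\<close>)
    then have "(\<Sum>s\<in>idx N Mr. ?a s) / card (idx N Mr) \<le> M0" unfolding av e0 by simp
    moreover have "gap (idx N Mr) ?a \<le> \<epsilon>"
    proof -
      have "gap (idx N Mr) ?a \<le> G v" unfolding G_def
        by (rule member_le_sum[OF e]) (use gp in auto)
      then show ?thesis using G\<epsilon> by simp
    qed
    \<comment> \<open>The shifts with i = i' = 0 already run through all subcells of the box, and
      closeness to the mean at these subcells is what \<open>nearly_quadratic\<close> asks
      for.\<close>
    moreover have "(0, 0, t) \<in> idx N Mr" using t Mr2 by (auto simp: idx_def Mr_def)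
    ultimately have "(?a (0, 0, t) - (\<Sum>s\<in>idx N Mr. ?a s) / card (idx N Mr))\<^sup>2
        \<le> card (idx N Mr) * \<epsilon> * (1 + card (idx N Mr) * M0) * (1 + M0)\<^sup>2"
      by (intro gap_small) (use ine ai in auto)
    also have "\<dots> = D * \<epsilon>" by (simp add: D_def ci_def)
    also have "\<dots> = \<tau>\<^sup>2" using D0 by (simp add: \<epsilon>_def)
    finally have "\<bar>?a (0, 0, t) - (\<Sum>s\<in>idx N Mr. ?a s) / card (idx N Mr)\<bar> \<le> \<tau>"
      using \<tau> by (simp add: abs_le_square_iff[symmetric] power2_le_iff_abs_le)
    moreover have "?a (0, 0, t) = ad2 N l' e ft (\<lambda>k. l' * t k)" by (simp add: adf idx_shift_def)
    ultimately show ?thesis unfolding av e0 by simp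
  qed
  have "\<exists>c0 g A. (\<forall>j k. A j k = A k j) \<and> (\<forall>y. enorm N (\<lambda>k. y k - z0 k) \<le> real (m * l') * h \<longrightarrow>
     \<bar>Ut y - (c0 + ip N g (\<lambda>k. y k - c k) + qf N A (\<lambda>k. y k - c k) / 2)\<bar>
       \<le> (15 * \<tau> * real (8 * m * N) ^ 3 + K * real m) * (real l' * h)\<^sup>2)"
    unfolding K_def B_def
    by (rule nearly_quadratic[OF N m2 l'0 h0 M \<tau> subt]) (use up lo R z0c nc[unfolded ft_def] order_trans in \<open>auto simp del: of_nat_mult\<close>)
  then obtain c1 g1 A where A: "\<forall>j k. A j k = A k j" and ap: "\<And>y. enorm N (\<lambda>k. y k - z0 k) \<le> real (m * l') * h \<Longrightarrow>
     \<bar>Ut y - (c1 + ip N g1 (\<lambda>k. y k - c k) + qf N A (\<lambda>k. y k - c k) / 2)\<bar>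
       \<le> (15 * \<tau> * real (8 * m * N) ^ 3 + K * real m) * (real l' * h)\<^sup>2" by blast
  define r where "r = real q * h"
  have r0: "0 < r" using q0 h0 by (simp add: r_def)
  have r1: "r \<le> \<rho>1"
  proof -
    have "1 * \<rho>s \<le> 6 * real N * \<rho>s" using N \<rho>s0 by (intro mult_right_mono) auto
    then show ?thesis using qh r0 \<rho>s1 unfolding r_def by linarith
  qed
  have err: "(15 * \<tau> * real (8 * m * N) ^ 3 + K * real m) * (real l' * h)\<^sup>2 \<le> \<eta> * r\<^sup>2"
  proof -
    have "15 * \<tau> * real (8 * m * N) ^ 3 + K * real m \<le> \<eta> * (real m)\<^sup>2"
      using \<tau>T Km by (simp add: T_def mult_ac)
    then have "(15 * \<tau> * real (8 * m * N) ^ 3 + K * real m) * (real l' * h)\<^sup>2 \<le> \<eta> * (real m)\<^sup>2 * (real l' * h)\<^sup>2"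
      by (rule mult_right_mono) simp
    also have "\<dots> = \<eta> * r\<^sup>2" by (simp add: r_def q_def power_mult_distrib mult_ac)
    finally show ?thesis .
  qed
  have "\<bar>Uc y - ((c1 + Uc z0 + ip N g (\<lambda>k. c k - z0 k)) + ip N (\<lambda>k. g1 k + g k) (\<lambda>k. y k - c k) + qf N A (\<lambda>k. y k - c k) / 2)\<bar> \<le> \<eta> * r\<^sup>2"
    if "enorm N (\<lambda>k. y k - z0 k) \<le> r" for y
  proof -
    have "enorm N (\<lambda>k. y k - z0 k) \<le> real (m * l') * h" using that by (simp add: r_def q_def)
    note order_trans[OF ap[OF this] err]
    moreover have "Ut y - (c1 + ip N g1 (\<lambda>k. y k - c k) + qf N A (\<lambda>k. y k - c k) / 2)
      = Uc y - ((c1 + Uc z0 + ip N g (\<lambda>k. c k - z0 k)) + ip N (\<lambda>k. g1 k + g k) (\<lambda>k. y k - c k) + qf N A (\<lambda>k. y k - c k) / 2)"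
      by (simp add: Ut_def ip_add_left ip_diff_right)
    ultimately show ?thesis by simp
  qed
  then show ?thesis using \<pi> r0 r1 A unfolding z0_def by blast
qed

subsection \<open>Continuity and compactness in the explicit Euclidean spaces\<close>

lemma closed_eball_iff: "x \<in> closed_eball N r \<longleftrightarrow> (\<forall>k\<ge>N. x k = 0) \<and> enorm N x \<le> r"
  by (simp add: closed_eball_def topspace_Euclidean_space)

lemma open_eball_iff: "x \<in> open_eball N r \<longleftrightarrow> (\<forall>k\<ge>N. x k = 0) \<and> enorm N x < r"
  by (simp add: open_eball_def topspace_Euclidean_space)

lemma continuous_on_coordinate [continuous_intros]: "continuous_on S (\<lambda>x. x i)"
  for S :: "('a \<Rightarrow> 'b::topological_space) set"
  by (rule continuous_on_subset[OF continuous_on_product_coordinates]) simp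

lemma continuous_on_enorm [continuous_intros]:
  assumes "\<And>k. k < N \<Longrightarrow> continuous_on S (\<lambda>x. f x k)"
  shows "continuous_on S (\<lambda>x. enorm N (f x))"
  unfolding enorm_def L2_set_def by (intro continuous_intros assms) auto

lemma continuous_on_ip [continuous_intros]:
  assumes "\<And>k. k < N \<Longrightarrow> continuous_on S (\<lambda>x. f x k)" "\<And>k. k < N \<Longrightarrow> continuous_on S (\<lambda>x. g x k)"
  shows "continuous_on S (\<lambda>x. ip N (f x) (g x))"
  unfolding ip_def by (intro continuous_intros assms) auto

lemma continuous_on_qf [continuous_intros]:
  assumes "\<And>k. k < N \<Longrightarrow> continuous_on S (\<lambda>x. f x k)"
  shows "continuous_on S (\<lambda>x. qf N A (f x))"
  unfolding qf_def by (intro continuous_intros assms) auto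

lemma compact_closed_eball: "compact (closed_eball N r)"
proof -
  define K where "K = (\<lambda>i. if i < N then {-r..r} else {0::real})"
  have "compactin (product_topology (\<lambda>_. euclidean) UNIV) (PiE UNIV K)"
    by (subst compactin_PiE) (auto simp: K_def)
  then have c: "compact (PiE UNIV K)"
    by (simp only: euclidean_product_topology compactin_euclidean_iff)
  have "closed {x. enorm N x \<le> r}"
    by (intro closed_Collect_le continuous_intros)
  then have "compact (PiE UNIV K \<inter> {x. enorm N x \<le> r})" using c by (rule compact_Int_closed[rotated])
  moreover have "closed_eball N r = PiE UNIV K \<inter> {x. enorm N x \<le> r}"
  proof (rule Set.set_eqI)
    fix x
    have "x k \<in> {-r..r}" if "enorm N x \<le> r" "k < N" for k
      using abs_le_enorm[OF that(2), of x] that(1) by (auto simp: abs_le_iff)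
    then show "x \<in> closed_eball N r \<longleftrightarrow> x \<in> PiE UNIV K \<inter> {x. enorm N x \<le> r}"
      by (auto simp: closed_eball_iff K_def PiE_iff split: if_splits)
  qed
  ultimately show ?thesis by simp
qed

lemma continuous_on_enorm_lipschitz:
  assumes "\<And>x y. x \<in> S \<Longrightarrow> y \<in> S \<Longrightarrow> \<bar>f x - f y\<bar> \<le> L * enorm N (\<lambda>k. x k - y k)"
  shows "continuous_on S (f :: _ \<Rightarrow> real)"
  unfolding continuous_on_def
proof
  fix x assume x: "x \<in> S"
  have "continuous_on S (\<lambda>y. L * enorm N (\<lambda>k. y k - x k))" by (intro continuous_intros)
  then have "((\<lambda>y. L * enorm N (\<lambda>k. y k - x k)) \<longlongrightarrow> L * enorm N (\<lambda>k. x k - x k)) (at x within S)"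
    using x unfolding continuous_on_def by blast
  then have "((\<lambda>y. L * enorm N (\<lambda>k. y k - x k)) \<longlongrightarrow> 0) (at x within S)" by simp
  then have "((\<lambda>y. f y - f x) \<longlongrightarrow> 0) (at x within S)"
  proof (rule Lim_null_comparison[rotated])
    show "\<forall>\<^sub>F y in at x within S. norm (f y - f x) \<le> L * enorm N (\<lambda>k. y k - x k)"
      using assms x by (auto simp: eventually_at_filter)
  qed
  then show "(f \<longlongrightarrow> f x) (at x within S)" by (subst Lim_null)
qed

text \<open>Points of \<open>S\<close> agree from coordinate N on, so only the first N factors of a
  product neighbourhood are a restriction, and finitely many radii have a positive minimum. The
  inserted 1 covers N = 0.\<close>

lemma continuous_on_enormD:
  fixes u :: "(nat \<Rightarrow> real) \<Rightarrow> real"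
  assumes u: "continuous_on S u" and S: "\<And>x k. x \<in> S \<Longrightarrow> N \<le> k \<Longrightarrow> x k = 0" and x: "x \<in> S" and e: "0 < e"
  shows "\<exists>d>0. \<forall>y\<in>S. enorm N (\<lambda>k. y k - x k) < d \<longrightarrow> \<bar>u y - u x\<bar> < e"
proof -
  obtain A where A: "open A" "x \<in> A" "\<And>y. y \<in> S \<Longrightarrow> y \<in> A \<Longrightarrow> u y \<in> ball (u x) e"
    using u x e unfolding continuous_on_topological by (metis centre_in_ball open_ball)
  have "openin (product_topology (\<lambda>_. euclidean) UNIV) A" using A(1) by (simp add: euclidean_product_topology)
  then obtain X where X: "x \<in> PiE UNIV X" "\<And>i. openin euclidean (X i)" "PiE UNIV X \<subseteq> A"
    using product_topology_open_contains_basis[OF _ A(2), of "\<lambda>_. euclidean" UNIV] by blast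
  have "\<exists>d>0. ball (x i) d \<subseteq> X i" for i
    using X(1,2) by (metis PiE_mem UNIV_I open_contains_ball open_openin)
  then obtain D where D: "\<And>i. 0 < D i" "\<And>i. ball (x i) (D i) \<subseteq> X i" by metis
  define d where "d = Min (insert 1 (D ` {..<N}))"
  have d: "0 < d" "\<And>i. i < N \<Longrightarrow> d \<le> D i" using D(1) by (auto simp: d_def)
  have "\<bar>u y - u x\<bar> < e" if y: "y \<in> S" "enorm N (\<lambda>k. y k - x k) < d" for y
  proof -
    have "y i \<in> X i" for i
    proof (cases "i < N")
      case True
      then have "\<bar>y i - x i\<bar> < D i" using abs_le_enorm[OF True, of "\<lambda>k. y k - x k"] y(2) d(2)[OF True] by simp
      then show ?thesis using D(2)[of i] by (auto simp: dist_real_def abs_minus_commute)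
    next
      case False
      then have "y i = x i" using S[OF y(1)] S[OF x] by simp
      then show ?thesis using D[of i] by auto
    qed
    then have "y \<in> A" using X(3) by (auto simp: PiE_iff)
    then show ?thesis using A(3)[OF y(1)] by (simp add: dist_real_def abs_minus_commute)
  qed
  then show ?thesis using d(1) by blast
qed

section \<open>Quadratic expansions and perturbed maxima\<close>

lemma gradient_unique:
  assumes d: "0 < d" and le: "\<And>w. (\<And>k. N \<le> k \<Longrightarrow> w k = 0) \<Longrightarrow> enorm N w < d \<Longrightarrow> ip N a w \<le> ip N b w + M * (enorm N w)\<^sup>2" and M: "0 \<le> M" and k: "k < N"
  shows "a k = b k"
proof -
  define v where "v = (\<lambda>k. if k < N then a k - b k else 0)"
  have vv: "ip N (\<lambda>k. a k - b k) v = (enorm N v)\<^sup>2"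
    unfolding enorm_sq ip_def by (rule sum.cong) (auto simp: v_def)
  define t where "t = min (d / (2 * (enorm N v + 1))) (1 / (2 * (M + 1)))"
  have t0: "0 < t" using d M by (auto simp: t_def intro!: divide_pos_pos add_nonneg_pos)
  have "t * enorm N v < d"
  proof -
    have "t * enorm N v \<le> d / (2 * (enorm N v + 1)) * (enorm N v + 1)" using t0 d by (intro mult_mono) (auto simp: t_def)
    also have "\<dots> = d / 2" using enorm_nonneg[of N v] by (simp add: field_simps add_nonneg_eq_0_iff)
    finally show ?thesis using d by simp
  qed
  then have "enorm N (\<lambda>k. t * v k) < d" using t0 by (simp add: enorm_scale)
  then have "ip N a (\<lambda>k. t * v k) \<le> ip N b (\<lambda>k. t * v k) + M * (enorm N (\<lambda>k. t * v k))\<^sup>2"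
    by (intro le) (auto simp: v_def)
  then have "t * ip N (\<lambda>k. a k - b k) v \<le> M * (t\<^sup>2 * (enorm N v)\<^sup>2)"
    by (simp add: ip_scale_right enorm_scale_sq ip_diff_left algebra_simps)
  then have "t * (enorm N v)\<^sup>2 \<le> t * ((M * t) * (enorm N v)\<^sup>2)" unfolding vv by (simp add: power2_eq_square mult_ac)
  then have le2: "(enorm N v)\<^sup>2 \<le> (M * t) * (enorm N v)\<^sup>2" using t0 by (simp only: mult_le_cancel_left_pos)
  have "M * t \<le> (M + 1) * (1 / (2 * (M + 1)))" using M t0 by (intro mult_mono) (auto simp: t_def)
  also have "\<dots> = 1 / 2" using M by (simp add: field_simps)
  finally have "(M * t) * (enorm N v)\<^sup>2 \<le> 1 / 2 * (enorm N v)\<^sup>2" by (intro mult_right_mono) auto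
  then have "(enorm N v)\<^sup>2 \<le> 0" using le2 by linarith
  then have "enorm N v = 0" by simp
  then have "v k = 0" using abs_le_enorm[OF k, of v] by simp
  then show ?thesis using k by (simp add: v_def)
qed

definition mv :: "nat \<Rightarrow> (nat \<Rightarrow> nat \<Rightarrow> real) \<Rightarrow> (nat \<Rightarrow> real) \<Rightarrow> nat \<Rightarrow> real" where
  "mv N A x = (\<lambda>j. \<Sum>k<N. A j k * x k)"

lemma qf_add:
  assumes "\<And>j k. A j k = A k j"
  shows "qf N A (\<lambda>k. x k + w k) = qf N A x + 2 * ip N (mv N A x) w + qf N A w"
proof -
  have "(\<Sum>j<N. \<Sum>k<N. A j k * x j * w k) = (\<Sum>j<N. \<Sum>k<N. A j k * w j * x k)"
    by (subst sum.swap, intro sum.cong refl) (subst assms, simp)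
  moreover have "ip N (mv N A x) w = (\<Sum>j<N. \<Sum>k<N. A j k * w j * x k)"
    by (simp add: ip_def mv_def sum_distrib_left sum_distrib_right mult_ac)
  ultimately show ?thesis
    by (simp add: qf_def sum.distrib algebra_simps)
qed

lemma qf_diag: "qf N (\<lambda>j k. t * A j k + (if j = k then d else 0)) x = t * qf N A x + d * (enorm N x)\<^sup>2"
proof -
  have "(\<Sum>k<N. (if j = k then d else 0) * x j * x k) = d * (x j * x j)" if "j < N" for j
  proof -
    have "(\<Sum>k<N. (if j = k then d else 0) * x j * x k) = (\<Sum>k<N. if j = k then d * (x j * x j) else 0)"
      by (rule sum.cong) auto
    then show ?thesis using that by simp
  qed
  then show ?thesis
    unfolding enorm_sq qf_def ip_def sum_distrib_left
    by (simp add: distrib_right sum.distrib sum_distrib_left mult.assoc)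
qed

lemma qf_le: "\<bar>qf N A x\<bar> \<le> (\<Sum>j<N. \<Sum>k<N. \<bar>A j k\<bar>) * (enorm N x)\<^sup>2"
  unfolding qf_def sum_distrib_right
proof (rule order_trans[OF sum_abs sum_mono], rule order_trans[OF sum_abs sum_mono])
  fix j k assume "j \<in> {..<N}" "k \<in> {..<N}"
  then have "\<bar>x j\<bar> * \<bar>x k\<bar> \<le> enorm N x * enorm N x" by (intro mult_mono abs_le_enorm) auto
  then show "\<bar>A j k * x j * x k\<bar> \<le> \<bar>A j k\<bar> * (enorm N x)\<^sup>2"
    by (simp add: abs_mult power2_eq_square mult_left_mono mult.assoc)
qed

text \<open>Re-expansion at \<open>z\<close> changes the matrix only by a multiple of the identity;
  the slope is left existential because the touching point determines it. The factor 1 in front of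
  \<open>A j k\<close> matches the form t A + d I of the eigenvalue rule.\<close>

lemma quadratic_recenter:
  assumes "\<And>j k. A j k = A k j"
  shows "\<exists>G. \<forall>y. c0 + ip N g (\<lambda>k. y k - c k) + qf N A (\<lambda>k. y k - c k) / 2 + d * (enorm N (\<lambda>k. y k - z0 k))\<^sup>2 + e * (enorm N y)\<^sup>2 + ip N p y
    = (c0 + ip N g (\<lambda>k. z k - c k) + qf N A (\<lambda>k. z k - c k) / 2 + d * (enorm N (\<lambda>k. z k - z0 k))\<^sup>2 + e * (enorm N z)\<^sup>2 + ip N p z)
      + ip N G (\<lambda>k. y k - z k) + qf N (\<lambda>j k. 1 * A j k + (if j = k then 2 * d + 2 * e else 0)) (\<lambda>k. y k - z k) / 2"
proof (intro exI allI)
  fix y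
  define w where "w = (\<lambda>k. y k - z k)"
  have 1: "(\<lambda>k. y k - c k) = (\<lambda>k. (z k - c k) + w k)" "(\<lambda>k. y k - z0 k) = (\<lambda>k. (z k - z0 k) + w k)" "y = (\<lambda>k. z k + w k)"
    by (auto simp: w_def)
  have 2: "(enorm N y)\<^sup>2 = (enorm N z)\<^sup>2 + 2 * ip N z w + (enorm N w)\<^sup>2" "ip N p y = ip N p z + ip N p w"
    using arg_cong[OF 1(3), of "\<lambda>y. (enorm N y)\<^sup>2"] arg_cong[OF 1(3), of "ip N p"]
    by (simp_all only: enorm_add_sq ip_add_right)
  show "c0 + ip N g (\<lambda>k. y k - c k) + qf N A (\<lambda>k. y k - c k) / 2 + d * (enorm N (\<lambda>k. y k - z0 k))\<^sup>2 + e * (enorm N y)\<^sup>2 + ip N p y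
    = (c0 + ip N g (\<lambda>k. z k - c k) + qf N A (\<lambda>k. z k - c k) / 2 + d * (enorm N (\<lambda>k. z k - z0 k))\<^sup>2 + e * (enorm N z)\<^sup>2 + ip N p z)
      + ip N (\<lambda>k. g k + mv N A (\<lambda>k. z k - c k) k + (2 * d) * (z k - z0 k) + (2 * e) * z k + p k) (\<lambda>k. y k - z k)
      + qf N (\<lambda>j k. 1 * A j k + (if j = k then 2 * d + 2 * e else 0)) (\<lambda>k. y k - z k) / 2"
    unfolding w_def[symmetric] 1(1,2) qf_diag 2 qf_add[OF assms] enorm_add_sq ip_add_left ip_add_right ip_scale_left
    by (simp add: algebra_simps add_divide_distrib)
qed

text \<open>The error \<eta> r^2 may occur once at the centre and once on the sphere, where the
  paraboloid costs \<delta> r^2. As 2 \<eta> < \<delta>, the maximum lies inside: an approximate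
  quadratic becomes one that touches exactly, at a nearby point.\<close>

lemma interior_maximum:
  assumes T: "continuous_on {y. (\<forall>k\<ge>N. y k = 0) \<and> enorm N (\<lambda>k. y k - z0 k) \<le> r} T"
    and z0: "\<forall>k\<ge>N. z0 k = 0" and r: "0 < r" and \<eta>: "2 * \<eta> < \<delta>"
    and a: "a - \<eta> * r\<^sup>2 \<le> T z0"
    and bd: "\<And>y. \<forall>k\<ge>N. y k = 0 \<Longrightarrow> enorm N (\<lambda>k. y k - z0 k) = r \<Longrightarrow> T y \<le> a + \<eta> * r\<^sup>2 - \<delta> * r\<^sup>2"
  shows "\<exists>z1. (\<forall>k\<ge>N. z1 k = 0) \<and> enorm N (\<lambda>k. z1 k - z0 k) < r \<and>
    (\<forall>y. (\<forall>k\<ge>N. y k = 0) \<longrightarrow> enorm N (\<lambda>k. y k - z0 k) \<le> r \<longrightarrow> T y \<le> (T z1 :: real))"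
proof -
  define S where "S = {y. (\<forall>k\<ge>N. y k = 0) \<and> enorm N (\<lambda>k. y k - z0 k) \<le> r}"
  have "S = closed_eball N (r + enorm N z0) \<inter> {y. enorm N (\<lambda>k. y k - z0 k) \<le> r}"
    using enorm_le_add_diff[of N _ z0] by (force simp: S_def closed_eball_iff intro: order_trans)
  moreover have "closed {y. enorm N (\<lambda>k. y k - z0 k) \<le> r}" by (intro closed_Collect_le continuous_intros)
  ultimately have "compact S" using compact_closed_eball by (simp add: compact_Int_closed)
  moreover have z0S: "z0 \<in> S" using z0 r by (simp add: S_def)
  ultimately obtain z1 where z1: "z1 \<in> S" "\<And>y. y \<in> S \<Longrightarrow> T y \<le> T z1"
    using continuous_attains_sup[of S T] T[folded S_def] by blast
  have "enorm N (\<lambda>k. z1 k - z0 k) \<noteq> r"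
  proof
    assume "enorm N (\<lambda>k. z1 k - z0 k) = r"
    then have "T z1 \<le> a + \<eta> * r\<^sup>2 - \<delta> * r\<^sup>2" using z1(1) by (intro bd) (auto simp: S_def)
    moreover have "2 * \<eta> * r\<^sup>2 < \<delta> * r\<^sup>2" using \<eta> r by (intro mult_strict_right_mono) auto
    ultimately show False using z1(2)[OF z0S] a by linarith
  qed
  then show ?thesis using z1 by (intro exI[of _ z1]) (auto simp: S_def)
qed

subsection \<open>Sup-convolutions\<close>

text \<open>The point \<open>z\<close> enters scaled by \<open>c\<close>. With the factors c and 1
  in the two convolutions, one variable \<open>z\<close> drives the pair \<open>(c * z, z)\<close>
  of displacements.\<close>

definition supconv :: "nat \<Rightarrow> real \<Rightarrow> real \<Rightarrow> real \<Rightarrow> ((nat \<Rightarrow> real) \<Rightarrow> real) \<Rightarrow> (nat \<Rightarrow> real) \<Rightarrow> real" where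
  "supconv N \<rho> K c u z = (SUP h\<in>closed_eball N \<rho>. u h - K * (enorm N (\<lambda>k. h k - c * z k))\<^sup>2)"

definition sc_at :: "nat \<Rightarrow> real \<Rightarrow> real \<Rightarrow> real \<Rightarrow> ((nat \<Rightarrow> real) \<Rightarrow> real) \<Rightarrow> (nat \<Rightarrow> real) \<Rightarrow> (nat \<Rightarrow> real) \<Rightarrow> bool" where
  "sc_at N \<rho> K c u z h \<longleftrightarrow> h \<in> closed_eball N \<rho> \<and> supconv N \<rho> K c u z = u h - K * (enorm N (\<lambda>k. h k - c * z k))\<^sup>2"

lemma zero_in_closed_eball: "0 \<le> \<rho> \<Longrightarrow> (\<lambda>_. 0) \<in> closed_eball N \<rho>"
  by (simp add: closed_eball_iff)

lemma supconv_attained: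
  assumes u: "continuous_on (closed_eball N \<rho>) u" and \<rho>: "0 \<le> \<rho>"
  shows "\<exists>h. sc_at N \<rho> K c u z h"
    and "h \<in> closed_eball N \<rho> \<Longrightarrow> u h - K * (enorm N (\<lambda>k. h k - c * z k))\<^sup>2 \<le> supconv N \<rho> K c u z"
proof -
  let ?f = "\<lambda>h. u h - K * (enorm N (\<lambda>k. h k - c * z k))\<^sup>2"
  have "continuous_on (closed_eball N \<rho>) ?f" by (intro continuous_intros u)
  then obtain h0 where h0: "h0 \<in> closed_eball N \<rho>" "\<And>h. h \<in> closed_eball N \<rho> \<Longrightarrow> ?f h \<le> ?f h0"
    using continuous_attains_sup[OF compact_closed_eball, of N \<rho> ?f] zero_in_closed_eball[OF \<rho>] by blast
  have "supconv N \<rho> K c u z = ?f h0" unfolding supconv_def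
    by (rule cSup_eq_maximum) (use h0 in auto)
  then show "\<exists>h. sc_at N \<rho> K c u z h" and "h \<in> closed_eball N \<rho> \<Longrightarrow> ?f h \<le> supconv N \<rho> K c u z"
    using h0 by (auto simp: sc_at_def)
qed

lemma supconv_cong: "(\<And>k. k < N \<Longrightarrow> y k = y' k) \<Longrightarrow> supconv N \<rho> K c u y = supconv N \<rho> K c u y'"
  unfolding supconv_def by (intro arg_cong[of _ _ Sup] image_cong refl arg_cong2[of _ _ _ _ "(-)"] arg_cong2[of _ _ _ _ "(*)"] arg_cong[of _ _ "\<lambda>x. x\<^sup>2"] enorm_cong) simp

text \<open>The maximizer at \<open>z\<close> is a competitor at every \<open>y\<close>. This gives
  semiconvexity with an explicit slope.\<close>

lemma supconv_lower:
  assumes u: "continuous_on (closed_eball N \<rho>) u" and \<rho>: "0 \<le> \<rho>" and h: "sc_at N \<rho> K c u z h"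
  shows "supconv N \<rho> K c u z + 2 * c * K * ip N (\<lambda>k. h k - c * z k) (\<lambda>k. y k - z k) - K * c\<^sup>2 * (enorm N (\<lambda>k. y k - z k))\<^sup>2
     \<le> supconv N \<rho> K c u y"
proof -
  have "u h - K * (enorm N (\<lambda>k. h k - c * y k))\<^sup>2 \<le> supconv N \<rho> K c u y"
    by (rule supconv_attained(2)[OF u \<rho>]) (use h in \<open>auto simp: sc_at_def\<close>)
  moreover have "(\<lambda>k. h k - c * y k) = (\<lambda>k. (h k - c * z k) - c * (y k - z k))" by (auto simp: algebra_simps)
  then have "(enorm N (\<lambda>k. h k - c * y k))\<^sup>2 = (enorm N (\<lambda>k. h k - c * z k))\<^sup>2 - 2 * (c * ip N (\<lambda>k. h k - c * z k) (\<lambda>k. y k - z k)) + c\<^sup>2 * (enorm N (\<lambda>k. y k - z k))\<^sup>2"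
    by (simp only: enorm_diff_sq[of N "\<lambda>k. h k - c * z k" "\<lambda>k. c * (y k - z k)"] ip_scale_right enorm_scale_sq)
  ultimately show ?thesis using h by (simp add: sc_at_def algebra_simps)
qed

text \<open>Comparison with the competitor 0. Since u is at most a quarter of the penalty constant
  times |h|^2, the displacement a satisfies a^2 \<le> 3 b^2, and 3 is rounded up to 4.\<close>

lemma supconv_near:
  assumes u: "continuous_on (closed_eball N \<rho>) u" and \<rho>: "0 \<le> \<rho>" and h: "sc_at N \<rho> K c u z h"
    and u0: "u (\<lambda>_. 0) = 0" and up: "\<And>h. h \<in> closed_eball N \<rho> \<Longrightarrow> u h \<le> K0 * (enorm N h)\<^sup>2"
    and K: "4 * K0 \<le> K" "0 < K" "0 < c"
  shows "enorm N (\<lambda>k. h k - c * z k) \<le> 2 * c * enorm N z" "enorm N h \<le> 3 * c * enorm N z"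
proof -
  define a where "a = enorm N (\<lambda>k. h k - c * z k)"
  define b where "b = c * enorm N z"
  have ab0: "0 \<le> a" "0 \<le> b" using K by (auto simp: a_def b_def)
  have hab: "enorm N h \<le> b + a"
    using enorm_le_add_diff[of N h "\<lambda>k. c * z k"] K by (simp add: a_def b_def enorm_scale)
  have "u (\<lambda>_. 0) - K * (enorm N (\<lambda>k. 0 - c * z k))\<^sup>2 \<le> u h - K * a\<^sup>2"
    using supconv_attained(2)[OF u \<rho> zero_in_closed_eball[OF \<rho>], of K c z] h by (simp add: sc_at_def a_def)
  moreover have "(enorm N (\<lambda>k. 0 - c * z k))\<^sup>2 = b\<^sup>2"
    using K by (simp add: enorm_minus enorm_scale b_def power_mult_distrib)
  moreover have "u h \<le> K0 * (enorm N h)\<^sup>2" using h up by (auto simp: sc_at_def)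
  moreover have "K0 * (enorm N h)\<^sup>2 \<le> K / 4 * (enorm N h)\<^sup>2" using K by (intro mult_right_mono) auto
  moreover have "K / 4 * (enorm N h)\<^sup>2 \<le> K / 4 * (2 * b\<^sup>2 + 2 * a\<^sup>2)"
  proof (rule mult_left_mono)
    have "(enorm N h)\<^sup>2 \<le> (b + a)\<^sup>2" using hab by (intro power_mono) auto
    also have "\<dots> \<le> 2 * b\<^sup>2 + 2 * a\<^sup>2" using zero_le_power2[of "b - a"] by (simp add: power2_eq_square algebra_simps)
    finally show "(enorm N h)\<^sup>2 \<le> 2 * b\<^sup>2 + 2 * a\<^sup>2" .
  qed (use K in auto)
  ultimately have "- (K * b\<^sup>2) \<le> K / 4 * (2 * b\<^sup>2 + 2 * a\<^sup>2) - K * a\<^sup>2" using u0 by simp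
  then have "K * a\<^sup>2 \<le> K * (3 * b\<^sup>2)" by (simp add: algebra_simps)
  then have "a\<^sup>2 \<le> 3 * b\<^sup>2" using K by (simp only: mult_le_cancel_left_pos)
  also have "\<dots> \<le> (2 * b)\<^sup>2" by (simp add: power_mult_distrib)
  finally have "a \<le> 2 * b" by (rule power2_le_imp_le) (use ab0 in auto)
  then show "enorm N (\<lambda>k. h k - c * z k) \<le> 2 * c * enorm N z" "enorm N h \<le> 3 * c * enorm N z"
    using hab by (auto simp: a_def b_def)
qed

lemma supconv_lipschitz:
  assumes u: "continuous_on (closed_eball N \<rho>) u" and \<rho>: "0 \<le> \<rho>"
    and u0: "u (\<lambda>_. 0) = 0" and up: "\<And>h. h \<in> closed_eball N \<rho> \<Longrightarrow> u h \<le> K0 * (enorm N h)\<^sup>2"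
    and K: "4 * K0 \<le> K" "0 < K" "0 < c"
  shows "enorm N y \<le> 1 \<Longrightarrow> enorm N z \<le> 1 \<Longrightarrow>
    \<bar>supconv N \<rho> K c u y - supconv N \<rho> K c u z\<bar> \<le> 6 * c\<^sup>2 * K * enorm N (\<lambda>k. y k - z k)"
proof -
  have one: "supconv N \<rho> K c u z - supconv N \<rho> K c u y \<le> 6 * c\<^sup>2 * K * enorm N (\<lambda>k. y k - z k)"
    if yz: "enorm N y \<le> 1" "enorm N z \<le> 1" for y z
  proof -
    obtain h where h: "sc_at N \<rho> K c u z h" using supconv_attained(1)[OF u \<rho>] by blast
    define d where "d = enorm N (\<lambda>k. y k - z k)"
    have d: "0 \<le> d" "d \<le> 2" using enorm_diff_le[of N y z] yz by (auto simp: d_def)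
    have "\<bar>ip N (\<lambda>k. h k - c * z k) (\<lambda>k. y k - z k)\<bar> \<le> enorm N (\<lambda>k. h k - c * z k) * d"
      unfolding d_def by (rule ip_le)
    also have "\<dots> \<le> 2 * c * d"
    proof (rule mult_right_mono)
      have "2 * c * enorm N z \<le> 2 * c * 1" using yz K by (intro mult_left_mono) auto
      then show "enorm N (\<lambda>k. h k - c * z k) \<le> 2 * c"
        using supconv_near(1)[OF u \<rho> h u0 up K] by simp
    qed (use d in auto)
    finally have i: "\<bar>ip N (\<lambda>k. h k - c * z k) (\<lambda>k. y k - z k)\<bar> \<le> 2 * c * d" .
    have "2 * c * K * (- ip N (\<lambda>k. h k - c * z k) (\<lambda>k. y k - z k)) \<le> 2 * c * K * (2 * c * d)"
      using i K by (intro mult_left_mono) auto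
    moreover have "K * c\<^sup>2 * d\<^sup>2 \<le> K * c\<^sup>2 * (2 * d)"
      using d K by (intro mult_left_mono) (auto simp: power2_eq_square mult_right_mono)
    moreover have "2 * c * K * (2 * c * d) = 4 * (c\<^sup>2 * K * d)" "K * c\<^sup>2 * (2 * d) = 2 * (c\<^sup>2 * K * d)"
      "6 * c\<^sup>2 * K * d = 6 * (c\<^sup>2 * K * d)" by (simp_all add: power2_eq_square)
    ultimately show ?thesis using supconv_lower[OF u \<rho> h, of y]
      unfolding d_def[symmetric] mult_minus_right by linarith
  qed
  assume "enorm N y \<le> 1" "enorm N z \<le> 1"
  then show ?thesis using one[of y z] one[of z y] enorm_minus_commute[of N y z] by (simp add: abs_le_iff)
qed

text \<open>Along \<open>z = z1 + (h - h1) / c\<close> the vector \<open>h - c * z\<close> is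
  constant, so the penalty cancels and a quadratic above the convolution becomes one above u, with
  slope G / c and matrix B / c^2. The slope is known because \<open>supconv_lower\<close> also puts
  a paraboloid below the convolution at \<open>z1\<close>.\<close>

lemma supconv_touch:
  assumes u: "continuous_on (closed_eball N \<rho>) u" and \<rho>: "0 \<le> \<rho>" and h1: "sc_at N \<rho> K c u z1 h1" and K: "0 < K" "0 < c"
    and z1: "\<forall>k\<ge>N. z1 k = 0" and e: "0 < e"
    and t: "\<And>z. \<forall>k\<ge>N. z k = 0 \<Longrightarrow> enorm N (\<lambda>k. z k - z1 k) < e \<Longrightarrow>
      supconv N \<rho> K c u z \<le> supconv N \<rho> K c u z1 + ip N G (\<lambda>k. z k - z1 k) + qf N B (\<lambda>k. z k - z1 k) / 2"
  shows "k < N \<Longrightarrow> G k = 2 * c * K * (h1 k - c * z1 k)"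
    and "\<exists>d>0. \<forall>h\<in>closed_eball N \<rho>. enorm N (\<lambda>k. h k - h1 k) < d \<longrightarrow>
      u h \<le> u h1 + ip N (\<lambda>k. G k / c) (\<lambda>k. h k - h1 k) + qf N (\<lambda>j k. B j k / c\<^sup>2) (\<lambda>k. h k - h1 k) / 2"
proof -
  define S where "S = (\<Sum>j<N. \<Sum>k<N. \<bar>B j k\<bar>)"
  have S0: "0 \<le> S" by (simp add: S_def sum_nonneg)
  have "ip N (\<lambda>k. 2 * c * K * (h1 k - c * z1 k)) w \<le> ip N G w + (K * c\<^sup>2 + S) * (enorm N w)\<^sup>2"
    if w: "\<And>k. N \<le> k \<Longrightarrow> w k = 0" "enorm N w < e" for w
  proof -
    have e1: "(\<lambda>k. (z1 k + w k) - z1 k) = w" by auto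
    have "supconv N \<rho> K c u (\<lambda>k. z1 k + w k) \<le> supconv N \<rho> K c u z1 + ip N G w + qf N B w / 2"
      using t[of "\<lambda>k. z1 k + w k"] w z1 unfolding e1 by simp
    moreover have "qf N B w / 2 \<le> S * (enorm N w)\<^sup>2"
      using qf_le[of N B w] S0 unfolding S_def[symmetric] by (smt (verit) field_sum_of_halves zero_le_power2 mult_nonneg_nonneg)
    moreover note supconv_lower[OF u \<rho> h1, of "\<lambda>k. z1 k + w k", unfolded e1]
    moreover have "(K * c\<^sup>2 + S) * (enorm N w)\<^sup>2 = K * c\<^sup>2 * (enorm N w)\<^sup>2 + S * (enorm N w)\<^sup>2"
      by (rule distrib_right)
    ultimately show ?thesis unfolding ip_scale_left by linarith
  qed
  then show "k < N \<Longrightarrow> G k = 2 * c * K * (h1 k - c * z1 k)"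
    using gradient_unique[OF e, of N "\<lambda>k. 2 * c * K * (h1 k - c * z1 k)" G "K * c\<^sup>2 + S" k] K S0 by simp
  have "u h \<le> u h1 + ip N (\<lambda>k. G k / c) (\<lambda>k. h k - h1 k) + qf N (\<lambda>j k. B j k / c\<^sup>2) (\<lambda>k. h k - h1 k) / 2"
    if h: "h \<in> closed_eball N \<rho>" "enorm N (\<lambda>k. h k - h1 k) < c * e" for h
  proof -
    define z where "z = (\<lambda>k. z1 k + (1 / c) * (h k - h1 k))"
    have zz: "(\<lambda>k. z k - z1 k) = (\<lambda>k. (1 / c) * (h k - h1 k))" by (auto simp: z_def)
    have h1b: "h1 \<in> closed_eball N \<rho>" using h1 by (simp add: sc_at_def)
    have "enorm N (\<lambda>k. z k - z1 k) < e" unfolding zz enorm_scale using h(2) K by (simp add: field_simps)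
    moreover have "\<forall>k\<ge>N. z k = 0" using z1 h(1) h1b by (simp add: z_def closed_eball_iff)
    ultimately have "supconv N \<rho> K c u z \<le> supconv N \<rho> K c u z1 + ip N G (\<lambda>k. z k - z1 k) + qf N B (\<lambda>k. z k - z1 k) / 2" by (intro t)
    moreover have "u h - K * (enorm N (\<lambda>k. h k - c * z k))\<^sup>2 \<le> supconv N \<rho> K c u z" by (rule supconv_attained(2)[OF u \<rho> h(1)])
    moreover have "(\<lambda>k. h k - c * z k) = (\<lambda>k. h1 k - c * z1 k)" using K by (auto simp: z_def field_simps)
    moreover have "ip N G (\<lambda>k. z k - z1 k) = ip N (\<lambda>k. G k / c) (\<lambda>k. h k - h1 k)"
      unfolding zz by (simp add: ip_def)
    moreover have "qf N B (\<lambda>k. z k - z1 k) = qf N (\<lambda>j k. B j k / c\<^sup>2) (\<lambda>k. h k - h1 k)"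
      unfolding zz by (simp add: qf_def power2_eq_square)
    ultimately show ?thesis using h1 by (simp add: sc_at_def)
  qed
  then show "\<exists>d>0. \<forall>h\<in>closed_eball N \<rho>. enorm N (\<lambda>k. h k - h1 k) < d \<longrightarrow>
      u h \<le> u h1 + ip N (\<lambda>k. G k / c) (\<lambda>k. h k - h1 k) + qf N (\<lambda>j k. B j k / c\<^sup>2) (\<lambda>k. h k - h1 k) / 2"
    using K e by (intro exI[of _ "c * e"]) auto
qed

section \<open>The comparison of second-order superjets\<close>

lemma qf_uminus: "qf N (\<lambda>j k. - A j k) x = - qf N A x"
  by (simp add: qf_def sum_negf)

lemma ip_minus_left: "ip N (\<lambda>k. - x k) y = - ip N x y"
  by (simp add: ip_def sum_negf)

lemma enorm_recenter: "(enorm N y)\<^sup>2 = (enorm N z)\<^sup>2 + 2 * ip N z (\<lambda>k. y k - z k) + (enorm N (\<lambda>k. y k - z k))\<^sup>2"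
  using enorm_add_sq[of N z "\<lambda>k. y k - z k"] by simp

text \<open>Neither convolution need be twice differentiable at a given point. Instead one matrix A,
  found near a contact point for U plus a paraboloid, is used twice: it bounds U from above directly
  and, since the sum \<open>w\<close> stays below its tilted tangent, it bounds V from above with
  -A. Both bounds are made to touch by adding a paraboloid of size \<delta>. Then
  \<open>lam A\<close> is bounded below through \<sigma>1 and above through \<sigma>2, and
  cancels.\<close>

lemma touching_inequality_aux:
  fixes lam :: "(nat \<Rightarrow> nat \<Rightarrow> real) \<Rightarrow> real"
  assumes N: "0 < N" and c: "0 < c" and R: "0 \<le> R" and K: "0 \<le> K" and \<rho>: "0 < \<rho>" and \<kappa>: "0 < \<kappa>" and \<delta>: "0 < \<delta>"
    and u1: "continuous_on (closed_eball N \<rho>) u1" "u1 (\<lambda>_. 0) = 0"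
    and u2: "continuous_on (closed_eball N \<rho>) u2" "u2 (\<lambda>_. 0) = 0"
    and ineq: "\<And>h l. h \<in> closed_eball N \<rho> \<Longrightarrow> l \<in> closed_eball N \<rho> \<Longrightarrow>
       u1 h + u2 l \<le> R / 2 * (enorm N l)\<^sup>2 + K * (enorm N (\<lambda>k. h k - c * l k))\<^sup>2"
    and lam: "\<And>A t d. (\<And>j k. A j k = A k j) \<Longrightarrow> 0 < t \<Longrightarrow> lam (\<lambda>j k. t * A j k + (if j = k then d else 0)) = t * lam A + d"
    and sub: "\<And>A g h0. (\<And>j k. A j k = A k j) \<Longrightarrow> \<forall>k\<ge>N. h0 k = 0 \<Longrightarrow> enorm N h0 < \<rho> \<Longrightarrow> enorm N g < \<rho> \<Longrightarrow>
       (\<exists>d>0. \<forall>h\<in>closed_eball N \<rho>. enorm N (\<lambda>k. h k - h0 k) < d \<longrightarrow>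
          u1 h \<le> u1 h0 + ip N g (\<lambda>k. h k - h0 k) + qf N A (\<lambda>k. h k - h0 k) / 2) \<Longrightarrow> \<sigma>1 \<le> lam A"
    and super: "\<And>A g h0. (\<And>j k. A j k = A k j) \<Longrightarrow> \<forall>k\<ge>N. h0 k = 0 \<Longrightarrow> enorm N h0 < \<rho> \<Longrightarrow> enorm N g < \<rho> \<Longrightarrow>
       (\<exists>d>0. \<forall>h\<in>closed_eball N \<rho>. enorm N (\<lambda>k. h k - h0 k) < d \<longrightarrow>
          u2 h \<le> u2 h0 + ip N g (\<lambda>k. h k - h0 k) + qf N A (\<lambda>k. h k - h0 k) / 2) \<Longrightarrow> lam (\<lambda>j k. - A j k) \<le> \<sigma>2"
  shows "c\<^sup>2 * \<sigma>1 \<le> \<sigma>2 + R + 2 * \<kappa> + 4 * \<delta>"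
proof -
  \<comment> \<open>Parameter in Young's inequality: it raises the coefficient R of |z|^2 to at most
    R + \<kappa>.\<close>
  define \<tau> where "\<tau> = \<kappa> / (R + 1)"
  have \<tau>0: "0 < \<tau>" using \<kappa> R by (simp add: \<tau>_def)
  have R\<tau>: "R * \<tau> \<le> \<kappa>" using \<kappa> R by (simp add: \<tau>_def field_simps)
  define K2 where "K2 = R / 2 + K * c\<^sup>2"
  \<comment> \<open>The summands 4 K and 4 K2 serve \<open>supconv_near\<close> for the two
    functions; the others let the penalties absorb the displacements of the maximizers in
    \<open>UV\<close>.\<close>
  define K' where "K' = 1 + 4 * K + 4 * K2 + R * (1 + 1 / \<tau>) / 2 + 2 * K * c\<^sup>2"
  have K20: "0 \<le> K2" using R K by (simp add: K2_def)
  have p1: "0 \<le> R * (1 + 1 / \<tau>) / 2" using R \<tau>0 by simp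
  have p2: "0 \<le> 2 * K * c\<^sup>2" using K by simp
  have K': "0 < K'" "4 * K \<le> K'" "4 * K2 \<le> K'" "2 * K \<le> K'" "R * (1 + 1 / \<tau>) / 2 + 2 * K * c\<^sup>2 \<le> K'"
    using K K20 p1 p2 unfolding K'_def by linarith+
  define U where "U = supconv N \<rho> K' c u1"
  define V where "V = supconv N \<rho> K' 1 u2"
  have \<rho>0: "0 \<le> \<rho>" using \<rho> by simp
  note z\<rho> = zero_in_closed_eball[OF \<rho>0, of N]
  have up1: "u1 h \<le> K * (enorm N h)\<^sup>2" if "h \<in> closed_eball N \<rho>" for h
    using ineq[OF that z\<rho>] u2(2) by simp
  have up2: "u2 l \<le> K2 * (enorm N l)\<^sup>2" if "l \<in> closed_eball N \<rho>" for l
    using ineq[OF z\<rho> that] u1(2) c by (simp add: enorm_minus enorm_scale K2_def power_mult_distrib algebra_simps)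
  define hs where "hs z = (SOME h. sc_at N \<rho> K' c u1 z h)" for z
  have hs: "sc_at N \<rho> K' c u1 z (hs z)" for z
    unfolding hs_def by (rule someI_ex[OF supconv_attained(1)[OF u1(1) \<rho>0]])
  define ls where "ls z = (SOME h. sc_at N \<rho> K' 1 u2 z h)" for z
  have ls: "sc_at N \<rho> K' 1 u2 z (ls z)" for z
    unfolding ls_def by (rule someI_ex[OF supconv_attained(1)[OF u2(1) \<rho>0]])
  have one0: "0 < (1::real)" by simp
  note hn = supconv_near[OF u1(1) \<rho>0 hs u1(2) up1 K'(2,1) c]
  note ln = supconv_near[OF u2(1) \<rho>0 ls u2(2) up2 K'(3,1) one0]
  have UV: "U z + V z \<le> (R + \<kappa>) / 2 * (enorm N z)\<^sup>2" for z
  proof -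
    define a where "a = enorm N (\<lambda>k. hs z k - c * z k)"
    define b where "b = enorm N (\<lambda>k. ls z k - 1 * z k)"
    define n where "n = enorm N z"
    have nn: "0 \<le> a" "0 \<le> b" "0 \<le> n" by (auto simp: a_def b_def n_def)
    have "U z + V z = u1 (hs z) + u2 (ls z) - K' * a\<^sup>2 - K' * b\<^sup>2"
      using hs[of z] ls[of z] by (simp add: sc_at_def U_def V_def a_def b_def)
    also have "u1 (hs z) + u2 (ls z) \<le> R / 2 * (enorm N (ls z))\<^sup>2 + K * (enorm N (\<lambda>k. hs z k - c * ls z k))\<^sup>2"
      using hs[of z] ls[of z] by (intro ineq) (auto simp: sc_at_def)
    finally have 1: "U z + V z \<le> R / 2 * (enorm N (ls z))\<^sup>2 + K * (enorm N (\<lambda>k. hs z k - c * ls z k))\<^sup>2 - K' * a\<^sup>2 - K' * b\<^sup>2" by simp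
    have "enorm N (ls z) \<le> n + b" using enorm_le_add_diff[of N "ls z" z] by (simp add: n_def b_def)
    then have "(enorm N (ls z))\<^sup>2 \<le> (n + b)\<^sup>2" by (intro power_mono) auto
    also have "\<dots> \<le> (1 + \<tau>) * n\<^sup>2 + (1 + 1 / \<tau>) * b\<^sup>2"
    proof -
      have "0 \<le> (\<tau> * n - b)\<^sup>2 / \<tau>" using \<tau>0 by simp
      also have "(\<tau> * n - b)\<^sup>2 / \<tau> = \<tau> * n\<^sup>2 - 2 * n * b + 1 / \<tau> * b\<^sup>2" using \<tau>0 by (simp add: power2_eq_square field_simps)
      finally show ?thesis by (simp add: power2_eq_square algebra_simps)
    qed
    finally have "R / 2 * (enorm N (ls z))\<^sup>2 \<le> R / 2 * ((1 + \<tau>) * n\<^sup>2 + (1 + 1 / \<tau>) * b\<^sup>2)" using R by (intro mult_left_mono) auto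
    also have "\<dots> = (R + R * \<tau>) / 2 * n\<^sup>2 + R * (1 + 1 / \<tau>) / 2 * b\<^sup>2" by (simp add: algebra_simps add_divide_distrib)
    also have "\<dots> \<le> (R + \<kappa>) / 2 * n\<^sup>2 + R * (1 + 1 / \<tau>) / 2 * b\<^sup>2" using R\<tau> by (intro add_right_mono mult_right_mono) auto
    finally have 2: "R / 2 * (enorm N (ls z))\<^sup>2 \<le> (R + \<kappa>) / 2 * n\<^sup>2 + R * (1 + 1 / \<tau>) / 2 * b\<^sup>2" .
    have "enorm N (\<lambda>k. hs z k - c * ls z k) \<le> a + c * b"
    proof -
      have "(\<lambda>k. hs z k - c * ls z k) = (\<lambda>k. (hs z k - c * z k) - c * (ls z k - 1 * z k))" by (auto simp: algebra_simps)
      then show ?thesis using enorm_diff_le[of N "\<lambda>k. hs z k - c * z k" "\<lambda>k. c * (ls z k - 1 * z k)"] c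
        by (simp only: enorm_scale a_def b_def abs_of_pos)
    qed
    then have "(enorm N (\<lambda>k. hs z k - c * ls z k))\<^sup>2 \<le> (a + c * b)\<^sup>2" by (intro power_mono) auto
    also have "\<dots> \<le> 2 * a\<^sup>2 + 2 * c\<^sup>2 * b\<^sup>2" using zero_le_power2[of "a - c * b"] by (simp add: power2_eq_square algebra_simps)
    finally have "K * (enorm N (\<lambda>k. hs z k - c * ls z k))\<^sup>2 \<le> K * (2 * a\<^sup>2 + 2 * c\<^sup>2 * b\<^sup>2)" using K by (intro mult_left_mono) auto
    then have 3: "K * (enorm N (\<lambda>k. hs z k - c * ls z k))\<^sup>2 \<le> 2 * K * a\<^sup>2 + 2 * K * c\<^sup>2 * b\<^sup>2" by (simp add: algebra_simps)
    have 4: "2 * K * a\<^sup>2 \<le> K' * a\<^sup>2" using K' by (intro mult_right_mono) auto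
    have "(R * (1 + 1 / \<tau>) / 2 + 2 * K * c\<^sup>2) * b\<^sup>2 \<le> K' * b\<^sup>2" using K' by (intro mult_right_mono) auto
    then have 5: "R * (1 + 1 / \<tau>) / 2 * b\<^sup>2 + 2 * K * c\<^sup>2 * b\<^sup>2 \<le> K' * b\<^sup>2" by (simp only: distrib_right)
    show ?thesis using 1 2 3 4 5 unfolding n_def by linarith
  qed
  \<comment> \<open>The second \<kappa> turns the bound on U + V into
    \<open>w z \<le> - (\<kappa> / 2) * (enorm N z)\<^sup>2\<close>, so that small tilts keep the
    contact point close to 0.\<close>
  define R2 where "R2 = R + 2 * \<kappa>"
  define w where "w z = U z + V z - R2 / 2 * (enorm N z)\<^sup>2" for z
  have w0: "w (\<lambda>_. 0) \<ge> 0"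
    using supconv_attained(2)[OF u1(1) \<rho>0 z\<rho>, of K' c "\<lambda>_. 0"] supconv_attained(2)[OF u2(1) \<rho>0 z\<rho>, of K' 1 "\<lambda>_. 0"] u1 u2
    by (simp add: w_def U_def V_def)
  have wle: "w z \<le> - (\<kappa> / 2) * (enorm N z)\<^sup>2" for z
    using UV[of z] by (simp add: w_def R2_def algebra_simps add_divide_distrib)
  have contU: "continuous_on (closed_eball N 1) U"
    unfolding U_def by (rule continuous_on_enorm_lipschitz[where N = N], rule supconv_lipschitz[OF u1(1) \<rho>0 u1(2) up1 K'(2,1) c])
      (auto simp: closed_eball_iff)
  have contV: "continuous_on (closed_eball N 1) V"
    unfolding V_def by (rule continuous_on_enorm_lipschitz[where N = N], rule supconv_lipschitz[OF u2(1) \<rho>0 u2(2) up2 K'(3,1) one0])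
      (auto simp: closed_eball_iff)
  have "\<exists>z\<in>closed_eball N 1. \<forall>y\<in>closed_eball N 1. w y - ip N \<pi> y \<le> w z - ip N \<pi> z" for \<pi>
    using zero_in_closed_eball[of 1 N] by (intro continuous_attains_sup compact_closed_eball) (auto simp: w_def intro!: continuous_intros contU contV)
  then obtain zc where zc: "\<And>\<pi>. zc \<pi> \<in> closed_eball N 1"
    and zm0: "\<And>\<pi> y. y \<in> closed_eball N 1 \<Longrightarrow> w y - ip N \<pi> y \<le> w (zc \<pi>) - ip N \<pi> (zc \<pi>)" by metis
  \<comment> \<open>The pinching hypothesis of \<open>quadratic_approx_at_contact\<close> ranges
    over vectors with arbitrary entries from N on; truncation changes neither side.\<close>
  have zm: "w y \<le> w (zc \<pi>) + ip N \<pi> (\<lambda>k. y k - zc \<pi> k)" if "enorm N y \<le> 1" for \<pi> y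
  proof -
    define y' where "y' = (\<lambda>k. if k < N then y k else 0)"
    have eq: "\<And>k. k < N \<Longrightarrow> y' k = y k" by (simp add: y'_def)
    have "y' \<in> closed_eball N 1" using that enorm_cong[of N y' y] eq by (simp add: closed_eball_iff y'_def)
    from zm0[OF this, of \<pi>] have "w y' - ip N \<pi> y' \<le> w (zc \<pi>) - ip N \<pi> (zc \<pi>)" .
    moreover have "w y' = w y" unfolding w_def U_def V_def
      using supconv_cong[of N y' y \<rho> K' c u1, OF eq] supconv_cong[of N y' y \<rho> K' 1 u2, OF eq] enorm_cong[of N y' y, OF eq] by simp
    moreover have "ip N \<pi> y' = ip N \<pi> y" by (simp add: ip_def eq)
    ultimately show ?thesis by (simp add: ip_diff_right)
  qed
  have zc0: "\<forall>k\<ge>N. zc \<pi> k = 0" for \<pi> using zc by (simp add: closed_eball_iff)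
  have znear: "enorm N (zc \<pi>) \<le> 2 * enorm N \<pi> / \<kappa>" for \<pi>
  proof -
    have "0 \<le> w (zc \<pi>) - ip N \<pi> (zc \<pi>)" using zm[of "\<lambda>_. 0" \<pi>] w0 by (simp add: ip_minus_right)
    also have "\<dots> \<le> - (\<kappa> / 2) * (enorm N (zc \<pi>))\<^sup>2 + enorm N \<pi> * enorm N (zc \<pi>)"
      using wle[of "zc \<pi>"] ip_le[of N \<pi> "zc \<pi>"] by linarith
    finally have "enorm N (zc \<pi>) * (\<kappa> / 2 * enorm N (zc \<pi>)) \<le> enorm N (zc \<pi>) * enorm N \<pi>" by (simp add: power2_eq_square mult_ac)
    then have "enorm N (zc \<pi>) = 0 \<or> \<kappa> / 2 * enorm N (zc \<pi>) \<le> enorm N \<pi>"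
      using enorm_nonneg[of N "zc \<pi>"] by (metis mult_le_cancel_left_pos order_le_less)
    then show ?thesis using \<kappa> by (auto simp: field_simps)
  qed
  define M where "M = K' * c\<^sup>2 + K' + R2 / 2"
  have M0: "0 < M" using K' R \<kappa> by (simp add: M_def R2_def add_nonneg_pos add_pos_nonneg)
  \<comment> \<open>The maximizers and slopes at the touching points are bounded by constants times
    \<delta>2, and this choice brings them below \<rho>. The bound 1 / 4 leaves room for
    displacements of length 1 / 2 inside the unit ball.\<close>
  define \<delta>2 where "\<delta>2 = min (1 / 4) (\<rho> / (16 * (c + 1) * (K' + 1)))"
  have "\<delta>2 \<le> 1 / 4" unfolding \<delta>2_def by (rule min.cobounded1)
  moreover have "0 < \<delta>2" using \<rho> c K'(1) by (simp add: \<delta>2_def)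
  ultimately have \<delta>2: "0 < \<delta>2" "\<delta>2 \<le> 1 / 4" by auto
  have \<delta>2\<rho>: "16 * (c + 1) * (K' + 1) * \<delta>2 \<le> \<rho>"
  proof -
    have "16 * (c + 1) * (K' + 1) * \<delta>2 \<le> 16 * (c + 1) * (K' + 1) * (\<rho> / (16 * (c + 1) * (K' + 1)))"
      using c K' by (intro mult_left_mono) (auto simp: \<delta>2_def)
    then show ?thesis using c K' by simp
  qed
  have big: "16 * (c + 1) * (K' + 1) = 16 * (c * K') + 16 * c + 16 * K' + 16" by (simp add: algebra_simps)
  define good where "good \<pi> \<longleftrightarrow> enorm N (zc \<pi>) \<le> \<delta>2" for \<pi>
  define g where "g \<pi> = (\<lambda>k. 2 * c * K' * (hs (zc \<pi>) k - c * zc \<pi> k))" for \<pi>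
  define G where "G \<pi> = (\<lambda>k. - (2 * K' * (ls (zc \<pi>) k - zc \<pi> k)) + R2 * zc \<pi> k + \<pi> k)" for \<pi>
  have Ulow: "U z + ip N (\<lambda>k. 2 * c * K' * (hs z k - c * z k)) (\<lambda>k. y k - z k) - K' * c\<^sup>2 * (enorm N (\<lambda>k. y k - z k))\<^sup>2 \<le> U y" for y z
    using supconv_lower[OF u1(1) \<rho>0 hs, of z y] unfolding U_def ip_scale_left .
  have Vlow: "V z + ip N (\<lambda>k. 2 * K' * (ls z k - z k)) (\<lambda>k. y k - z k) - K' * (enorm N (\<lambda>k. y k - z k))\<^sup>2 \<le> V y" for y z
    using supconv_lower[OF u2(1) \<rho>0 ls, of z y] unfolding V_def ip_scale_left by simp
  \<comment> \<open>Semiconvexity bounds U only from below. At a contact point \<open>w\<close> lies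
    below an affine function and V above a paraboloid, which supplies the missing upper bound on
    U.\<close>
  have Uup: "U y \<le> U (zc \<pi>) + ip N (G \<pi>) (\<lambda>k. y k - zc \<pi> k) + (K' + R2 / 2) * (enorm N (\<lambda>k. y k - zc \<pi> k))\<^sup>2"
    if y: "enorm N y \<le> 1" for y \<pi>
  proof -
    have "U y + V y - R2 / 2 * (enorm N y)\<^sup>2 \<le> U (zc \<pi>) + V (zc \<pi>) - R2 / 2 * (enorm N (zc \<pi>))\<^sup>2 + ip N \<pi> (\<lambda>k. y k - zc \<pi> k)"
      using zm[OF y, of \<pi>] by (simp add: w_def)
    moreover have "R2 / 2 * (enorm N y)\<^sup>2 = R2 / 2 * (enorm N (zc \<pi>))\<^sup>2 + R2 * ip N (zc \<pi>) (\<lambda>k. y k - zc \<pi> k) + R2 / 2 * (enorm N (\<lambda>k. y k - zc \<pi> k))\<^sup>2"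
      unfolding enorm_recenter[of N y "zc \<pi>"] by (simp add: algebra_simps)
    moreover have "ip N (G \<pi>) (\<lambda>k. y k - zc \<pi> k) = - ip N (\<lambda>k. 2 * K' * (ls (zc \<pi>) k - zc \<pi> k)) (\<lambda>k. y k - zc \<pi> k)
        + R2 * ip N (zc \<pi>) (\<lambda>k. y k - zc \<pi> k) + ip N \<pi> (\<lambda>k. y k - zc \<pi> k)"
      by (simp only: G_def ip_add_left ip_minus_left ip_scale_left)
    moreover have "(K' + R2 / 2) * (enorm N (\<lambda>k. y k - zc \<pi> k))\<^sup>2 = K' * (enorm N (\<lambda>k. y k - zc \<pi> k))\<^sup>2 + R2 / 2 * (enorm N (\<lambda>k. y k - zc \<pi> k))\<^sup>2"
      by (rule distrib_right)
    ultimately show ?thesis using Vlow[of "zc \<pi>" y] by linarith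
  qed
  \<comment> \<open>U is caught between two paraboloids meeting at the contact point, so their
    slopes agree.\<close>
  have gG: "g \<pi> k = G \<pi> k" if gd: "good \<pi>" and k: "k < N" for \<pi> k
  proof (rule gradient_unique[where d = "1 / 2" and M = M, OF _ _ _ k])
    fix v assume v: "\<And>k. N \<le> k \<Longrightarrow> v k = 0" "enorm N v < 1 / 2"
    define y where "y = (\<lambda>k. zc \<pi> k + v k)"
    have e: "(\<lambda>k. y k - zc \<pi> k) = v" by (auto simp: y_def)
    have "enorm N y \<le> 1" using enorm_triangle[of N "zc \<pi>" v] v gd \<delta>2 unfolding y_def good_def by linarith
    from Uup[OF this, of \<pi>] Ulow[of "zc \<pi>" y]
    have "ip N (g \<pi>) v - K' * c\<^sup>2 * (enorm N v)\<^sup>2 \<le> ip N (G \<pi>) v + (K' + R2 / 2) * (enorm N v)\<^sup>2"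
      unfolding e g_def by linarith
    then show "ip N (g \<pi>) v \<le> ip N (G \<pi>) v + M * (enorm N v)\<^sup>2" by (simp add: M_def algebra_simps)
  qed (use M0 in auto)
  have gGip: "ip N (g \<pi>) v = ip N (G \<pi>) v" if "good \<pi>" for \<pi> v
    unfolding ip_def using gG[OF that] by (intro sum.cong) auto
  define Uc where "Uc y = U y + K' * c\<^sup>2 * (enorm N y)\<^sup>2" for y
  have Uclow: "Uc y \<ge> Uc z + ip N (\<lambda>k. 2 * c * K' * hs z k) (\<lambda>k. y k - z k)" for y z
  proof -
    have "K' * c\<^sup>2 * (enorm N y)\<^sup>2 = K' * c\<^sup>2 * (enorm N z)\<^sup>2 + 2 * (K' * c\<^sup>2) * ip N z (\<lambda>k. y k - z k) + K' * c\<^sup>2 * (enorm N (\<lambda>k. y k - z k))\<^sup>2"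
      unfolding enorm_recenter[of N y z] by (simp add: algebra_simps)
    moreover have "ip N (\<lambda>k. 2 * c * K' * (hs z k - c * z k)) (\<lambda>k. y k - z k)
       = ip N (\<lambda>k. 2 * c * K' * hs z k) (\<lambda>k. y k - z k) - 2 * (K' * c\<^sup>2) * ip N z (\<lambda>k. y k - z k)"
      unfolding ip_scale_left ip_diff_left by (simp add: algebra_simps power2_eq_square)
    ultimately show ?thesis using Ulow[of z y] unfolding Uc_def by linarith
  qed
  have pinch: "0 \<le> Uc y - Uc (zc \<pi>) - ip N (\<lambda>k. 2 * c * K' * hs (zc \<pi>) k) (\<lambda>k. y k - zc \<pi> k) \<and>
      Uc y - Uc (zc \<pi>) - ip N (\<lambda>k. 2 * c * K' * hs (zc \<pi>) k) (\<lambda>k. y k - zc \<pi> k) \<le> M * (enorm N (\<lambda>k. y k - zc \<pi> k))\<^sup>2"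
    if gd: "good \<pi>" and y: "enorm N (\<lambda>k. y k - zc \<pi> k) \<le> \<delta>2" for \<pi> y
  proof -
    have "enorm N y \<le> 1" using enorm_le_add_diff[of N y "zc \<pi>"] y gd \<delta>2 unfolding good_def by linarith
    note Uup[OF this, of \<pi>]
    moreover have "K' * c\<^sup>2 * (enorm N y)\<^sup>2 = K' * c\<^sup>2 * (enorm N (zc \<pi>))\<^sup>2 + 2 * (K' * c\<^sup>2) * ip N (zc \<pi>) (\<lambda>k. y k - zc \<pi> k) + K' * c\<^sup>2 * (enorm N (\<lambda>k. y k - zc \<pi> k))\<^sup>2"
      unfolding enorm_recenter[of N y "zc \<pi>"] by (simp add: algebra_simps)
    moreover have "ip N (G \<pi>) (\<lambda>k. y k - zc \<pi> k)
       = ip N (\<lambda>k. 2 * c * K' * hs (zc \<pi>) k) (\<lambda>k. y k - zc \<pi> k) - 2 * (K' * c\<^sup>2) * ip N (zc \<pi>) (\<lambda>k. y k - zc \<pi> k)"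
      unfolding gGip[OF gd, symmetric] g_def ip_scale_left ip_diff_left by (simp add: algebra_simps power2_eq_square)
    moreover have "M * (enorm N (\<lambda>k. y k - zc \<pi> k))\<^sup>2 = K' * c\<^sup>2 * (enorm N (\<lambda>k. y k - zc \<pi> k))\<^sup>2 + (K' + R2 / 2) * (enorm N (\<lambda>k. y k - zc \<pi> k))\<^sup>2"
      by (simp add: M_def algebra_simps)
    ultimately show ?thesis using Uclow[of "zc \<pi>" y] unfolding Uc_def by linarith
  qed
  \<comment> \<open>The tilt is the slope of \<open>w\<close> at the contact point. The affine bound
    for one tilt is compared with the paraboloid below \<open>w\<close> for the other, at a
    displacement along the difference of the tilts whose length t is the distance of the contact
    points; this gives t P \<le> M (2 t)^2.\<close>
  have lip: "enorm N (\<lambda>k. \<pi> k - \<pi>' k) \<le> 4 * M * enorm N (\<lambda>k. zc \<pi> k - zc \<pi>' k)" if gd: "good \<pi>" "good \<pi>'" for \<pi> \<pi>'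
  proof -
    define z where "z = zc \<pi>"
    define z' where "z' = zc \<pi>'"
    have zz: "enorm N z \<le> 1 / 4" "enorm N z' \<le> 1 / 4" using gd \<delta>2 by (auto simp: good_def z_def z'_def)
    have wlow: "w z' + ip N \<pi>' (\<lambda>k. y k - z' k) - M * (enorm N (\<lambda>k. y k - z' k))\<^sup>2 \<le> w y" for y
    proof -
      have "R2 / 2 * (enorm N y)\<^sup>2 = R2 / 2 * (enorm N z')\<^sup>2 + R2 * ip N z' (\<lambda>k. y k - z' k) + R2 / 2 * (enorm N (\<lambda>k. y k - z' k))\<^sup>2"
        unfolding enorm_recenter[of N y z'] by (simp add: algebra_simps)
      moreover have "ip N (\<lambda>k. 2 * c * K' * (hs z' k - c * z' k)) (\<lambda>k. y k - z' k) = - ip N (\<lambda>k. 2 * K' * (ls z' k - z' k)) (\<lambda>k. y k - z' k)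
        + R2 * ip N z' (\<lambda>k. y k - z' k) + ip N \<pi>' (\<lambda>k. y k - z' k)"
        using gGip[OF gd(2), of "\<lambda>k. y k - z' k"] by (simp only: g_def G_def z'_def ip_add_left ip_minus_left ip_scale_left)
      moreover have "M * (enorm N (\<lambda>k. y k - z' k))\<^sup>2 = K' * c\<^sup>2 * (enorm N (\<lambda>k. y k - z' k))\<^sup>2 + K' * (enorm N (\<lambda>k. y k - z' k))\<^sup>2 + R2 / 2 * (enorm N (\<lambda>k. y k - z' k))\<^sup>2"
        by (simp add: M_def algebra_simps)
      ultimately show ?thesis using Ulow[of z' y] Vlow[of z' y] unfolding w_def by linarith
    qed
    have key: "ip N (\<lambda>k. \<pi>' k - \<pi> k) v \<le> M * (enorm N (\<lambda>k. v k + (z k - z' k)))\<^sup>2" if v: "enorm N v \<le> 1 / 2" for v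
    proof -
      define y where "y = (\<lambda>k. z k + v k)"
      have "enorm N y \<le> 1" using enorm_triangle[of N z v] v zz unfolding y_def by linarith
      from zm[OF this, of \<pi>] have "w y \<le> w z + ip N \<pi> v" unfolding z_def[symmetric] by (simp add: y_def)
      moreover have "w z \<le> w z' + ip N \<pi>' (\<lambda>k. z k - z' k)" unfolding z'_def by (rule zm) (use zz in auto)
      moreover have "(\<lambda>k. y k - z' k) = (\<lambda>k. v k + (z k - z' k))" by (auto simp: y_def)
      then have "w z' + (ip N \<pi>' v + ip N \<pi>' (\<lambda>k. z k - z' k)) - M * (enorm N (\<lambda>k. v k + (z k - z' k)))\<^sup>2 \<le> w y"
        using wlow[of y] by (simp add: ip_add_right)
      ultimately show ?thesis unfolding ip_diff_left by linarith
    qed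
    define t where "t = enorm N (\<lambda>k. z k - z' k)"
    define P where "P = enorm N (\<lambda>k. \<pi>' k - \<pi> k)"
    have t: "0 \<le> t" "t \<le> 1 / 2" using enorm_diff_le[of N z z'] zz by (auto simp: t_def)
    have "P \<le> 4 * M * t"
    proof (cases "t = 0")
      case True
      have "\<pi>' k - \<pi> k = 0" if k: "k < N" for k
      proof (rule gradient_unique[where d = "1 / 2" and M = M and b = "\<lambda>_. 0", OF _ _ _ k])
        fix v assume v: "\<And>k. N \<le> k \<Longrightarrow> v k = 0" "enorm N v < 1 / 2"
        have "(enorm N (\<lambda>k. v k + (z k - z' k)))\<^sup>2 \<le> (enorm N v + t)\<^sup>2"
          using enorm_triangle[of N v "\<lambda>k. z k - z' k"] unfolding t_def by (intro power_mono) auto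
        then have "M * (enorm N (\<lambda>k. v k + (z k - z' k)))\<^sup>2 \<le> M * (enorm N v)\<^sup>2" using True M0 by simp
        then show "ip N (\<lambda>k. \<pi>' k - \<pi> k) v \<le> ip N (\<lambda>_. 0) v + M * (enorm N v)\<^sup>2"
          using key[of v] v by (simp add: ip_def)
      qed (use M0 in auto)
      then have "P \<le> real N * 0" unfolding P_def by (intro enorm_le_sum) auto
      then show ?thesis using True by simp
    next
      case False
      then have t0: "0 < t" using t by simp
      show ?thesis
      proof (cases "P = 0")
        case True then show ?thesis using M0 t by simp
      next
        case False
        define v where "v = (\<lambda>k. (t / P) * (\<pi>' k - \<pi> k))"
        have P0: "0 < P" using False by (simp add: P_def order_less_le)
        have vn: "enorm N v = t" unfolding v_def enorm_scale using t0 P0 by (simp add: P_def[symmetric])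
        have "ip N (\<lambda>k. \<pi>' k - \<pi> k) v = t * P"
          unfolding v_def ip_scale_right enorm_sq[symmetric] P_def[symmetric] using P0 by (simp add: power2_eq_square)
        then have "t * P \<le> M * (enorm N (\<lambda>k. v k + (z k - z' k)))\<^sup>2" using key[of v] vn t by simp
        also have "\<dots> \<le> M * (t + t)\<^sup>2"
          using enorm_triangle[of N v "\<lambda>k. z k - z' k"] M0 vn unfolding t_def[symmetric] by (intro mult_left_mono power_mono) auto
        also have "\<dots> = t * (4 * M * t)" by (simp add: power2_eq_square algebra_simps)
        finally show ?thesis using t0 by (simp only: mult_le_cancel_left_pos)
      qed
    qed
    then show ?thesis by (simp add: P_def t_def z_def z'_def enorm_minus_commute[of N \<pi>])
  qed
  \<comment> \<open>Such tilts have norm at most \<kappa> \<delta>2 / 2, so \<open>znear\<close>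
    puts their contact points within \<delta>2 of the origin.\<close>
  define \<pi>0 where "\<pi>0 = \<kappa> * \<delta>2 / (2 * real N)"
  have \<pi>00: "0 < \<pi>0" using \<kappa> \<delta>2 N by (simp add: \<pi>0_def)
  have good: "good \<pi>" if "\<And>k. k < N \<Longrightarrow> 0 \<le> \<pi> k \<and> \<pi> k \<le> \<pi>0" for \<pi>
  proof -
    have "enorm N \<pi> \<le> real N * \<pi>0" by (rule enorm_le_sum) (use that in \<open>auto simp: abs_le_iff intro: order_trans[of _ 0]\<close>)
    then have "2 * enorm N \<pi> / \<kappa> \<le> \<delta>2" using \<kappa> N by (simp add: \<pi>0_def field_simps)
    then show ?thesis using znear[of \<pi>] by (simp add: good_def)
  qed
  have "\<exists>\<pi> r cc c0 gg A. (\<forall>k<N. 0 \<le> \<pi> k \<and> \<pi> k \<le> \<pi>0) \<and> 0 < r \<and> r \<le> \<delta>2 \<and> (\<forall>j k. A j k = A k j) \<and>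
     (\<forall>y. enorm N (\<lambda>k. y k - zc \<pi> k) \<le> r \<longrightarrow>
       \<bar>Uc y - (c0 + ip N gg (\<lambda>k. y k - cc k) + qf N A (\<lambda>k. y k - cc k) / 2)\<bar> \<le> (\<delta> / 4) * r\<^sup>2)"
  proof (rule quadratic_approx_at_contact[where C = "4 * M" and \<rho> = 1 and M = M])
    show "\<bar>zc \<pi> k\<bar> \<le> 1" if "k < N" for \<pi> k using abs_le_enorm[OF that, of "zc \<pi>"] zc[of \<pi>] by (simp add: closed_eball_iff)
    show "\<exists>g. \<forall>y. Uc z + ip N g (\<lambda>k. y k - z k) \<le> Uc y" for z using Uclow by blast
    fix \<pi> assume \<pi>: "\<And>k. k < N \<Longrightarrow> 0 \<le> \<pi> k \<and> \<pi> k \<le> \<pi>0"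
    show "\<exists>g. \<forall>y. enorm N (\<lambda>k. y k - zc \<pi> k) \<le> \<delta>2 \<longrightarrow>
        0 \<le> Uc y - Uc (zc \<pi>) - ip N g (\<lambda>k. y k - zc \<pi> k) \<and>
        Uc y - Uc (zc \<pi>) - ip N g (\<lambda>k. y k - zc \<pi> k) \<le> M * (enorm N (\<lambda>k. y k - zc \<pi> k))\<^sup>2"
    proof -
      have "good \<pi>" by (rule good) (rule \<pi>)
      from pinch[OF this] show ?thesis by blast
    qed
    fix \<pi>' assume \<pi>': "\<And>k. k < N \<Longrightarrow> 0 \<le> \<pi>' k \<and> \<pi>' k \<le> \<pi>0"
    show "enorm N (\<lambda>k. \<pi> k - \<pi>' k) \<le> 4 * M * enorm N (\<lambda>k. zc \<pi> k - zc \<pi>' k)"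
      by (rule lip; rule good) (rule \<pi> \<pi>', assumption)+
  qed (use N M0 \<pi>00 \<delta>2 \<delta> in auto)
  then obtain \<pi> r cc c0 gg A where \<pi>: "\<And>k. k < N \<Longrightarrow> 0 \<le> \<pi> k \<and> \<pi> k \<le> \<pi>0" and r: "0 < r" "r \<le> \<delta>2"
    and A: "\<And>j k. A j k = A k j" and ap: "\<And>y. enorm N (\<lambda>k. y k - zc \<pi> k) \<le> r \<Longrightarrow>
       \<bar>Uc y - (c0 + ip N gg (\<lambda>k. y k - cc k) + qf N A (\<lambda>k. y k - cc k) / 2)\<bar> \<le> (\<delta> / 4) * r\<^sup>2" by blast
  define z0 where "z0 = zc \<pi>"
  have z0s: "\<forall>k\<ge>N. z0 k = 0" using zc0 by (simp add: z0_def)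
  have "good \<pi>" by (rule good) (rule \<pi>)
  then have z0n: "enorm N z0 \<le> \<delta>2" by (simp add: good_def z0_def)
  define Q where "Q y = c0 + ip N gg (\<lambda>k. y k - cc k) + qf N A (\<lambda>k. y k - cc k) / 2" for y
  have ap': "\<bar>Uc y - Q y\<bar> \<le> (\<delta> / 4) * r\<^sup>2" if "enorm N (\<lambda>k. y k - z0 k) \<le> r" for y
    using ap that by (simp add: Q_def z0_def)
  have nb: "enorm N y \<le> 2 * \<delta>2" if "enorm N (\<lambda>k. y k - z0 k) \<le> r" for y
    using enorm_le_add_diff[of N y z0] that z0n r by linarith
  define S where "S = {y. (\<forall>k\<ge>N. y k = 0) \<and> enorm N (\<lambda>k. y k - z0 k) \<le> r}"
  have S1: "S \<subseteq> closed_eball N 1" using nb \<delta>2 by (fastforce simp: S_def closed_eball_iff)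
  have contQ: "continuous_on S Q" unfolding Q_def by (intro continuous_intros) auto
  have z00: "enorm N (\<lambda>k. z0 k - z0 k) \<le> r" and z000: "(enorm N (\<lambda>k. z0 k - z0 k))\<^sup>2 = 0" using r by simp_all
  have ap1: "Uc y - Q y \<le> \<delta> / 4 * r\<^sup>2" "- (\<delta> / 4 * r\<^sup>2) \<le> Uc y - Q y" if "enorm N (\<lambda>k. y k - z0 k) \<le> r" for y
    using ap'[OF that] by linarith+

  \<comment> \<open>Its interior maximum touches U from above with matrix A + (2 \<delta> - 2 K'
    c^2) I.\<close>
  define T1 where "T1 y = U y + K' * c\<^sup>2 * (enorm N y)\<^sup>2 - Q y - \<delta> * (enorm N (\<lambda>k. y k - z0 k))\<^sup>2" for y
  have "\<exists>z1. (\<forall>k\<ge>N. z1 k = 0) \<and> enorm N (\<lambda>k. z1 k - z0 k) < r \<and>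
    (\<forall>y. (\<forall>k\<ge>N. y k = 0) \<longrightarrow> enorm N (\<lambda>k. y k - z0 k) \<le> r \<longrightarrow> T1 y \<le> T1 z1)"
  proof (rule interior_maximum[where \<eta> = "\<delta> / 4" and \<delta> = \<delta> and a = 0])
    show "continuous_on {y. (\<forall>k\<ge>N. y k = 0) \<and> enorm N (\<lambda>k. y k - z0 k) \<le> r} T1" unfolding S_def[symmetric] T1_def
      by (intro continuous_intros contQ continuous_on_subset[OF contU S1])
    show "0 - \<delta> / 4 * r\<^sup>2 \<le> T1 z0" using ap1[OF z00] z000 unfolding T1_def Uc_def by simp
    show "T1 y \<le> 0 + \<delta> / 4 * r\<^sup>2 - \<delta> * r\<^sup>2" if "enorm N (\<lambda>k. y k - z0 k) = r" for y
      using ap1(1)[of y] that unfolding T1_def Uc_def by simp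
  qed (use z0s r \<delta> in auto)
  then obtain z1 where z1: "\<forall>k\<ge>N. z1 k = 0" "enorm N (\<lambda>k. z1 k - z0 k) < r"
    and z1m: "\<And>y. \<forall>k\<ge>N. y k = 0 \<Longrightarrow> enorm N (\<lambda>k. y k - z0 k) \<le> r \<Longrightarrow> T1 y \<le> T1 z1" by blast
  obtain G1 where G1: "\<And>y. c0 + ip N gg (\<lambda>k. y k - cc k) + qf N A (\<lambda>k. y k - cc k) / 2 + \<delta> * (enorm N (\<lambda>k. y k - z0 k))\<^sup>2 + (- (K' * c\<^sup>2)) * (enorm N y)\<^sup>2 + ip N (\<lambda>_. 0) y
    = (c0 + ip N gg (\<lambda>k. z1 k - cc k) + qf N A (\<lambda>k. z1 k - cc k) / 2 + \<delta> * (enorm N (\<lambda>k. z1 k - z0 k))\<^sup>2 + (- (K' * c\<^sup>2)) * (enorm N z1)\<^sup>2 + ip N (\<lambda>_. 0) z1)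
      + ip N G1 (\<lambda>k. y k - z1 k) + qf N (\<lambda>j k. 1 * A j k + (if j = k then 2 * \<delta> + 2 * (- (K' * c\<^sup>2)) else 0)) (\<lambda>k. y k - z1 k) / 2"
    using quadratic_recenter[of A, OF A] by blast
  define B1 where "B1 = (\<lambda>j k. 1 * A j k + (if j = k then 2 * \<delta> + 2 * (- (K' * c\<^sup>2)) else 0))"
  have B1s: "B1 j k = B1 k j" for j k using A by (simp add: B1_def)
  have lB1: "lam B1 = lam A + (2 * \<delta> - 2 * K' * c\<^sup>2)"
    unfolding B1_def by (subst lam[of A 1, OF A]) auto
  have t1: "supconv N \<rho> K' c u1 z \<le> supconv N \<rho> K' c u1 z1 + ip N G1 (\<lambda>k. z k - z1 k) + qf N B1 (\<lambda>k. z k - z1 k) / 2"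
    if "\<forall>k\<ge>N. z k = 0" "enorm N (\<lambda>k. z k - z1 k) < r - enorm N (\<lambda>k. z1 k - z0 k)" for z
  proof -
    have "enorm N (\<lambda>k. z k - z0 k) \<le> r"
      using enorm_triangle[of N "\<lambda>k. z k - z1 k" "\<lambda>k. z1 k - z0 k"] that(2) by simp
    from z1m[OF that(1) this] have "T1 z \<le> T1 z1" .
    then show ?thesis using G1[of z] unfolding T1_def B1_def[symmetric] Q_def[symmetric] U_def[symmetric]
      by (simp add: ip_def)
  qed
  define h1 where "h1 = hs z1"
  have z1n: "enorm N z1 \<le> 2 * \<delta>2" using nb[of z1] z1 by simp
  have r1: "0 < r - enorm N (\<lambda>k. z1 k - z0 k)" using z1 by simp
  note touch1 = supconv_touch[OF u1(1) \<rho>0 hs K'(1) c z1(1) r1 t1, folded h1_def]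
  have h1n: "enorm N h1 < \<rho>"
  proof -
    have "enorm N h1 \<le> 3 * c * enorm N z1" using hn(2) by (simp add: h1_def)
    also have "\<dots> \<le> 3 * c * (2 * \<delta>2)" using z1n c by (intro mult_left_mono) auto
    also have "\<dots> < 16 * (c + 1) * (K' + 1) * \<delta>2"
    proof -
      have "0 < c * K'" using c K' by simp
      then have "6 * c < 16 * (c + 1) * (K' + 1)" unfolding big using c K'(1) by linarith
      then show ?thesis using \<delta>2(1) by (simp add: mult.assoc[symmetric])
    qed
    finally show ?thesis using \<delta>2\<rho> by simp
  qed
  have g1n: "enorm N (\<lambda>k. G1 k / c) < \<rho>"
  proof -
    have "enorm N (\<lambda>k. G1 k / c) = enorm N (\<lambda>k. 2 * K' * (h1 k - c * z1 k))"
      by (rule enorm_cong) (use touch1(1) c in \<open>simp add: field_simps\<close>)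
    also have "\<dots> = 2 * K' * enorm N (\<lambda>k. h1 k - c * z1 k)" using K' by (simp add: enorm_scale)
    also have "\<dots> \<le> 2 * K' * (2 * c * enorm N z1)" using hn(1)[of z1] K' by (intro mult_left_mono) (auto simp: h1_def)
    also have "\<dots> \<le> 2 * K' * (2 * c * (2 * \<delta>2))" using z1n c K' by (intro mult_left_mono) auto
    also have "\<dots> < 16 * (c + 1) * (K' + 1) * \<delta>2"
    proof -
      have "0 < c * K'" using c K' by simp
      then have "8 * (c * K') < 16 * (c + 1) * (K' + 1)" unfolding big using c K'(1) by linarith
      then have "8 * (c * K') * \<delta>2 < 16 * (c + 1) * (K' + 1) * \<delta>2" using \<delta>2(1) by (rule mult_strict_right_mono)
      then show ?thesis by (simp add: mult_ac)
    qed
    finally show ?thesis using \<delta>2\<rho> by simp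
  qed
  have h1s: "\<forall>k\<ge>N. h1 k = 0" using hs[of z1] by (simp add: sc_at_def closed_eball_iff h1_def)
  have "\<sigma>1 \<le> lam (\<lambda>j k. B1 j k / c\<^sup>2)"
    by (rule sub[OF _ h1s h1n g1n touch1(2)]) (use B1s in auto)
  moreover have "lam (\<lambda>j k. B1 j k / c\<^sup>2) = lam B1 / c\<^sup>2"
    using lam[of B1 "1 / c\<^sup>2" 0, OF B1s] c by simp
  ultimately have "c\<^sup>2 * \<sigma>1 \<le> c\<^sup>2 * (lam B1 / c\<^sup>2)" using c by (intro mult_left_mono) auto
  then have S1': "c\<^sup>2 * \<sigma>1 \<le> lam A + 2 * \<delta> - 2 * K' * c\<^sup>2" using c lB1 by simp

  \<comment> \<open>Up to the approximation error this is the tilted \<open>w\<close> minus the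
    \<delta> paraboloid, so its interior maximum touches V from above with matrix -A + (2 \<delta> +
    2 E) I.\<close>
  define T2 where "T2 y = V y + Q y - (K' * c\<^sup>2 + R2 / 2) * (enorm N y)\<^sup>2 - ip N \<pi> y - \<delta> * (enorm N (\<lambda>k. y k - z0 k))\<^sup>2" for y
  define a2 where "a2 = w z0 - ip N \<pi> z0"
  have "\<exists>z2. (\<forall>k\<ge>N. z2 k = 0) \<and> enorm N (\<lambda>k. z2 k - z0 k) < r \<and>
    (\<forall>y. (\<forall>k\<ge>N. y k = 0) \<longrightarrow> enorm N (\<lambda>k. y k - z0 k) \<le> r \<longrightarrow> T2 y \<le> T2 z2)"
  proof (rule interior_maximum[where \<eta> = "\<delta> / 4" and \<delta> = \<delta> and a = a2])
    show "continuous_on {y. (\<forall>k\<ge>N. y k = 0) \<and> enorm N (\<lambda>k. y k - z0 k) \<le> r} T2" unfolding S_def[symmetric] T2_def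
      by (intro continuous_intros contQ continuous_on_subset[OF contV S1])
    have id: "T2 y = (w y - ip N \<pi> y) + (Q y - Uc y) - \<delta> * (enorm N (\<lambda>k. y k - z0 k))\<^sup>2" for y
      by (simp add: T2_def w_def Uc_def algebra_simps)
    show "a2 - \<delta> / 4 * r\<^sup>2 \<le> T2 z0" using ap1[OF z00] z000 unfolding id a2_def by simp
    show "T2 y \<le> a2 + \<delta> / 4 * r\<^sup>2 - \<delta> * r\<^sup>2" if y: "enorm N (\<lambda>k. y k - z0 k) = r" for y
    proof -
      have "enorm N y \<le> 1" using nb[of y] y \<delta>2 by simp
      from zm[OF this, of \<pi>] have "w y - ip N \<pi> y \<le> a2" unfolding a2_def z0_def ip_diff_right by linarith
      then show ?thesis using ap1(2)[of y] y unfolding id by simp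
    qed
  qed (use z0s r \<delta> in auto)
  then obtain z2 where z2: "\<forall>k\<ge>N. z2 k = 0" "enorm N (\<lambda>k. z2 k - z0 k) < r"
    and z2m: "\<And>y. \<forall>k\<ge>N. y k = 0 \<Longrightarrow> enorm N (\<lambda>k. y k - z0 k) \<le> r \<Longrightarrow> T2 y \<le> T2 z2" by blast
  define E where "E = K' * c\<^sup>2 + R2 / 2"
  have mA: "- A j k = - A k j" for j k using A by simp
  obtain G2 where G2: "\<And>y. - c0 + ip N (\<lambda>k. - gg k) (\<lambda>k. y k - cc k) + qf N (\<lambda>j k. - A j k) (\<lambda>k. y k - cc k) / 2 + \<delta> * (enorm N (\<lambda>k. y k - z0 k))\<^sup>2 + E * (enorm N y)\<^sup>2 + ip N \<pi> y
    = (- c0 + ip N (\<lambda>k. - gg k) (\<lambda>k. z2 k - cc k) + qf N (\<lambda>j k. - A j k) (\<lambda>k. z2 k - cc k) / 2 + \<delta> * (enorm N (\<lambda>k. z2 k - z0 k))\<^sup>2 + E * (enorm N z2)\<^sup>2 + ip N \<pi> z2)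
      + ip N G2 (\<lambda>k. y k - z2 k) + qf N (\<lambda>j k. 1 * - A j k + (if j = k then 2 * \<delta> + 2 * E else 0)) (\<lambda>k. y k - z2 k) / 2"
    using quadratic_recenter[of "\<lambda>j k. - A j k", OF mA] by blast
  define B2 where "B2 = (\<lambda>j k. 1 * - A j k + (if j = k then 2 * \<delta> + 2 * E else 0))"
  have B2s: "B2 j k = B2 k j" for j k using A by (simp add: B2_def)
  have nQ: "- c0 + ip N (\<lambda>k. - gg k) (\<lambda>k. y k - cc k) + qf N (\<lambda>j k. - A j k) (\<lambda>k. y k - cc k) / 2 = - Q y" for y
    unfolding Q_def qf_uminus by (simp add: ip_def sum_negf)
  have t2: "supconv N \<rho> K' 1 u2 z \<le> supconv N \<rho> K' 1 u2 z2 + ip N G2 (\<lambda>k. z k - z2 k) + qf N B2 (\<lambda>k. z k - z2 k) / 2"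
    if "\<forall>k\<ge>N. z k = 0" "enorm N (\<lambda>k. z k - z2 k) < r - enorm N (\<lambda>k. z2 k - z0 k)" for z
  proof -
    have "enorm N (\<lambda>k. z k - z0 k) \<le> r"
      using enorm_triangle[of N "\<lambda>k. z k - z2 k" "\<lambda>k. z2 k - z0 k"] that(2) by simp
    from z2m[OF that(1) this] have "T2 z \<le> T2 z2" .
    then show ?thesis using G2[of z] unfolding T2_def B2_def[symmetric] nQ V_def[symmetric] E_def[symmetric] by linarith
  qed
  define l2 where "l2 = ls z2"
  have z2n: "enorm N z2 \<le> 2 * \<delta>2" using nb[of z2] z2 by simp
  have r2: "0 < r - enorm N (\<lambda>k. z2 k - z0 k)" using z2 by simp
  note touch2 = supconv_touch[OF u2(1) \<rho>0 ls K'(1) one0 z2(1) r2 t2, folded l2_def]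
  have l2n: "enorm N l2 < \<rho>"
  proof -
    have "enorm N l2 \<le> 3 * 1 * enorm N z2" using ln(2) by (simp add: l2_def)
    also have "\<dots> \<le> 6 * \<delta>2" using z2n by simp
    also have "\<dots> < 16 * (c + 1) * (K' + 1) * \<delta>2"
    proof -
      have "0 < c * K'" using c K' by simp
      then have "6 < 16 * (c + 1) * (K' + 1)" unfolding big using c K'(1) by linarith
      then show ?thesis using \<delta>2(1) by (rule mult_strict_right_mono)
    qed
    finally show ?thesis using \<delta>2\<rho> by simp
  qed
  have g2n: "enorm N (\<lambda>k. G2 k / 1) < \<rho>"
  proof -
    have "enorm N (\<lambda>k. G2 k / 1) = enorm N (\<lambda>k. 2 * K' * (l2 k - 1 * z2 k))"
      by (rule enorm_cong) (use touch2(1) in simp)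
    also have "\<dots> = 2 * K' * enorm N (\<lambda>k. l2 k - 1 * z2 k)" using K' by (simp add: enorm_scale)
    also have "\<dots> \<le> 2 * K' * (2 * 1 * enorm N z2)" using ln(1)[of z2] K' by (intro mult_left_mono) (auto simp: l2_def)
    also have "\<dots> \<le> 2 * K' * (2 * 1 * (2 * \<delta>2))" using z2n K' by (intro mult_left_mono) auto
    also have "\<dots> < 16 * (c + 1) * (K' + 1) * \<delta>2"
    proof -
      have "0 < c * K'" using c K' by simp
      then have "8 * K' < 16 * (c + 1) * (K' + 1)" unfolding big using c K'(1) by linarith
      then have "8 * K' * \<delta>2 < 16 * (c + 1) * (K' + 1) * \<delta>2" using \<delta>2(1) by (rule mult_strict_right_mono)
      then show ?thesis by (simp add: mult_ac)
    qed
    finally show ?thesis using \<delta>2\<rho> by simp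
  qed
  have l2s: "\<forall>k\<ge>N. l2 k = 0" using ls[of z2] by (simp add: sc_at_def closed_eball_iff l2_def)
  have "lam (\<lambda>j k. - (B2 j k / 1\<^sup>2)) \<le> \<sigma>2"
    by (rule super[OF _ l2s l2n g2n touch2(2)]) (use B2s in auto)
  moreover have "(\<lambda>j k. - (B2 j k / 1\<^sup>2)) = (\<lambda>j k. 1 * A j k + (if j = k then - (2 * \<delta> + 2 * E) else 0))"
    by (auto simp: B2_def fun_eq_iff)
  ultimately have "lam A - (2 * \<delta> + 2 * E) \<le> \<sigma>2" using lam[of A 1 "- (2 * \<delta> + 2 * E)", OF A] by simp
  moreover have "2 * E = 2 * K' * c\<^sup>2 + R + 2 * \<kappa>" by (simp add: E_def R2_def add_divide_distrib)
  ultimately show ?thesis using S1' by linarith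
qed

text \<open>A substitute for the theorem on sums: \<open>\<sigma>1\<close> and \<open>\<sigma>2\<close> bound \<open>\<lambda>\<^sub>i\<close> on the second-order superjets of \<open>u1\<close> and on
  the negatives of those of \<open>u2\<close>.\<close>

lemma touching_inequality:
  fixes lam :: "(nat \<Rightarrow> nat \<Rightarrow> real) \<Rightarrow> real"
  assumes N: "0 < N" and c: "0 < c" and R: "0 \<le> R" and K: "0 \<le> K" and \<rho>: "0 < \<rho>"
    and u1: "continuous_on (closed_eball N \<rho>) u1" "u1 (\<lambda>_. 0) = 0"
    and u2: "continuous_on (closed_eball N \<rho>) u2" "u2 (\<lambda>_. 0) = 0"
    and ineq: "\<And>h l. h \<in> closed_eball N \<rho> \<Longrightarrow> l \<in> closed_eball N \<rho> \<Longrightarrow>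
       u1 h + u2 l \<le> R / 2 * (enorm N l)\<^sup>2 + K * (enorm N (\<lambda>k. h k - c * l k))\<^sup>2"
    and lam: "\<And>A t d. (\<And>j k. A j k = A k j) \<Longrightarrow> 0 < t \<Longrightarrow> lam (\<lambda>j k. t * A j k + (if j = k then d else 0)) = t * lam A + d"
    and sub: "\<And>A g h0. (\<And>j k. A j k = A k j) \<Longrightarrow> \<forall>k\<ge>N. h0 k = 0 \<Longrightarrow> enorm N h0 < \<rho> \<Longrightarrow> enorm N g < \<rho> \<Longrightarrow>
       (\<exists>d>0. \<forall>h\<in>closed_eball N \<rho>. enorm N (\<lambda>k. h k - h0 k) < d \<longrightarrow>
          u1 h \<le> u1 h0 + ip N g (\<lambda>k. h k - h0 k) + qf N A (\<lambda>k. h k - h0 k) / 2) \<Longrightarrow> \<sigma>1 \<le> lam A"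
    and super: "\<And>A g h0. (\<And>j k. A j k = A k j) \<Longrightarrow> \<forall>k\<ge>N. h0 k = 0 \<Longrightarrow> enorm N h0 < \<rho> \<Longrightarrow> enorm N g < \<rho> \<Longrightarrow>
       (\<exists>d>0. \<forall>h\<in>closed_eball N \<rho>. enorm N (\<lambda>k. h k - h0 k) < d \<longrightarrow>
          u2 h \<le> u2 h0 + ip N g (\<lambda>k. h k - h0 k) + qf N A (\<lambda>k. h k - h0 k) / 2) \<Longrightarrow> lam (\<lambda>j k. - A j k) \<le> \<sigma>2"
  shows "c\<^sup>2 * \<sigma>1 \<le> \<sigma>2 + R"
proof (rule field_le_epsilon)
  fix e :: real assume e: "0 < e"
  have "c\<^sup>2 * \<sigma>1 \<le> \<sigma>2 + R + 2 * (e / 4) + 4 * (e / 8)"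
    by (rule touching_inequality_aux[OF N c R K \<rho> _ _ u1 u2 ineq lam sub super]) (use e in auto)
  then show "c\<^sup>2 * \<sigma>1 \<le> \<sigma>2 + R + e" by simp
qed

subsection \<open>Eigenvalues and quadratic test functions\<close>

text \<open>A complex root exists, is real by assumption and is split off. Applied to a
  characteristic polynomial, this shows that the sorted list of eigenvalues has as many entries as
  the degree.\<close>

lemma size_proots_real:
  fixes p :: "real poly"
  assumes "\<And>z :: complex. poly (map_poly complex_of_real p) z = 0 \<Longrightarrow> Im z = 0" "p \<noteq> 0"
  shows "size (proots p) = degree p"
  using assms
proof (induction "degree p" arbitrary: p)
  case 0
  then show ?case using size_proots_le[of p] by simp
next
  case (Suc n)
  interpret of_real_hom: inj_comm_ring_hom complex_of_real by standard auto
  interpret of_real_poly: map_poly_comm_ring_hom complex_of_real ..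
  let ?q = "map_poly complex_of_real p"
  have "degree ?q = Suc n" using Suc(2) by simp
  then have "\<not> constant (poly ?q)" by (simp add: constant_degree)
  then obtain z where z: "poly ?q z = 0" using fundamental_theorem_of_algebra by blast
  then have "z = complex_of_real (Re z)" using Suc(3) by (simp add: complex_eq_iff)
  then have "poly ?q (complex_of_real (Re z)) = 0" using z by simp
  then have "poly p (Re z) = 0" by simp
  then obtain r where r: "p = [:- Re z, 1:] * r" by (auto simp: poly_eq_0_iff_dvd elim: dvdE)
  have r0: "r \<noteq> 0" using Suc.prems r by auto
  have "degree p = Suc (degree r)" using r0 unfolding r by (subst degree_mult_eq) auto
  then have "size (proots r) = degree r"
  proof (intro Suc(1))
    fix w assume "poly (map_poly complex_of_real r) w = 0"
    then have "poly ?q w = 0" unfolding r of_real_poly.hom_mult by simp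
    then show "Im w = 0" by (rule Suc.prems(1))
  qed (use Suc(2) r0 in auto)
  moreover have "proots p = {#Re z#} + proots r" unfolding r using r0 by (subst proots_mult) auto
  ultimately show ?case using \<open>degree p = Suc (degree r)\<close> by simp
qed

text \<open>For an eigenvector v the number v* A v is real by symmetry and equals z times the
  positive number v* v.\<close>

lemma symmetric_char_poly_real_roots:
  fixes A :: "real mat"
  assumes A: "A \<in> carrier_mat n n" and sym: "\<And>i j. i < n \<Longrightarrow> j < n \<Longrightarrow> A $$ (i, j) = A $$ (j, i)"
    and z: "poly (map_poly complex_of_real (char_poly A)) z = 0"
  shows "Im z = 0"
proof -
  interpret of_real_hom: inj_comm_ring_hom complex_of_real by standard auto
  let ?B = "map_mat complex_of_real A"
  have B: "?B \<in> carrier_mat n n" using A by simp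
  have "poly (char_poly ?B) z = 0" using z by (simp add: of_real_hom.char_poly_hom[OF A])
  then have "eigenvalue ?B z" by (simp add: eigenvalue_root_char_poly[OF B])
  then obtain v where v: "v \<in> carrier_vec n" "v \<noteq> 0\<^sub>v n" "?B *\<^sub>v v = z \<cdot>\<^sub>v v"
    using A by (auto simp: eigenvalue_def eigenvector_def)
  have row: "(\<Sum>j<n. complex_of_real (A $$ (i, j)) * v $ j) = z * v $ i" if i: "i < n" for i
  proof -
    have "(?B *\<^sub>v v) $ i = z * v $ i" using v i by simp
    moreover have "(?B *\<^sub>v v) $ i = (\<Sum>j<n. complex_of_real (A $$ (i, j)) * v $ j)"
      using A v(1) i by (simp add: scalar_prod_def lessThan_atLeast0)
    ultimately show ?thesis by simp
  qed
  define S where "S = (\<Sum>i<n. cnj (v $ i) * (\<Sum>j<n. complex_of_real (A $$ (i, j)) * v $ j))"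
  define s where "s = (\<Sum>i<n. cnj (v $ i) * v $ i)"
  have "S = (\<Sum>i<n. cnj (v $ i) * (z * v $ i))" unfolding S_def
    by (intro sum.cong refl) (simp only: row lessThan_iff)
  then have S1: "S = z * s" by (simp add: s_def sum_distrib_left mult_ac)
  have "cnj S = (\<Sum>i<n. \<Sum>j<n. v $ i * (complex_of_real (A $$ (i, j)) * cnj (v $ j)))"
    unfolding S_def by (simp add: sum_distrib_left)
  also have "\<dots> = (\<Sum>j<n. \<Sum>i<n. v $ i * (complex_of_real (A $$ (i, j)) * cnj (v $ j)))" by (rule sum.swap)
  also have "\<dots> = S" unfolding S_def sum_distrib_left
    by (intro sum.cong refl) (simp add: sym)
  finally have cS: "cnj S = S" .
  have s: "s = complex_of_real (\<Sum>i<n. (cmod (v $ i))\<^sup>2)"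
    unfolding s_def of_real_sum by (intro sum.cong refl) (subst complex_norm_square, rule mult.commute)
  obtain i where i: "i < n" "v $ i \<noteq> 0" using v(1,2) by (metis carrier_vecD eq_vecI index_zero_vec(1) index_zero_vec(2))
  have "0 < (\<Sum>i<n. (cmod (v $ i))\<^sup>2)" by (rule sum_pos2[of _ i]) (use i in auto)
  then have "s \<noteq> 0" unfolding s by (metis less_irrefl of_real_eq_0_iff)
  moreover have "cnj z * s = z * s" using cS unfolding S1 s by simp
  ultimately have "cnj z = z" by simp
  then show ?thesis by (simp add: complex_eq_iff)
qed

lemma char_poly_affine:
  fixes A :: "real mat"
  assumes A: "A \<in> carrier_mat n n" and B: "B \<in> carrier_mat n n" and t: "t \<noteq> 0"
    and AB: "\<And>i j. i < n \<Longrightarrow> j < n \<Longrightarrow> B $$ (i, j) = t * A $$ (i, j) + (if i = j then d else 0)"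
  shows "poly (char_poly B) (t * x + d) = t ^ n * poly (char_poly A) x"
proof -
  have "- char_matrix B (t * x + d) = t \<cdot>\<^sub>m (- char_matrix A x)"
    using A B AB by (intro eq_matI) (auto simp: char_matrix_def algebra_simps)
  then show ?thesis
    unfolding char_poly_matrix[OF A] char_poly_matrix[OF B]
    using carrier_matD[OF char_matrix_closed[OF A, of x]] by simp
qed

text \<open>The size condition says that p splits, so a root r can be removed at each step.
  Cancelling x - r yields the reduced identity only for x different from r; as an identity of
  polynomials it then holds everywhere.\<close>

lemma proots_affine:
  fixes p q :: "real poly"
  assumes t: "t \<noteq> 0" and c: "c \<noteq> 0" and pq: "\<And>x. poly q (t * x + d) = c * poly p x" and p: "p \<noteq> 0"
    and sp: "size (proots p) = degree p"
  shows "proots q = image_mset (\<lambda>x. t * x + d) (proots p)"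
  using assms
proof (induction "degree p" arbitrary: p q c)
  case 0
  then obtain a where a: "p = [:a:]" by (metis degree_eq_zeroE)
  have "poly q y = poly [:c * a:] y" for y
    using 0(4)[of "(y - d) / t"] t by (simp add: a)
  then have "q = [:c * a:]" by (metis poly_eq_poly_eq_iff ext)
  then show ?case by (simp add: a)
next
  case (Suc n)
  then obtain r where r: "r \<in># proots p" by (metis Suc.hyps(2) nat.distinct(1) multiset_nonemptyE size_empty)
  then have pr: "poly p r = 0" using Suc by simp
  then obtain p' where p': "p = [:- r, 1:] * p'" by (auto simp: poly_eq_0_iff_dvd elim: dvdE)
  have p'0: "p' \<noteq> 0" using Suc.prems p' by auto
  have dp: "degree p = Suc (degree p')" using p'0 unfolding p' by (subst degree_mult_eq) auto
  have pp: "proots p = {#r#} + proots p'" unfolding p' using p'0 by (subst proots_mult) auto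
  have "poly q (t * r + d) = 0" using Suc(5)[of r] pr by simp
  then obtain q' where q': "q = [:- (t * r + d), 1:] * q'" by (auto simp: poly_eq_0_iff_dvd elim: dvdE)
  have q0: "q \<noteq> 0"
  proof
    assume "q = 0"
    then have "poly p x = 0" for x using Suc(4) Suc(5)[of x] by simp
    then show False using Suc.prems by (metis poly_all_0_iff_0)
  qed
  then have q'0: "q' \<noteq> 0" using q' by auto
  have pq': "t * (x - r) * poly q' (t * x + d) = c * (x - r) * poly p' x" for x
    using Suc(5)[of x] unfolding p' q' by (simp add: algebra_simps)
  have "poly (pcompose q' [:d, t:] - Polynomial.smult (c / t) p') x = 0" if "x \<noteq> r" for x
  proof -
    have "(x - r) * (t * poly q' (t * x + d)) = (x - r) * (c * poly p' x)" using pq'[of x] by (simp only: mult_ac)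
    then have "t * poly q' (t * x + d) = c * poly p' x" using that by simp
    then show ?thesis using t by (simp add: poly_pcompose field_simps)
  qed
  then have "UNIV - {r} \<subseteq> {x. poly (pcompose q' [:d, t:] - Polynomial.smult (c / t) p') x = 0}" by blast
  moreover have "infinite (UNIV - {r})" by (intro infinite_remove infinite_UNIV_char_0)
  ultimately have "infinite {x. poly (pcompose q' [:d, t:] - Polynomial.smult (c / t) p') x = 0}"
    by (rule infinite_super)
  then have "pcompose q' [:d, t:] - Polynomial.smult (c / t) p' = 0" using poly_roots_finite by blast
  then have e: "pcompose q' [:d, t:] = Polynomial.smult (c / t) p'" by simp
  have "poly q' (t * x + d) = c / t * poly p' x" for x
    using arg_cong[OF e, of "\<lambda>p. poly p x"] by (simp add: poly_pcompose algebra_simps)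
  then have "proots q' = image_mset (\<lambda>x. t * x + d) (proots p')"
  proof (intro Suc.hyps(1))
    show "n = degree p'" "size (proots p') = degree p'" using Suc.hyps(2) dp Suc.prems(5) pp by simp_all
    show "c / t \<noteq> 0" using Suc.prems t by simp
  qed (use p'0 t in auto)
  moreover have "proots q = {#t * r + d#} + proots q'" unfolding q' using q'0 by (subst proots_mult) auto
  ultimately show ?case by (simp add: pp)
qed

definition lam_nth :: "nat \<Rightarrow> nat \<Rightarrow> (nat \<Rightarrow> nat \<Rightarrow> real) \<Rightarrow> real" where
  "lam_nth N i A = eigenvalue_nth i (Matrix.mat N N (\<lambda>(j, k). A j k))"

lemma sorted_list_of_multiset_affine:
  assumes "0 < (t :: real)"
  shows "sorted_list_of_multiset (image_mset (\<lambda>x. t * x + d) M) = map (\<lambda>x. t * x + d) (sorted_list_of_multiset M)"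
proof -
  let ?f = "\<lambda>x. t * x + d"
  have "sorted (map ?f xs)" if "sorted xs" for xs
    using that assms by (induction xs) auto
  then have "sorted (map ?f (sorted_list_of_multiset M))" by simp
  then have "sort (sorted_list_of_multiset (image_mset ?f M)) = map ?f (sorted_list_of_multiset M)"
    by (intro properties_for_sort) simp_all
  then show ?thesis by (simp add: sorted_sort_id)
qed

text \<open>For t > 0 the affine map preserves the order of the eigenvalues. All N of them are real,
  so \<open>i - 1\<close> is a valid position in the list.\<close>

lemma lam_nth_affine:
  assumes i: "1 \<le> i" "i \<le> N" and A: "\<And>j k. A j k = A k j" and t: "0 < t"
  shows "lam_nth N i (\<lambda>j k. t * A j k + (if j = k then d else 0)) = t * lam_nth N i A + d"
proof -
  let ?A = "Matrix.mat N N (\<lambda>(j, k). A j k)" and ?B = "Matrix.mat N N (\<lambda>(j, k). t * A j k + (if j = k then d else 0))"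
  have cA: "?A \<in> carrier_mat N N" and cB: "?B \<in> carrier_mat N N" by auto
  have dA: "degree (char_poly ?A) = N" and mA: "monic (char_poly ?A)"
    using degree_monic_char_poly[OF cA] by auto
  have A0: "char_poly ?A \<noteq> 0" using mA by auto
  have sA: "size (proots (char_poly ?A)) = degree (char_poly ?A)"
  proof (rule size_proots_real[OF _ A0])
    fix z assume "poly (map_poly complex_of_real (char_poly ?A)) z = 0"
    then show "Im z = 0" by (rule symmetric_char_poly_real_roots[OF cA, rotated]) (use A in simp)
  qed
  have "proots (char_poly ?B) = image_mset (\<lambda>x. t * x + d) (proots (char_poly ?A))"
  proof (rule proots_affine[OF _ _ _ A0 sA])
    show "poly (char_poly ?B) (t * x + d) = t ^ N * poly (char_poly ?A) x" for x
      by (rule char_poly_affine[OF cA cB]) (use t in auto)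
  qed (use t in auto)
  then have "sorted_list_of_multiset (proots (char_poly ?B)) = map (\<lambda>x. t * x + d) (sorted_list_of_multiset (proots (char_poly ?A)))"
    by (simp add: sorted_list_of_multiset_affine[OF t])
  moreover have "i - 1 < length (sorted_list_of_multiset (proots (char_poly ?A)))"
    using i sA dA by (simp flip: size_mset)
  ultimately show ?thesis by (simp add: lam_nth_def eigenvalue_nth_def)
qed

section \<open>Quadratic test functions\<close>

lemma partial_deriv_quadratic:
  fixes A :: "nat \<Rightarrow> nat \<Rightarrow> real" and g z :: "nat \<Rightarrow> real" and N :: nat
  assumes A: "\<And>j k. A j k = A k j" and j: "j < N"
  defines "\<phi> \<equiv> \<lambda>y. ip N g (\<lambda>k. y k - z k) + qf N A (\<lambda>k. y k - z k) / 2"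
  shows "((\<lambda>t. \<phi> (x(j := t))) has_real_derivative (g j + (\<Sum>k<N. A j k * (x k - z k)))) (at (x j))"
proof -
  define e where "e = (\<lambda>k. if k = j then 1 else 0::real)"
  have ipe: "ip N v e = v j" for v using j by (simp add: ip_def e_def if_distrib cong: if_cong)
  have up: "(\<lambda>k. (x(j := t)) k - z k) = (\<lambda>k. (x k - z k) + (t - x j) * e k)" for t
    by (auto simp: e_def)
  have "\<phi> (x(j := t)) = \<phi> x + (t - x j) * (g j + mv N A (\<lambda>k. x k - z k) j) + (t - x j)\<^sup>2 * (qf N A e / 2)" for t
  proof -
    have q: "qf N A (\<lambda>k. a * e k) = a\<^sup>2 * qf N A e" for a
      by (simp add: qf_def sum_distrib_left power2_eq_square mult_ac)
    show ?thesis unfolding \<phi>_def up qf_add[OF A] ip_add_right ip_scale_right ipe q by (simp add: field_simps)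
  qed
  then have "(\<lambda>t. \<phi> (x(j := t))) = (\<lambda>t. \<phi> x + (t - x j) * (g j + mv N A (\<lambda>k. x k - z k) j) + (t - x j)\<^sup>2 * (qf N A e / 2))"
    by auto
  moreover have "((\<lambda>t. \<phi> x + (t - x j) * (g j + mv N A (\<lambda>k. x k - z k) j) + (t - x j)\<^sup>2 * (qf N A e / 2)) has_real_derivative
      (g j + mv N A (\<lambda>k. x k - z k) j)) (at (x j))"
    by (auto intro!: derivative_eq_intros)
  ultimately show ?thesis by (simp add: mv_def)
qed

lemma quadratic_C2:
  fixes A :: "nat \<Rightarrow> nat \<Rightarrow> real" and g z :: "nat \<Rightarrow> real" and N :: nat
  assumes A: "\<And>j k. A j k = A k j"
  defines "\<phi> \<equiv> \<lambda>y. ip N g (\<lambda>k. y k - z k) + qf N A (\<lambda>k. y k - z k) / 2"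
  shows "C2_on N S \<phi>" "gradient N \<phi> z = (\<lambda>k. if k < N then g k else 0)" "hessian N \<phi> x = Matrix.mat N N (\<lambda>(j, k). A j k)"
proof -
  have der: "((\<lambda>t. \<phi> (x(j := t))) has_real_derivative (g j + (\<Sum>k<N. A j k * (x k - z k)))) (at (x j))" if "j < N" for x j
    unfolding \<phi>_def by (rule partial_deriv_quadratic[OF A that])
  then have p1: "partial_deriv j \<phi> = (\<lambda>x. g j + (\<Sum>k<N. A j k * (x k - z k)))" if "j < N" for j
    using that by (auto simp: partial_deriv_def fun_eq_iff intro!: DERIV_imp_deriv)
  have der2: "((\<lambda>t. g k + (\<Sum>i<N. A k i * ((x(j := t)) i - z i))) has_real_derivative A k j) (at (x j))" if "j < N" for x j k
  proof -
    have dd: "((\<lambda>t. (x(j := t)) i - z i) has_real_derivative (if i = j then 1 else 0)) (at (x j))" for i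
      by (cases "i = j") (auto intro!: derivative_eq_intros)
    have "((\<lambda>t. g k + (\<Sum>i<N. A k i * ((x(j := t)) i - z i))) has_real_derivative 0 + (\<Sum>i<N. A k i * (if i = j then 1 else 0))) (at (x j))"
      by (intro DERIV_add DERIV_const DERIV_sum DERIV_cmult dd)
    moreover have "(\<Sum>i<N. A k i * (if i = j then 1 else 0)) = A k j"
      using that by (simp add: if_distrib cong: if_cong)
    ultimately show ?thesis by simp
  qed
  have p2: "partial_deriv j (\<lambda>x. g k + (\<Sum>i<N. A k i * (x i - z i))) = (\<lambda>x. A k j)" if "j < N" for j k
    using der2[OF that] by (auto simp: partial_deriv_def fun_eq_iff intro!: DERIV_imp_deriv)
  have "C1_on N S \<phi>" unfolding C1_on_def
  proof (intro conjI allI impI ballI)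
    show "continuous_on S \<phi>" unfolding \<phi>_def by (intro continuous_intros) auto
    fix k assume k: "k < N"
    show "(\<lambda>t. \<phi> (x(k := t))) differentiable (at (x k))" for x using der[OF k] real_differentiable_def by blast
    show "continuous_on S (partial_deriv k \<phi>)" unfolding p1[OF k] by (intro continuous_intros)
  qed
  moreover have "C1_on N S (partial_deriv j \<phi>)" if j: "j < N" for j unfolding C1_on_def p1[OF j]
  proof (intro conjI allI impI ballI)
    show "continuous_on S (\<lambda>x. g j + (\<Sum>k<N. A j k * (x k - z k)))" by (intro continuous_intros)
    fix k assume k: "k < N"
    show "(\<lambda>t. g j + (\<Sum>i<N. A j i * ((x(k := t)) i - z i))) differentiable (at (x k))" for x
      using der2[OF k] real_differentiable_def by blast
    show "continuous_on S (partial_deriv k (\<lambda>x. g j + (\<Sum>i<N. A j i * (x i - z i))))" unfolding p2[OF k] by (intro continuous_intros)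
  qed
  ultimately show "C2_on N S \<phi>" by (simp add: C2_on_def)
  show "gradient N \<phi> z = (\<lambda>k. if k < N then g k else 0)" by (auto simp: gradient_def p1)
  show "hessian N \<phi> x = Matrix.mat N N (\<lambda>(j, k). A j k)"
    unfolding hessian_def by (rule cong_mat) (auto simp: p1 p2 A)
qed

lemma powr_continuous_at:
  assumes "0 < (p::real)" "0 \<le> t0" "0 < e"
  shows "\<exists>d>0. \<forall>t\<ge>0. \<bar>t - t0\<bar> < d \<longrightarrow> \<bar>t powr p - t0 powr p\<bar> < e"
proof -
  have "continuous_on {0..} (\<lambda>t::real. t powr p)" using assms(1) by (intro continuous_on_powr' continuous_intros) auto
  then show ?thesis using assms(2,3) unfolding continuous_on_iff dist_real_def by force
qed

lemma edist_eq: "edist N x y = enorm N (\<lambda>k. x k - y k)"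
  by (simp add: edist_def)

lemma continuous_on_translate:
  assumes "continuous_on T (u :: _ \<Rightarrow> real)" "\<And>h. h \<in> S \<Longrightarrow> (\<lambda>k. x k + h k) \<in> T"
  shows "continuous_on S (\<lambda>h. u (\<lambda>k. x k + h k :: real))"
proof (rule continuous_on_compose2[OF assms(1)])
  show "continuous_on S (\<lambda>h k. x k + h k)"
    by (intro continuous_on_coordinatewise_then_product continuous_intros)
qed (use assms(2) in auto)

text \<open>The touching argument provides test functions only at points near \<open>x\<close> and
  with slopes near \<open>P\<close>. The terms of the equation other than the eigenvalue then change
  by less than \<open>e\<close>.\<close>

lemma test_gradient_continuity:
  assumes b: "0 < b" and p: "1 < p" and \<gamma>: "0 \<le> \<gamma>" and \<Lambda>: "0 \<le> \<Lambda>"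
    and f: "\<And>x y. x \<in> closed_eball N 2 \<Longrightarrow> y \<in> closed_eball N 2 \<Longrightarrow> \<bar>f x - f y\<bar> \<le> \<Lambda> * edist N x y"
    and u: "continuous_on (closed_eball N 2) u"
    and x: "x \<in> open_eball N 2" and e: "0 < e"
  shows "\<exists>d>0. \<forall>h g. (\<forall>k\<ge>N. h k = 0) \<longrightarrow> enorm N h < d \<longrightarrow> enorm N g < d \<longrightarrow>
     (\<lambda>k. x k + h k) \<in> open_eball N 2 \<and>
     \<bar>(b * enorm N (\<lambda>k. P k + g k) powr p - f (\<lambda>k. x k + h k) + \<gamma> * u (\<lambda>k. x k + h k))
       - (b * enorm N P powr p - f x + \<gamma> * u x)\<bar> < e"
proof -
  have xs: "\<forall>k\<ge>N. x k = 0" "enorm N x < 2" using x by (auto simp: open_eball_iff)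
  have xc: "x \<in> closed_eball N 2" using xs by (simp add: closed_eball_iff)
  obtain d1 where d1: "0 < d1" "\<And>t. 0 \<le> t \<Longrightarrow> \<bar>t - enorm N P\<bar> < d1 \<Longrightarrow> \<bar>t powr p - enorm N P powr p\<bar> < e / (4 * b)"
    using powr_continuous_at[of p "enorm N P" "e / (4 * b)"] p e b by auto
  obtain d2 where d2: "0 < d2" "\<And>y. y \<in> closed_eball N 2 \<Longrightarrow> enorm N (\<lambda>k. y k - x k) < d2 \<Longrightarrow> \<bar>u y - u x\<bar> < e / (4 * (\<gamma> + 1))"
  proof -
    have "0 < e / (4 * (\<gamma> + 1))" using e \<gamma> by simp
    then show ?thesis using continuous_on_enormD[OF u _ xc, of N "e / (4 * (\<gamma> + 1))"] that by (auto simp: closed_eball_iff)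
  qed
  define d where "d = min (min d1 d2) (min (2 - enorm N x) (e / (4 * (\<Lambda> + 1))))"
  have d: "0 < d" "d \<le> d1" "d \<le> d2" "d \<le> 2 - enorm N x" "d \<le> e / (4 * (\<Lambda> + 1))"
    using d1(1) d2(1) xs(2) e \<Lambda> by (auto simp: d_def)
  have "(\<lambda>k. x k + h k) \<in> open_eball N 2 \<and>
     \<bar>(b * enorm N (\<lambda>k. P k + g k) powr p - f (\<lambda>k. x k + h k) + \<gamma> * u (\<lambda>k. x k + h k))
       - (b * enorm N P powr p - f x + \<gamma> * u x)\<bar> < e"
    if h: "\<forall>k\<ge>N. h k = 0" "enorm N h < d" and g: "enorm N g < d" for h g
  proof -
    let ?y = "\<lambda>k. x k + h k"
    have yx: "(\<lambda>k. ?y k - x k) = h" by auto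
    have y1: "?y \<in> open_eball N 2"
      using enorm_triangle[of N x h] h d xs by (auto simp: open_eball_iff)
    then have y2: "?y \<in> closed_eball N 2" by (auto simp: open_eball_iff closed_eball_iff)
    have "\<bar>enorm N (\<lambda>k. P k + g k) - enorm N P\<bar> < d1"
      using enorm_triangle[of N P g] enorm_le_add_diff[of N P "\<lambda>k. P k + g k"] g d by (simp add: enorm_minus)
    then have "\<bar>enorm N (\<lambda>k. P k + g k) powr p - enorm N P powr p\<bar> < e / (4 * b)" by (intro d1(2)) auto
    then have "b * \<bar>enorm N (\<lambda>k. P k + g k) powr p - enorm N P powr p\<bar> < b * (e / (4 * b))" using b by (intro mult_strict_left_mono)
    then have 1: "\<bar>b * enorm N (\<lambda>k. P k + g k) powr p - b * enorm N P powr p\<bar> < e / 4"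
      using b by (simp add: right_diff_distrib[symmetric] abs_mult)
    have "\<bar>u ?y - u x\<bar> < e / (4 * (\<gamma> + 1))" by (rule d2(2)[OF y2]) (use yx h d in simp)
    then have "\<gamma> * \<bar>u ?y - u x\<bar> \<le> \<gamma> * (e / (4 * (\<gamma> + 1)))" using \<gamma> by (intro mult_left_mono) auto
    also have "\<dots> \<le> e / 4" using \<gamma> e by (simp add: field_simps)
    finally have 2: "\<bar>\<gamma> * u ?y - \<gamma> * u x\<bar> \<le> e / 4" using \<gamma> by (simp add: right_diff_distrib[symmetric] abs_mult)
    have "\<bar>f ?y - f x\<bar> \<le> \<Lambda> * enorm N h" using f[OF y2 xc] unfolding edist_eq yx .
    also have "\<dots> \<le> \<Lambda> * (e / (4 * (\<Lambda> + 1)))" using h d \<Lambda> by (intro mult_left_mono) auto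
    also have "\<dots> \<le> e / 4" using \<Lambda> e by (simp add: field_simps)
    finally have 3: "\<bar>f ?y - f x\<bar> \<le> e / 4" .
    show ?thesis by (intro conjI y1) (use 1 2 3 e in linarith)
  qed
  then show ?thesis using d(1) by blast
qed

text \<open>After recentring, \<open>u1\<close> and \<open>u2\<close> vanish at 0 and the doubled
  maximum is the hypothesis of \<open>touching_inequality\<close>. The equation yields the bounds
  (HP - e) / a and (HQ + e) / a on the eigenvalues of superjets close to the origin, and e tends to
  0.\<close>

lemma viscosity_doubling:
  assumes i: "i \<in> {1..N}" and a: "0 < a" and b: "0 < b" and p: "1 < p" and \<gamma>: "0 \<le> \<gamma>" and \<Lambda>: "0 \<le> \<Lambda>"
    and f: "\<And>x y. x \<in> closed_eball N 2 \<Longrightarrow> y \<in> closed_eball N 2 \<Longrightarrow> \<bar>f x - f y\<bar> \<le> \<Lambda> * edist N x y"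
    and u: "continuous_on (closed_eball N 2) u"
    and visc: "viscosity_solution N (\<lambda>x r q X. - a * eigenvalue_nth i X + b * enorm N q powr p - f x + \<gamma> * r) (open_eball N 2) u"
    and x: "x \<in> open_eball N 2" and y: "y \<in> open_eball N 2"
    and c: "0 < c" and R: "0 \<le> R" and K: "0 \<le> K" and \<rho>: "0 < \<rho>"
    and ineq: "\<And>h l. h \<in> closed_eball N \<rho> \<Longrightarrow> l \<in> closed_eball N \<rho> \<Longrightarrow>
       u (\<lambda>k. x k + h k) - u (\<lambda>k. y k + l k) \<le> u x - u y + ip N P h - ip N Q l
         + R / 2 * (enorm N l)\<^sup>2 + K * (enorm N (\<lambda>k. h k - c * l k))\<^sup>2"
  shows "c\<^sup>2 * (b * enorm N P powr p - f x + \<gamma> * u x) \<le> b * enorm N Q powr p - f y + \<gamma> * u y + a * R"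
proof -
  define HP where "HP = b * enorm N P powr p - f x + \<gamma> * u x"
  define HQ where "HQ = b * enorm N Q powr p - f y + \<gamma> * u y"
  have main: "c\<^sup>2 * ((HP - e) / a) \<le> (HQ + e) / a + R" if e: "0 < e" for e
  proof -
    obtain d1 where d1: "0 < d1" and D1: "\<And>h g. \<forall>k\<ge>N. h k = 0 \<Longrightarrow> enorm N h < d1 \<Longrightarrow> enorm N g < d1 \<Longrightarrow>
     (\<lambda>k. x k + h k) \<in> open_eball N 2 \<and>
     \<bar>(b * enorm N (\<lambda>k. P k + g k) powr p - f (\<lambda>k. x k + h k) + \<gamma> * u (\<lambda>k. x k + h k)) - HP\<bar> < e"
      using test_gradient_continuity[OF b p \<gamma> \<Lambda> f u x e, of P] unfolding HP_def by blast
    obtain d2 where d2: "0 < d2" and D2: "\<And>h g. \<forall>k\<ge>N. h k = 0 \<Longrightarrow> enorm N h < d2 \<Longrightarrow> enorm N g < d2 \<Longrightarrow>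
     (\<lambda>k. y k + h k) \<in> open_eball N 2 \<and>
     \<bar>(b * enorm N (\<lambda>k. Q k + g k) powr p - f (\<lambda>k. y k + h k) + \<gamma> * u (\<lambda>k. y k + h k)) - HQ\<bar> < e"
      using test_gradient_continuity[OF b p \<gamma> \<Lambda> f u y e, of Q] unfolding HQ_def by blast
    define r where "r = min \<rho> (min (d1 / 2) (d2 / 2))"
    have r: "0 < r" "r \<le> \<rho>" "r < d1" "r < d2" using \<rho> d1 d2 by (auto simp: r_def)
    have xy0: "\<forall>k\<ge>N. x k = 0" "\<forall>k\<ge>N. y k = 0" using x y by (auto simp: open_eball_iff)
    have inx: "(\<lambda>k. x k + h k) \<in> closed_eball N 2" and iny: "(\<lambda>k. y k + h k) \<in> closed_eball N 2" if "h \<in> closed_eball N r" for h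
      using D1[of h "\<lambda>_. 0"] D2[of h "\<lambda>_. 0"] that r d1 d2 by (auto simp: closed_eball_iff open_eball_iff)
    define u1 where "u1 h = u (\<lambda>k. x k + h k) - u x - ip N P h" for h
    define u2 where "u2 l = u y + ip N Q l - u (\<lambda>k. y k + l k)" for l
    have "c\<^sup>2 * ((HP - e) / a) \<le> (HQ + e) / a + R"
    proof (rule touching_inequality[where ?u1.0 = u1 and ?u2.0 = u2 and lam = "lam_nth N i" and \<rho> = r, OF _ c R K r(1)])
      show "0 < N" using i by auto
      show "continuous_on (closed_eball N r) u1" unfolding u1_def
        by (intro continuous_intros continuous_on_translate[OF u] inx) auto
      show "continuous_on (closed_eball N r) u2" unfolding u2_def
        by (intro continuous_intros continuous_on_translate[OF u] iny) auto
      show "u1 (\<lambda>_. 0) = 0" "u2 (\<lambda>_. 0) = 0" by (simp_all add: u1_def u2_def ip_zero_right)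
      show "u1 h + u2 l \<le> R / 2 * (enorm N l)\<^sup>2 + K * (enorm N (\<lambda>k. h k - c * l k))\<^sup>2"
        if "h \<in> closed_eball N r" "l \<in> closed_eball N r" for h l
        using ineq[of h l] that r by (simp add: u1_def u2_def closed_eball_iff)
      show "lam_nth N i (\<lambda>j k. t * A j k + (if j = k then d else 0)) = t * lam_nth N i A + d"
        if "\<And>j k. A j k = A k j" "0 < t" for A t d
        by (rule lam_nth_affine) (use i that in auto)
    next
      fix A g h0
      assume A: "\<And>j k. A j k = A k j" and h0: "\<forall>k\<ge>N. h0 k = 0" "enorm N h0 < r" and g: "enorm N g < r"
        and "\<exists>d>0. \<forall>h\<in>closed_eball N r. enorm N (\<lambda>k. h k - h0 k) < d \<longrightarrow>
          u1 h \<le> u1 h0 + ip N g (\<lambda>k. h k - h0 k) + qf N A (\<lambda>k. h k - h0 k) / 2"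
      then obtain d where d: "0 < d" and T: "\<And>h. h \<in> closed_eball N r \<Longrightarrow> enorm N (\<lambda>k. h k - h0 k) < d \<Longrightarrow>
          u1 h \<le> u1 h0 + ip N g (\<lambda>k. h k - h0 k) + qf N A (\<lambda>k. h k - h0 k) / 2" by blast
      define x0 where "x0 = (\<lambda>k. x k + h0 k)"
      define \<phi> where "\<phi> = (\<lambda>y. ip N (\<lambda>k. P k + g k) (\<lambda>k. y k - x0 k) + qf N A (\<lambda>k. y k - x0 k) / 2)"
      have x0: "x0 \<in> open_eball N 2" and close: "\<bar>(b * enorm N (\<lambda>k. P k + g k) powr p - f x0 + \<gamma> * u x0) - HP\<bar> < e"
        using D1[of h0 g] h0 g r by (auto simp: x0_def)
      have "local_max_at N (open_eball N 2) (\<lambda>y. u y - \<phi> y) x0"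
        unfolding local_max_at_def
      proof (intro exI[of _ "min d (r - enorm N h0)"] conjI ballI impI)
        show "0 < min d (r - enorm N h0)" using d h0 by simp
        fix z assume z: "z \<in> open_eball N 2" "edist N z x0 < min d (r - enorm N h0)"
        define h where "h = (\<lambda>k. z k - x k)"
        have hh: "(\<lambda>k. h k - h0 k) = (\<lambda>k. z k - x0 k)" and xh: "(\<lambda>k. x k + h k) = z" by (auto simp: h_def x0_def)
        have n: "enorm N (\<lambda>k. h k - h0 k) < min d (r - enorm N h0)" using z(2) unfolding hh edist_eq .
        have "h \<in> closed_eball N r" using enorm_le_add_diff[of N h h0] n z(1) xy0 by (auto simp: closed_eball_iff open_eball_iff h_def)
        from T[OF this] n have "u1 h \<le> u1 h0 + ip N g (\<lambda>k. z k - x0 k) + qf N A (\<lambda>k. z k - x0 k) / 2" unfolding hh by simp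
        moreover have "ip N P h = ip N P h0 + ip N P (\<lambda>k. z k - x0 k)" unfolding hh[symmetric] ip_diff_right by simp
        moreover have "\<phi> x0 = 0" by (simp add: \<phi>_def ip_zero_right qf_def)
        ultimately show "u z - \<phi> z \<le> u x0 - \<phi> x0"
          unfolding u1_def xh x0_def[symmetric] by (simp add: \<phi>_def ip_add_left)
      qed
      then have "- a * eigenvalue_nth i (hessian N \<phi> x0) + b * enorm N (gradient N \<phi> x0) powr p - f x0 + \<gamma> * u x0 \<le> 0"
        using visc x0 quadratic_C2(1)[where A = A and N = N and z = x0 and g = "\<lambda>k. P k + g k", OF A, folded \<phi>_def]
        unfolding viscosity_solution_def by blast
      moreover have "hessian N \<phi> x0 = Matrix.mat N N (\<lambda>(j, k). A j k)" unfolding \<phi>_def by (rule quadratic_C2(3)[OF A])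
      moreover have "enorm N (gradient N \<phi> x0) = enorm N (\<lambda>k. P k + g k)" unfolding \<phi>_def quadratic_C2(2)[where A = A, OF A]
        by (rule enorm_cong) simp
      ultimately have "HP - e \<le> a * lam_nth N i A" using close by (simp add: lam_nth_def abs_less_iff)
      then show "(HP - e) / a \<le> lam_nth N i A" using a by (simp add: field_simps)
    next
      fix A g h0
      assume A: "\<And>j k. A j k = A k j" and h0: "\<forall>k\<ge>N. h0 k = 0" "enorm N h0 < r" and g: "enorm N g < r"
        and "\<exists>d>0. \<forall>h\<in>closed_eball N r. enorm N (\<lambda>k. h k - h0 k) < d \<longrightarrow>
          u2 h \<le> u2 h0 + ip N g (\<lambda>k. h k - h0 k) + qf N A (\<lambda>k. h k - h0 k) / 2"
      then obtain d where d: "0 < d" and T: "\<And>h. h \<in> closed_eball N r \<Longrightarrow> enorm N (\<lambda>k. h k - h0 k) < d \<Longrightarrow>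
          u2 h \<le> u2 h0 + ip N g (\<lambda>k. h k - h0 k) + qf N A (\<lambda>k. h k - h0 k) / 2" by blast
      have mA: "- A j k = - A k j" for j k using A by simp
      define y0 where "y0 = (\<lambda>k. y k + h0 k)"
      \<comment> \<open>\<open>u2\<close> contains -u, so a superjet (g, A) of \<open>u2\<close> is
        a subjet (Q - g, -A) of u.\<close>
      define \<phi> where "\<phi> = (\<lambda>y. ip N (\<lambda>k. Q k + - g k) (\<lambda>k. y k - y0 k) + qf N (\<lambda>j k. - A j k) (\<lambda>k. y k - y0 k) / 2)"
      have "enorm N (\<lambda>k. - g k) < r" using g by (simp add: enorm_minus)
      then have y0: "y0 \<in> open_eball N 2" and close: "\<bar>(b * enorm N (\<lambda>k. Q k + - g k) powr p - f y0 + \<gamma> * u y0) - HQ\<bar> < e"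
        using D2[of h0 "\<lambda>k. - g k"] h0 r by (auto simp: y0_def)
      have "local_min_at N (open_eball N 2) (\<lambda>y. u y - \<phi> y) y0"
        unfolding local_min_at_def
      proof (intro exI[of _ "min d (r - enorm N h0)"] conjI ballI impI)
        show "0 < min d (r - enorm N h0)" using d h0 by simp
        fix z assume z: "z \<in> open_eball N 2" "edist N z y0 < min d (r - enorm N h0)"
        define h where "h = (\<lambda>k. z k - y k)"
        have hh: "(\<lambda>k. h k - h0 k) = (\<lambda>k. z k - y0 k)" and xh: "(\<lambda>k. y k + h k) = z" by (auto simp: h_def y0_def)
        have n: "enorm N (\<lambda>k. h k - h0 k) < min d (r - enorm N h0)" using z(2) unfolding hh edist_eq .
        have "h \<in> closed_eball N r" using enorm_le_add_diff[of N h h0] n z(1) xy0 by (auto simp: closed_eball_iff open_eball_iff h_def)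
        from T[OF this] n have "u2 h \<le> u2 h0 + ip N g (\<lambda>k. z k - y0 k) + qf N A (\<lambda>k. z k - y0 k) / 2" unfolding hh by simp
        moreover have "ip N Q h = ip N Q h0 + ip N Q (\<lambda>k. z k - y0 k)" unfolding hh[symmetric] ip_diff_right by simp
        moreover have "\<phi> y0 = 0" by (simp add: \<phi>_def ip_zero_right qf_def)
        ultimately show "u y0 - \<phi> y0 \<le> u z - \<phi> z"
          unfolding u2_def xh y0_def[symmetric] by (simp add: \<phi>_def ip_diff_left qf_uminus)
      qed
      then have "0 \<le> - a * eigenvalue_nth i (hessian N \<phi> y0) + b * enorm N (gradient N \<phi> y0) powr p - f y0 + \<gamma> * u y0"
        using visc y0 quadratic_C2(1)[where A = "\<lambda>j k. - A j k" and N = N and z = y0 and g = "\<lambda>k. Q k + - g k", OF mA, folded \<phi>_def]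
        unfolding viscosity_solution_def by blast
      moreover have "hessian N \<phi> y0 = Matrix.mat N N (\<lambda>(j, k). - A j k)" unfolding \<phi>_def by (rule quadratic_C2(3)[where A = "\<lambda>j k. - A j k", OF mA])
      moreover have "enorm N (gradient N \<phi> y0) = enorm N (\<lambda>k. Q k + - g k)" unfolding \<phi>_def quadratic_C2(2)[where A = "\<lambda>j k. - A j k", OF mA]
        by (rule enorm_cong) simp
      ultimately have "a * lam_nth N i (\<lambda>j k. - A j k) \<le> HQ + e" using close by (simp add: lam_nth_def abs_less_iff)
      then show "lam_nth N i (\<lambda>j k. - A j k) \<le> (HQ + e) / a" using a by (simp add: field_simps)
    qed
    then show ?thesis .
  qed
  have "c\<^sup>2 * HP \<le> HQ + a * R"
  proof (rule field_le_epsilon)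
    fix e :: real assume e: "0 < e"
    define e' where "e' = e / (c\<^sup>2 + 1)"
    have c2: "0 < c\<^sup>2 + 1" by (simp add: add_nonneg_pos)
    have "0 < e'" using e c2 by (simp add: e'_def)
    from main[OF this] have "a * (c\<^sup>2 * ((HP - e') / a)) \<le> a * ((HQ + e') / a + R)" using a by (intro mult_left_mono) auto
    moreover have "a * (c\<^sup>2 * ((HP - e') / a)) = c\<^sup>2 * (HP - e')" "a * ((HQ + e') / a + R) = HQ + e' + a * R"
      using a by (simp_all add: field_simps)
    ultimately have "c\<^sup>2 * (HP - e') \<le> HQ + e' + a * R" by simp
    moreover have "(c\<^sup>2 + 1) * e' = e" using c2 by (simp add: e'_def)
    ultimately show "c\<^sup>2 * HP \<le> HQ + a * R + e" by (simp add: algebra_simps)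
  qed
  then show ?thesis by (simp add: HP_def HQ_def)
qed

subsection \<open>The penalty\<close>

lemma second_order_taylor_bound:
  fixes g g' g'' :: "real \<Rightarrow> real"
  assumes d1: "\<And>t. 0 \<le> t \<Longrightarrow> t \<le> 1 \<Longrightarrow> (g has_real_derivative g' t) (at t)"
    and d2: "\<And>t. 0 \<le> t \<Longrightarrow> t \<le> 1 \<Longrightarrow> (g' has_real_derivative g'' t) (at t)"
    and B: "\<And>t. 0 \<le> t \<Longrightarrow> t \<le> 1 \<Longrightarrow> g'' t \<le> B"
  shows "g 1 \<le> g 0 + g' 0 + B / 2"
proof -
  have g': "g' t - B * t \<le> g' 0 - B * 0" if "0 \<le> t" "t \<le> 1" for t
  proof (rule DERIV_nonpos_imp_nonincreasing[of 0 t "\<lambda>t. g' t - B * t"])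
    fix x assume x: "0 \<le> x" "x \<le> t"
    have "((\<lambda>t. g' t - B * t) has_real_derivative (g'' x - B)) (at x)"
      using x that by (auto intro!: derivative_eq_intros d2)
    then show "\<exists>y. ((\<lambda>t. g' t - B * t) has_real_derivative y) (at x) \<and> y \<le> 0"
      using B[of x] x that by (intro exI[of _ "g'' x - B"]) auto
  qed (use that in auto)
  have "g 1 - g' 0 * 1 - B * 1\<^sup>2 / 2 \<le> g 0 - g' 0 * 0 - B * 0\<^sup>2 / 2"
  proof (rule DERIV_nonpos_imp_nonincreasing[of 0 1 "\<lambda>t. g t - g' 0 * t - B * t\<^sup>2 / 2"])
    fix x :: real assume x: "0 \<le> x" "x \<le> 1"
    have "((\<lambda>t. g t - g' 0 * t - B * t\<^sup>2 / 2) has_real_derivative (g' x - g' 0 - B * x)) (at x)"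
      using x by (auto intro!: derivative_eq_intros d1)
    then show "\<exists>y. ((\<lambda>t. g t - g' 0 * t - B * t\<^sup>2 / 2) has_real_derivative y) (at x) \<and> y \<le> 0"
      using g'[of x] x by (intro exI[of _ "g' x - g' 0 - B * x"]) auto
  qed auto
  then show ?thesis by simp
qed

lemma powr_neg_le_half:
  fixes D D0 q :: real
  assumes "0 < D0" "D0 / 2 \<le> D" "0 \<le> q"
  shows "D powr (- q) \<le> 2 powr q * D0 powr (- q)"
proof -
  have "D powr (- q) \<le> (D0 / 2) powr (- q)" using assms by (intro powr_mono2') auto
  also have "\<dots> = 2 powr q * D0 powr (- q)" using assms by (simp add: powr_divide powr_minus field_simps)
  finally show ?thesis .
qed

text \<open>\<open>r\<close> and \<open>D\<close> are the distance and the quantity \<open>1 - |x|\<^sup>2 - k r\<close> along a segment;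
  \<open>W\<close> and \<open>H\<close> bound the displacements of \<open>x - y\<close> and \<open>x\<close>.\<close>

lemma blowup_second_derivative_bound:
  fixes r r' r'' D D' D'' D0 r0 W H k \<beta> :: real
  assumes D0: "0 < D0" and r0: "0 < r0" and k: "0 < k" and \<beta>: "0 < \<beta>"
    and D: "D0 / 2 \<le> D" and r: "0 < r" "r \<le> 2 * r0" and WH: "0 \<le> W" "0 \<le> H"
    and r': "\<bar>r'\<bar> \<le> 2 * W" and r'': "r'' = W\<^sup>2 / r0"
    and D': "\<bar>D'\<bar> \<le> 4 * H + 2 * k * W" and D'': "\<bar>D''\<bar> \<le> 2 * H\<^sup>2 + k * W\<^sup>2 / r0"
  shows "r'' * D powr (- \<beta>) - 2 * \<beta> * r' * D powr (- \<beta> - 1) * D' + \<beta> * (\<beta> + 1) * r * D powr (- \<beta> - 2) * D'\<^sup>2 - \<beta> * r * D powr (- \<beta> - 1) * D''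
    \<le> 2 powr (\<beta> + 2) * D0 powr (- \<beta> - 1) *
      (W\<^sup>2 * (D0 / r0 + 10 * \<beta> * k + 16 * \<beta> * (\<beta> + 1) * k\<^sup>2 * r0 / D0) + 16 * \<beta> * W * H + H\<^sup>2 * (64 * \<beta> * (\<beta> + 1) * r0 / D0 + 4 * \<beta> * r0))"
proof -
  \<comment> \<open>One power of two covers the three exponents \<beta>, \<beta> + 1 and \<beta> + 2
    that occur when D is replaced by D0 / 2.\<close>
  define Z where "Z = 2 powr (\<beta> + 2)"
  define X where "X = D0 powr (- \<beta> - 1)"
  have Z0: "0 < Z" and X0: "0 < X" using D0 by (simp_all add: Z_def X_def)
  have Dpos: "0 < D" using D D0 by simp
  have zp: "2 powr q \<le> Z" if "q \<le> \<beta> + 2" for q unfolding Z_def using that by (intro powr_mono) auto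
  have b0: "D powr (- \<beta>) \<le> Z * (X * D0)"
  proof -
    have "D powr (- \<beta>) \<le> 2 powr \<beta> * D0 powr (- \<beta>)" using powr_neg_le_half[of D0 D \<beta>] D0 D \<beta> by simp
    also have "\<dots> \<le> Z * D0 powr (- \<beta>)" using zp[of \<beta>] by (intro mult_right_mono) auto
    also have "D0 powr (- \<beta>) = X * D0" using powr_add[of D0 "- \<beta> - 1" 1] D0 by (simp add: X_def)
    finally show ?thesis .
  qed
  have b1: "D powr (- \<beta> - 1) \<le> Z * X"
  proof -
    have "D powr (- (\<beta> + 1)) \<le> 2 powr (\<beta> + 1) * D0 powr (- (\<beta> + 1))" using powr_neg_le_half[of D0 D "\<beta> + 1"] D0 D \<beta> by simp
    also have "\<dots> \<le> Z * D0 powr (- (\<beta> + 1))" using zp[of "\<beta> + 1"] by (intro mult_right_mono) auto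
    finally show ?thesis by (simp add: X_def)
  qed
  have b2: "D powr (- \<beta> - 2) \<le> Z * (X / D0)"
  proof -
    have "D powr (- (\<beta> + 2)) \<le> 2 powr (\<beta> + 2) * D0 powr (- (\<beta> + 2))" using powr_neg_le_half[of D0 D "\<beta> + 2"] D0 D \<beta> by simp
    also have "D0 powr (- (\<beta> + 2)) = X / D0"
    proof -
      have e: "- (\<beta> + 2) = (- \<beta> - 1) - 1" by simp
      show ?thesis unfolding X_def e powr_diff[of D0 "- \<beta> - 1" 1] using D0 by simp
    qed
    finally show ?thesis by (simp add: Z_def)
  qed
  have D'sq: "D'\<^sup>2 \<le> 32 * H\<^sup>2 + 8 * k\<^sup>2 * W\<^sup>2"
  proof -
    have "D'\<^sup>2 \<le> (4 * H + 2 * k * W)\<^sup>2" using D' by (simp add: abs_le_square_iff[symmetric])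
    also have "\<dots> \<le> 32 * H\<^sup>2 + 8 * k\<^sup>2 * W\<^sup>2" using zero_le_power2[of "4 * H - 2 * k * W"] by (simp add: power2_eq_square algebra_simps)
    finally show ?thesis .
  qed
  have t1: "r'' * D powr (- \<beta>) \<le> W\<^sup>2 / r0 * (Z * (X * D0))"
    unfolding r'' using b0 r0 by (intro mult_left_mono) auto
  have t2: "- (2 * \<beta> * r' * D powr (- \<beta> - 1) * D') \<le> (2 * \<beta>) * ((2 * W) * (4 * H + 2 * k * W)) * (Z * X)"
  proof -
    have "- (r' * D') \<le> \<bar>r'\<bar> * \<bar>D'\<bar>" by (metis abs_ge_minus_self abs_mult)
    also have "\<dots> \<le> (2 * W) * (4 * H + 2 * k * W)" using r' D' WH by (intro mult_mono) auto
    finally have "(2 * \<beta>) * (- (r' * D')) \<le> (2 * \<beta>) * ((2 * W) * (4 * H + 2 * k * W))" using \<beta> by (intro mult_left_mono) auto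
    then have "(2 * \<beta>) * (- (r' * D')) * D powr (- \<beta> - 1) \<le> (2 * \<beta>) * ((2 * W) * (4 * H + 2 * k * W)) * D powr (- \<beta> - 1)" by (intro mult_right_mono) auto
    also have "\<dots> \<le> (2 * \<beta>) * ((2 * W) * (4 * H + 2 * k * W)) * (Z * X)" using b1 \<beta> WH k by (intro mult_left_mono) auto
    finally show ?thesis by (simp only: mult_minus_right mult_minus_left mult_ac)
  qed
  have t3: "\<beta> * (\<beta> + 1) * r * D powr (- \<beta> - 2) * D'\<^sup>2 \<le> \<beta> * (\<beta> + 1) * (2 * r0) * (Z * (X / D0)) * (32 * H\<^sup>2 + 8 * k\<^sup>2 * W\<^sup>2)"
    using r r0 b2 D'sq \<beta> Z0 X0 D0 by (intro mult_mono) auto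
  have t4: "- (\<beta> * r * D powr (- \<beta> - 1) * D'') \<le> \<beta> * (2 * r0) * (Z * X) * (2 * H\<^sup>2 + k * W\<^sup>2 / r0)"
  proof -
    have "\<beta> * r * D powr (- \<beta> - 1) * (- D'') \<le> \<beta> * r * D powr (- \<beta> - 1) * (2 * H\<^sup>2 + k * W\<^sup>2 / r0)"
      using D'' \<beta> r by (intro mult_left_mono) auto
    also have "\<dots> \<le> \<beta> * (2 * r0) * (Z * X) * (2 * H\<^sup>2 + k * W\<^sup>2 / r0)"
      using r r0 b1 \<beta> Z0 X0 k by (intro mult_mono) auto
    finally show ?thesis by simp
  qed
  have "W\<^sup>2 / r0 * (Z * (X * D0)) + (2 * \<beta>) * ((2 * W) * (4 * H + 2 * k * W)) * (Z * X) + \<beta> * (\<beta> + 1) * (2 * r0) * (Z * (X / D0)) * (32 * H\<^sup>2 + 8 * k\<^sup>2 * W\<^sup>2)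
      + \<beta> * (2 * r0) * (Z * X) * (2 * H\<^sup>2 + k * W\<^sup>2 / r0)
    = Z * X * (W\<^sup>2 * (D0 / r0 + 10 * \<beta> * k + 16 * \<beta> * (\<beta> + 1) * k\<^sup>2 * r0 / D0) + 16 * \<beta> * W * H + H\<^sup>2 * (64 * \<beta> * (\<beta> + 1) * r0 / D0 + 4 * \<beta> * r0))"
    using r0 D0 by (simp add: field_simps power2_eq_square)
  then show ?thesis using t1 t2 t3 t4 unfolding Z_def[symmetric] X_def[symmetric] by linarith
qed

text \<open>Taylor's formula along (x + t h, y + t l). The coefficient D0 / r0, singular as r0 tends
  to 0, multiplies only |h - l|^2. Since h - l is s l plus the deviation h - (1 + s) l, it
  contributes s^2 |l|^2 to S and otherwise only to K.\<close>

lemma penalty_upper_bound: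
  assumes x: "enorm N x < 1" and r0: "0 < r0" "r0 = enorm N (\<lambda>k. x k - y k)" and k: "0 < k" and \<beta>: "0 < \<beta>"
    and D0: "0 < D0" "D0 = 1 - (enorm N x)\<^sup>2 - k * r0" and s: "0 < s" "s \<le> 1"
  defines "X \<equiv> D0 powr (- \<beta> - 1)" and "F \<equiv> D0 + \<beta> * k * r0"
  defines "S \<equiv> 2 powr (\<beta> + 2) * X * (2 * s\<^sup>2 * (D0 / r0 + 10 * \<beta> * k + 16 * \<beta> * (\<beta> + 1) * k\<^sup>2 * r0 / D0)
      + 48 * \<beta> * s + 8 * (64 * \<beta> * (\<beta> + 1) * r0 / D0 + 4 * \<beta> * r0))"
  shows "\<exists>\<rho> K. 0 < \<rho> \<and> 0 \<le> K \<and> (\<forall>h l. enorm N h \<le> \<rho> \<longrightarrow> enorm N l \<le> \<rho> \<longrightarrow>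
    0 < 1 - (enorm N (\<lambda>i. x i + h i))\<^sup>2 - k * enorm N (\<lambda>i. (x i + h i) - (y i + l i)) \<and>
    enorm N (\<lambda>i. (x i + h i) - (y i + l i)) * (1 - (enorm N (\<lambda>i. x i + h i))\<^sup>2 - k * enorm N (\<lambda>i. (x i + h i) - (y i + l i))) powr (- \<beta>)
    \<le> r0 * D0 powr (- \<beta>) + ip N (\<lambda>i. X * F * ((x i - y i) / r0) + 2 * \<beta> * r0 * X * x i) h - ip N (\<lambda>i. X * F * ((x i - y i) / r0)) l
      + S / 2 * (enorm N l)\<^sup>2 + K * (enorm N (\<lambda>i. h i - (1 + s) * l i))\<^sup>2)"
proof -
  \<comment> \<open>Along the segment the distance changes by at most 3 \<rho> \<le> 3 r0 / 8 and D
    by at most 3 \<rho> + 3 k \<rho> \<le> D0 / 2; the bound 1 / 2 makes H^2 \<le> H.\<close>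
  define \<rho> where "\<rho> = min (1 / 2) (min (r0 / 8) (D0 / (6 * (1 + k))))"
  have \<rho>: "0 < \<rho>" "\<rho> \<le> 1 / 2" "\<rho> \<le> r0 / 8" "\<rho> \<le> D0 / (6 * (1 + k))"
    subgoal using r0(1) D0(1) k by (simp add: \<rho>_def)
    subgoal unfolding \<rho>_def by (rule min.cobounded1)
    subgoal unfolding \<rho>_def by (intro min.coboundedI2 min.cobounded1)
    subgoal unfolding \<rho>_def by (intro min.coboundedI2 order_refl)
    done
  have \<rho>D: "6 * \<rho> + 6 * (k * \<rho>) \<le> D0" using \<rho>(4) k by (simp add: field_simps)
  define c1 where "c1 = D0 / r0 + 10 * \<beta> * k + 16 * \<beta> * (\<beta> + 1) * k\<^sup>2 * r0 / D0"
  define c3 where "c3 = 64 * \<beta> * (\<beta> + 1) * r0 / D0 + 4 * \<beta> * r0"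
  define Z where "Z = 2 powr (\<beta> + 2) * X"
  have c0: "0 \<le> c1" "0 \<le> c3" "0 \<le> Z" using r0 D0 k \<beta> by (auto simp: c1_def c3_def Z_def X_def)
  define K where "K = Z * (2 * c1 + 16 * \<beta> * (1 + 9 / (4 * s)) + 2 * c3) / 2"
  have K0: "0 \<le> K" using c0 s \<beta> by (auto simp: K_def intro!: mult_nonneg_nonneg add_nonneg_nonneg)
  have S: "S = Z * (2 * s\<^sup>2 * c1 + 48 * \<beta> * s + 8 * c3)" by (simp add: S_def Z_def c1_def c3_def)
  have "0 < 1 - (enorm N (\<lambda>i. x i + h i))\<^sup>2 - k * enorm N (\<lambda>i. (x i + h i) - (y i + l i)) \<and>
    enorm N (\<lambda>i. (x i + h i) - (y i + l i)) * (1 - (enorm N (\<lambda>i. x i + h i))\<^sup>2 - k * enorm N (\<lambda>i. (x i + h i) - (y i + l i))) powr (- \<beta>)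
    \<le> r0 * D0 powr (- \<beta>) + ip N (\<lambda>i. X * F * ((x i - y i) / r0) + 2 * \<beta> * r0 * X * x i) h - ip N (\<lambda>i. X * F * ((x i - y i) / r0)) l
      + S / 2 * (enorm N l)\<^sup>2 + K * (enorm N (\<lambda>i. h i - (1 + s) * l i))\<^sup>2"
    if h: "enorm N h \<le> \<rho>" and l: "enorm N l \<le> \<rho>" for h l
  proof -
    define w where "w = (\<lambda>i. h i - l i)"
    define W where "W = enorm N w"
    define H where "H = enorm N h"
    define A where "A = ip N (\<lambda>i. (x i - y i) / r0) w"
    define T where "T = ip N x h"
    have WH: "0 \<le> W" "0 \<le> H" "H \<le> \<rho>" using h by (auto simp: W_def H_def)
    have W2: "W \<le> 2 * \<rho>" using enorm_diff_le[of N h l] h l by (simp add: W_def w_def)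
    have e1: "enorm N (\<lambda>i. (x i - y i) / r0) = 1"
      using enorm_scale[of N "1 / r0" "\<lambda>i. x i - y i"] r0 by simp
    have A: "\<bar>A\<bar> \<le> W" using ip_le[of N "\<lambda>i. (x i - y i) / r0" w] e1 by (simp add: A_def W_def)
    have T: "\<bar>T\<bar> \<le> H"
    proof -
      have "\<bar>T\<bar> \<le> enorm N x * H" unfolding T_def H_def by (rule ip_le)
      also have "\<dots> \<le> 1 * H" using x WH by (intro mult_right_mono) auto
      finally show ?thesis by simp
    qed
    have WW: "W\<^sup>2 \<le> r0 * W" using W2 \<rho> WH r0 by (simp add: power2_eq_square mult_right_mono)
    have HH: "H\<^sup>2 \<le> H" using WH \<rho> by (simp add: power2_eq_square mult_left_le)
    \<comment> \<open>The tangent to the square root at r0^2 turns |x - y + t w| into a polynomial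
      majorant with the same value and slope at t = 0. Since the penalty increases with the
      distance, the majorant may replace it also inside D.\<close>
    define r where "r t = r0 + t * A + t\<^sup>2 * (W\<^sup>2 / (2 * r0))" for t
    define \<theta> where "\<theta> t = (enorm N x)\<^sup>2 + 2 * t * T + t\<^sup>2 * H\<^sup>2" for t
    define r' where "r' t = A + t * (W\<^sup>2 / r0)" for t
    define \<theta>' where "\<theta>' t = 2 * T + 2 * t * H\<^sup>2" for t
    define D where "D t = 1 - \<theta> t - k * r t" for t
    define D' where "D' t = - \<theta>' t - k * r' t" for t
    define D'' where "D'' = - 2 * H\<^sup>2 - k * (W\<^sup>2 / r0)"
    have Wr: "W\<^sup>2 / r0 \<le> W" using WW r0 by (simp add: pos_divide_le_eq mult.commute)
    have Wr0: "0 \<le> W\<^sup>2 / r0" using r0 by simp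
    have rb: "\<bar>r t - r0\<bar> \<le> 3 * \<rho>" if t: "0 \<le> t" "t \<le> 1" for t
    proof -
      have "\<bar>t * A\<bar> \<le> 1 * W" unfolding abs_mult using t A WH by (intro mult_mono) auto
      moreover have "t\<^sup>2 * (W\<^sup>2 / (2 * r0)) \<le> 1 * (W / 2)"
        using t Wr Wr0 WH by (intro mult_mono) (auto simp: power_le_one)
      moreover have "0 \<le> t\<^sup>2 * (W\<^sup>2 / (2 * r0))" using r0 by simp
      moreover have "r t - r0 = t * A + t\<^sup>2 * (W\<^sup>2 / (2 * r0))" by (simp add: r_def)
      ultimately show ?thesis using W2 by linarith
    qed
    have \<theta>b: "\<bar>\<theta> t - (enorm N x)\<^sup>2\<bar> \<le> 3 * \<rho>" if t: "0 \<le> t" "t \<le> 1" for t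
    proof -
      have "\<bar>t * T\<bar> \<le> 1 * H" unfolding abs_mult using t T WH by (intro mult_mono) auto
      moreover have "t\<^sup>2 * H\<^sup>2 \<le> 1 * H" using t HH by (intro mult_mono) (auto simp: power_le_one)
      moreover have "0 \<le> t\<^sup>2 * H\<^sup>2" by simp
      moreover have "\<theta> t - (enorm N x)\<^sup>2 = 2 * (t * T) + t\<^sup>2 * H\<^sup>2" by (simp add: \<theta>_def)
      ultimately show ?thesis using WH by linarith
    qed
    have rp: "0 < r t" "r t \<le> 2 * r0" if t: "0 \<le> t" "t \<le> 1" for t
      using rb[OF t] \<rho> r0 by (auto simp: abs_le_iff)
    have Db: "D0 / 2 \<le> D t" if t: "0 \<le> t" "t \<le> 1" for t
    proof -
      have "k * \<bar>r t - r0\<bar> \<le> k * (3 * \<rho>)" using rb[OF t] k by (intro mult_left_mono) auto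
      moreover have "k * (r t - r0) \<le> k * \<bar>r t - r0\<bar>" using k by (intro mult_left_mono) auto
      moreover have "k * (3 * \<rho>) = 3 * (k * \<rho>)" by simp
      moreover have "D t = D0 - (\<theta> t - (enorm N x)\<^sup>2) - k * (r t - r0)" by (simp add: D_def D0(2) algebra_simps)
      ultimately show ?thesis using \<theta>b[OF t] \<rho>D by linarith
    qed
    have r'b: "\<bar>r' t\<bar> \<le> 2 * W" if t: "0 \<le> t" "t \<le> 1" for t
    proof -
      define q where "q = t * (W\<^sup>2 / r0)"
      have "q \<le> 1 * W" unfolding q_def using t Wr Wr0 WH by (intro mult_mono) auto
      moreover have "0 \<le> q" unfolding q_def using t Wr0 by (intro mult_nonneg_nonneg) auto
      ultimately show ?thesis unfolding r'_def q_def[symmetric] using A by linarith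
    qed
    have \<theta>'b: "\<bar>\<theta>' t\<bar> \<le> 4 * H" if t: "0 \<le> t" "t \<le> 1" for t
    proof -
      have "t * H\<^sup>2 \<le> 1 * H" using t HH WH by (intro mult_mono) auto
      moreover have "0 \<le> t * H\<^sup>2" using t by simp
      moreover have "\<theta>' t = 2 * T + 2 * (t * H\<^sup>2)" by (simp add: \<theta>'_def)
      ultimately show ?thesis using T by linarith
    qed
    have D'b: "\<bar>D' t\<bar> \<le> 4 * H + 2 * k * W" if t: "0 \<le> t" "t \<le> 1" for t
    proof -
      have "\<bar>k * r' t\<bar> \<le> k * (2 * W)" unfolding abs_mult using r'b[OF t] k by (simp add: mult_left_mono)
      moreover have "k * (2 * W) = 2 * k * W" by simp
      ultimately show ?thesis unfolding D'_def using \<theta>'b[OF t] by linarith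
    qed
    have dr: "(r has_real_derivative r' t) (at t)" for t unfolding r_def[abs_def] r'_def
      using r0(1) by (auto intro!: derivative_eq_intros simp: field_simps)
    have dr': "(r' has_real_derivative W\<^sup>2 / r0) (at t)" for t unfolding r'_def[abs_def]
      using r0(1) by (auto intro!: derivative_eq_intros)
    have dD: "(D has_real_derivative D' t) (at t)" for t unfolding D_def[abs_def] D'_def \<theta>_def[abs_def] \<theta>'_def
      by (auto intro!: derivative_eq_intros dr)
    have dD': "(D' has_real_derivative D'') (at t)" for t unfolding D'_def[abs_def] D''_def \<theta>'_def[abs_def]
      by (auto intro!: derivative_eq_intros dr')
    have D''b: "\<bar>D''\<bar> \<le> 2 * H\<^sup>2 + k * W\<^sup>2 / r0"
    proof -
      have "0 \<le> k * W\<^sup>2 / r0" using k r0(1) by simp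
      moreover have "D'' = - (2 * H\<^sup>2) - k * W\<^sup>2 / r0" by (simp add: D''_def)
      moreover have "0 \<le> 2 * H\<^sup>2" by simp
      ultimately show ?thesis by linarith
    qed
    define g where "g t = r t * D t powr (- \<beta>)" for t
    define g' where "g' t = r' t * D t powr (- \<beta>) - \<beta> * r t * D t powr (- \<beta> - 1) * D' t" for t
    define g'' where "g'' t = W\<^sup>2 / r0 * D t powr (- \<beta>) - 2 * \<beta> * r' t * D t powr (- \<beta> - 1) * D' t + \<beta> * (\<beta> + 1) * r t * D t powr (- \<beta> - 2) * (D' t)\<^sup>2 - \<beta> * r t * D t powr (- \<beta> - 1) * D''" for t
    have dpow: "((\<lambda>t. D t powr q) has_real_derivative q * D t powr (q - 1) * D' t) (at t)" if "0 \<le> t" "t \<le> 1" for t q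
    proof -
      have "0 < D t" using Db[OF that] D0 by linarith
      from DERIV_chain2[OF has_real_derivative_powr[OF this] dD] show ?thesis .
    qed
    have dg: "(g has_real_derivative g' t) (at t)" if t: "0 \<le> t" "t \<le> 1" for t
      unfolding g_def[abs_def] g'_def
      by (rule DERIV_cong[OF DERIV_mult[OF dr dpow[OF t]]]) (simp add: algebra_simps)
    have dg': "(g' has_real_derivative g'' t) (at t)" if t: "0 \<le> t" "t \<le> 1" for t
    proof -
      have "((\<lambda>t. r' t * D t powr (- \<beta>) - (\<beta> * r t) * (D t powr (- \<beta> - 1) * D' t)) has_real_derivative
        ((W\<^sup>2 / r0) * D t powr (- \<beta>) + (- \<beta> * D t powr (- \<beta> - 1) * D' t) * r' t)
        - ((\<beta> * r' t) * (D t powr (- \<beta> - 1) * D' t) + (((- \<beta> - 1) * D t powr (- \<beta> - 1 - 1) * D' t) * D' t + D'' * D t powr (- \<beta> - 1)) * (\<beta> * r t))) (at t)"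
        by (intro DERIV_diff DERIV_mult DERIV_cmult dr dr' dD' dpow[OF t])
      moreover have "- \<beta> - 1 - 1 = - \<beta> - 2" by simp
      ultimately show ?thesis unfolding g'_def[abs_def] g''_def
        by (simp add: algebra_simps power2_eq_square)
    qed
    define B where "B = Z * (W\<^sup>2 * c1 + 16 * \<beta> * W * H + H\<^sup>2 * c3)"
    have "g 1 \<le> g 0 + g' 0 + B / 2"
    proof (rule second_order_taylor_bound[OF dg dg'])
      fix t :: real assume t: "0 \<le> t" "t \<le> 1"
      show "g'' t \<le> B" unfolding g''_def B_def Z_def c1_def c3_def X_def
        by (rule blowup_second_derivative_bound)
          (use D0(1) r0(1) k \<beta> Db[OF t] rp[OF t] WH r'b[OF t] D'b[OF t] D''b in simp_all)
    qed
    moreover have "B / 2 \<le> S / 2 * (enorm N l)\<^sup>2 + K * (enorm N (\<lambda>i. h i - (1 + s) * l i))\<^sup>2"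
    proof -
      define G where "G = enorm N (\<lambda>i. h i - (1 + s) * l i)"
      define E where "E = enorm N l"
      have GE: "0 \<le> G" "0 \<le> E" by (auto simp: G_def E_def)
      have WGE: "W \<le> s * E + G"
      proof -
        have "w = (\<lambda>i. s * l i + (h i - (1 + s) * l i))" by (auto simp: w_def algebra_simps)
        then show ?thesis using enorm_triangle[of N "\<lambda>i. s * l i" "\<lambda>i. h i - (1 + s) * l i"] s by (simp add: W_def enorm_scale E_def G_def)
      qed
      have HGE: "H \<le> 2 * E + G"
      proof -
        have "enorm N h \<le> enorm N (\<lambda>i. (1 + s) * l i) + G" unfolding G_def by (rule enorm_le_add_diff)
        moreover have "(1 + s) * E \<le> 2 * E" using s GE by (intro mult_right_mono) auto
        ultimately show ?thesis using s by (simp add: enorm_scale H_def E_def)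
      qed
      have w2: "W\<^sup>2 \<le> 2 * s\<^sup>2 * E\<^sup>2 + 2 * G\<^sup>2"
      proof -
        have "W\<^sup>2 \<le> (s * E + G)\<^sup>2" using WGE WH by (intro power_mono) auto
        also have "\<dots> \<le> 2 * s\<^sup>2 * E\<^sup>2 + 2 * G\<^sup>2" using zero_le_power2[of "s * E - G"] by (simp add: power2_eq_square algebra_simps)
        finally show ?thesis .
      qed
      have h2: "H\<^sup>2 \<le> 8 * E\<^sup>2 + 2 * G\<^sup>2"
      proof -
        have "H\<^sup>2 \<le> (2 * E + G)\<^sup>2" using HGE WH by (intro power_mono) auto
        also have "\<dots> \<le> 8 * E\<^sup>2 + 2 * G\<^sup>2" using zero_le_power2[of "2 * E - G"] by (simp add: power2_eq_square algebra_simps)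
        finally show ?thesis .
      qed
      have wh: "W * H \<le> 3 * s * E\<^sup>2 + (1 + 9 / (4 * s)) * G\<^sup>2"
      proof -
        have "W * H \<le> (s * E + G) * (2 * E + G)" using WGE HGE WH by (intro mult_mono) auto
        also have "\<dots> = 2 * s * E\<^sup>2 + (s + 2) * (E * G) + G\<^sup>2" by (simp add: power2_eq_square algebra_simps)
        also have "(s + 2) * (E * G) \<le> 3 * (E * G)" using s GE by (intro mult_right_mono) auto
        \<comment> \<open>Young's inequality weighted so that the coefficient of E^2 remains of
          order s. The large factor 9 / (4 s) falls on G^2 and thus into K, whose size does not
          affect the conclusion of \<open>viscosity_doubling\<close>.\<close>
        also have "3 * (E * G) \<le> s * E\<^sup>2 + 9 / (4 * s) * G\<^sup>2"
        proof -
          have "0 \<le> (s * E - 3 / 2 * G)\<^sup>2 / s" using s by simp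
          also have "\<dots> = s * E\<^sup>2 - 3 * (E * G) + 9 / (4 * s) * G\<^sup>2" using s by (simp add: power2_eq_square field_simps)
          finally show ?thesis by simp
        qed
        finally show ?thesis by (simp add: algebra_simps)
      qed
      have "W\<^sup>2 * c1 + 16 * \<beta> * W * H + H\<^sup>2 * c3
        \<le> (2 * s\<^sup>2 * E\<^sup>2 + 2 * G\<^sup>2) * c1 + 16 * \<beta> * (3 * s * E\<^sup>2 + (1 + 9 / (4 * s)) * G\<^sup>2) + (8 * E\<^sup>2 + 2 * G\<^sup>2) * c3"
        unfolding mult.assoc[of "16 * \<beta>" W H]
        by (intro add_mono mult_right_mono mult_left_mono w2 h2 wh) (use c0 \<beta> in auto)
      also have "\<dots> = (2 * s\<^sup>2 * c1 + 48 * \<beta> * s + 8 * c3) * E\<^sup>2 + (2 * c1 + 16 * \<beta> * (1 + 9 / (4 * s)) + 2 * c3) * G\<^sup>2"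
        by (simp add: algebra_simps)
      finally have "B \<le> Z * ((2 * s\<^sup>2 * c1 + 48 * \<beta> * s + 8 * c3) * E\<^sup>2 + (2 * c1 + 16 * \<beta> * (1 + 9 / (4 * s)) + 2 * c3) * G\<^sup>2)"
        unfolding B_def using c0(3) by (rule mult_left_mono)
      also have "\<dots> = 2 * (S / 2 * E\<^sup>2 + K * G\<^sup>2)"
      proof -
        have "Z * (a * v + b * v') = 2 * (Z * a / 2 * v + Z * b / 2 * v')" for a b v v' by (simp add: field_simps)
        then show ?thesis unfolding S K_def .
      qed
      finally show ?thesis unfolding G_def E_def by simp
    qed
    moreover have "g 0 = r0 * D0 powr (- \<beta>)" by (simp add: g_def r_def D_def \<theta>_def D0(2))
    moreover have "g' 0 = ip N (\<lambda>i. X * F * ((x i - y i) / r0) + 2 * \<beta> * r0 * X * x i) h - ip N (\<lambda>i. X * F * ((x i - y i) / r0)) l"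
    proof -
      have "D0 powr (- \<beta>) = X * D0" using powr_add[of D0 "- \<beta> - 1" 1] D0(1) by (simp add: X_def)
      moreover have "D 0 = D0" by (simp add: D_def \<theta>_def r_def D0(2))
      ultimately have "g' 0 = A * (X * D0) - \<beta> * r0 * X * (- (2 * T) - k * A)"
        by (simp add: g'_def r'_def D'_def \<theta>'_def r_def X_def)
      also have "\<dots> = X * F * A + 2 * \<beta> * r0 * X * T" by (simp add: F_def algebra_simps)
      also have "A = ip N (\<lambda>i. (x i - y i) / r0) h - ip N (\<lambda>i. (x i - y i) / r0) l" unfolding A_def w_def by (rule ip_diff_right)
      finally show ?thesis unfolding ip_add_left ip_scale_left T_def by (simp add: algebra_simps)
    qed
    moreover have D1: "0 < 1 - (enorm N (\<lambda>i. x i + h i))\<^sup>2 - k * enorm N (\<lambda>i. (x i + h i) - (y i + l i))"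
      and "enorm N (\<lambda>i. (x i + h i) - (y i + l i)) * (1 - (enorm N (\<lambda>i. x i + h i))\<^sup>2 - k * enorm N (\<lambda>i. (x i + h i) - (y i + l i))) powr (- \<beta>) \<le> g 1"
    proof -
      have x2: "(enorm N (\<lambda>i. x i + h i))\<^sup>2 = \<theta> 1" unfolding enorm_add_sq \<theta>_def T_def H_def by simp
      define rr where "rr = enorm N (\<lambda>i. (x i + h i) - (y i + l i))"
      have "(\<lambda>i. (x i + h i) - (y i + l i)) = (\<lambda>i. (x i - y i) + w i)" by (auto simp: w_def)
      then have "rr\<^sup>2 = r0\<^sup>2 + 2 * ip N (\<lambda>i. x i - y i) w + W\<^sup>2" unfolding rr_def W_def r0(2) by (simp only: enorm_add_sq)
      moreover have "ip N (\<lambda>i. x i - y i) w = r0 * A"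
        using ip_scale_left[of N "1 / r0" "\<lambda>i. x i - y i" w] r0(1) by (simp add: A_def)
      ultimately have rr2: "rr\<^sup>2 = 2 * r0 * r 1 - r0\<^sup>2" using r0(1) by (simp add: r_def power2_eq_square field_simps)
      have "0 \<le> (rr - r0)\<^sup>2" by simp
      then have "2 * r0 * rr \<le> 2 * r0 * r 1" using rr2 by (simp add: power2_eq_square algebra_simps)
      then have rle: "rr \<le> r 1" using r0(1) by simp
      have "k * rr \<le> k * r 1" using rle k by (intro mult_left_mono) auto
      then have Dle: "D 1 \<le> 1 - \<theta> 1 - k * rr" by (simp add: D_def)
      have D1p: "0 < D 1" using Db[of 1] D0(1) by simp
      show "0 < 1 - (enorm N (\<lambda>i. x i + h i))\<^sup>2 - k * enorm N (\<lambda>i. (x i + h i) - (y i + l i))"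
        unfolding x2 rr_def[symmetric] using Dle D1p by simp
      have "rr * (1 - \<theta> 1 - k * rr) powr (- \<beta>) \<le> r 1 * D 1 powr (- \<beta>)"
        using rle Dle D1p \<beta> rp[of 1] by (intro mult_mono powr_mono2') (auto simp: rr_def)
      then show "enorm N (\<lambda>i. (x i + h i) - (y i + l i)) * (1 - (enorm N (\<lambda>i. x i + h i))\<^sup>2 - k * enorm N (\<lambda>i. (x i + h i) - (y i + l i))) powr (- \<beta>) \<le> g 1"
        unfolding x2 rr_def[symmetric] g_def .
    qed
    ultimately show ?thesis by linarith
  qed
  then show ?thesis using \<rho>(1) K0 by blast
qed

section \<open>Choice of the constants\<close>

lemma powr_ge_tangent:
  assumes p: "1 \<le> (p::real)" and t: "0 < t" "t \<le> 1"
  shows "1 + p * (t - 1) \<le> t powr p"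
proof -
  have "1 powr p - p * 1 \<le> t powr p - p * t"
  proof (rule DERIV_nonpos_imp_nonincreasing[of t 1 "\<lambda>t. t powr p - p * t"])
    fix x assume x: "t \<le> x" "x \<le> 1"
    have "((\<lambda>t. t powr p - p * t) has_real_derivative (p * x powr (p - 1) - p * 1)) (at x)"
      by (intro DERIV_diff has_real_derivative_powr DERIV_cmult DERIV_ident) (use x t in auto)
    moreover have "x powr (p - 1) \<le> 1" using x t p by (simp add: powr_le1)
    then have "p * x powr (p - 1) - p * 1 \<le> 0" using p mult_left_mono[of "x powr (p - 1)" 1 p] by simp
    ultimately show "\<exists>y. ((\<lambda>t. t powr p - p * t) has_real_derivative y) (at x) \<and> y \<le> 0" by blast
  qed (use t in auto)
  then show ?thesis by (simp add: algebra_simps)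
qed

definition curv_const :: "real \<Rightarrow> real \<Rightarrow> real" where
  "curv_const k \<beta> = 2 powr (\<beta> + 2) * (2 * (k * \<beta>) + 20 * (\<beta> * k) + 32 * ((\<beta> + 1) * k) + 48 * \<beta> + 512 * ((\<beta> + 1) / k) + 32 / k)"

text \<open>The choice of s gives s F = k \<beta> r0 and s \<le> 1. Hence s, r0 and r0 / D0 are all
  bounded by multiples of Y = s F / D0, and s^2 D0 / r0 = s k \<beta> D0 / F is too. The whole
  curvature is of order s times the gradient size X F, divided by D0.\<close>

lemma curvature_bound:
  assumes D0: "0 < D0" "D0 \<le> 1" and r0: "0 < r0" and k: "0 < k" and \<beta>: "0 < \<beta>" and X: "0 < X"
  defines "F \<equiv> D0 + \<beta> * k * r0"
  defines "s \<equiv> k * \<beta> * r0 / F"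
  shows "2 powr (\<beta> + 2) * X * (2 * s\<^sup>2 * (D0 / r0 + 10 * \<beta> * k + 16 * \<beta> * (\<beta> + 1) * k\<^sup>2 * r0 / D0)
      + 48 * \<beta> * s + 8 * (64 * \<beta> * (\<beta> + 1) * r0 / D0 + 4 * \<beta> * r0)) \<le> curv_const k \<beta> * (s * (X * F) / D0)"
proof -
  have F0: "0 < F" using D0 r0 k \<beta> by (simp add: F_def add_pos_pos)
  have FD: "D0 \<le> F" using r0 k \<beta> by (simp add: F_def)
  have Fr: "\<beta> * k * r0 \<le> F" using D0 by (simp add: F_def)
  have s0: "0 < s" using F0 r0 k \<beta> by (simp add: s_def)
  have s1: "s \<le> 1" using Fr F0 by (simp add: s_def mult_ac)
  have sF: "s * F = k * \<beta> * r0" using F0 by (simp add: s_def)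
  define Y where "Y = s * F / D0"
  have sY: "s \<le> Y"
  proof -
    have "s * D0 \<le> s * F" using FD s0 by (intro mult_left_mono) auto
    then show ?thesis using D0 by (simp add: Y_def pos_le_divide_eq)
  qed
  have ss: "s\<^sup>2 \<le> s" using s0 s1 by (simp add: power2_eq_square mult_left_le)
  have r0Y: "r0 / D0 = Y / (k * \<beta>)" using sF k \<beta> by (simp add: Y_def)
  have a1: "s\<^sup>2 * (D0 / r0) \<le> k * \<beta> * Y"
  proof -
    have "s\<^sup>2 * (D0 / r0) = s * (k * \<beta>) * (D0 / F)" using r0 F0 by (simp add: s_def power2_eq_square field_simps)
    also have "\<dots> \<le> s * (k * \<beta>) * 1" using FD F0 s0 k \<beta> by (intro mult_left_mono) auto
    also have "\<dots> \<le> Y * (k * \<beta>)" using sY k \<beta> by simp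
    finally show ?thesis by (simp add: mult_ac)
  qed
  have a2: "s\<^sup>2 * (10 * \<beta> * k) \<le> 10 * (\<beta> * k) * Y"
  proof -
    have "s\<^sup>2 * (10 * \<beta> * k) \<le> Y * (10 * \<beta> * k)" using ss sY \<beta> k by (intro mult_right_mono) auto
    then show ?thesis by (simp add: mult_ac)
  qed
  have a3: "s\<^sup>2 * (16 * \<beta> * (\<beta> + 1) * k\<^sup>2 * r0 / D0) \<le> 16 * ((\<beta> + 1) * k) * Y"
  proof -
    have "16 * \<beta> * (\<beta> + 1) * k\<^sup>2 * r0 / D0 = 16 * ((\<beta> + 1) * k) * Y" using sF by (simp add: Y_def power2_eq_square)
    moreover have "0 \<le> 16 * ((\<beta> + 1) * k) * Y" using \<beta> k s0 sY by simp
    moreover have "s\<^sup>2 \<le> 1" using ss s1 by simp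
    ultimately show ?thesis by (simp add: mult_left_le_one_le)
  qed
  have a4: "48 * \<beta> * s \<le> 48 * \<beta> * Y" using sY \<beta> by simp
  have a5: "64 * \<beta> * (\<beta> + 1) * r0 / D0 = 64 * ((\<beta> + 1) / k) * Y"
  proof -
    have "64 * \<beta> * (\<beta> + 1) * r0 / D0 = 64 * ((\<beta> + 1) / k) * (k * \<beta> * (r0 / D0))" using k by simp
    moreover have "k * \<beta> * (r0 / D0) = Y" by (simp add: Y_def sF)
    ultimately show ?thesis by (simp only:)
  qed
  have a6: "4 * \<beta> * r0 \<le> 4 / k * Y"
  proof -
    have "r0 * D0 \<le> r0 * 1" using r0 D0 by (intro mult_left_mono) auto
    then have "r0 \<le> r0 / D0" using D0 by (simp add: pos_le_divide_eq)
    then have "4 * \<beta> * r0 \<le> 4 * \<beta> * (Y / (k * \<beta>))" unfolding r0Y using \<beta> by (intro mult_left_mono) auto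
    also have "\<dots> = 4 / k * Y" using k \<beta> by simp
    finally show ?thesis .
  qed
  have "2 * s\<^sup>2 * (D0 / r0 + 10 * \<beta> * k + 16 * \<beta> * (\<beta> + 1) * k\<^sup>2 * r0 / D0) + 48 * \<beta> * s + 8 * (64 * \<beta> * (\<beta> + 1) * r0 / D0 + 4 * \<beta> * r0)
    = 2 * (s\<^sup>2 * (D0 / r0)) + 2 * (s\<^sup>2 * (10 * \<beta> * k)) + 2 * (s\<^sup>2 * (16 * \<beta> * (\<beta> + 1) * k\<^sup>2 * r0 / D0)) + 48 * \<beta> * s
      + 8 * (64 * \<beta> * (\<beta> + 1) * r0 / D0) + 8 * (4 * \<beta> * r0)"
    by (simp only: distrib_left mult.assoc)
  also have "\<dots> \<le> 2 * (k * \<beta> * Y) + 2 * (10 * (\<beta> * k) * Y) + 2 * (16 * ((\<beta> + 1) * k) * Y) + 48 * \<beta> * Y + 8 * (64 * ((\<beta> + 1) / k) * Y) + 8 * (4 / k * Y)"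
    using a1 a2 a3 a4 a5 a6 by linarith
  also have "\<dots> = (2 * (k * \<beta>) + 20 * (\<beta> * k) + 32 * ((\<beta> + 1) * k) + 48 * \<beta> + 512 * ((\<beta> + 1) / k) + 32 / k) * Y"
    by (simp add: distrib_right mult.assoc)
  finally have le: "2 * s\<^sup>2 * (D0 / r0 + 10 * \<beta> * k + 16 * \<beta> * (\<beta> + 1) * k\<^sup>2 * r0 / D0) + 48 * \<beta> * s + 8 * (64 * \<beta> * (\<beta> + 1) * r0 / D0 + 4 * \<beta> * r0)
    \<le> (2 * (k * \<beta>) + 20 * (\<beta> * k) + 32 * ((\<beta> + 1) * k) + 48 * \<beta> + 512 * ((\<beta> + 1) / k) + 32 / k) * Y" .
  have "2 powr (\<beta> + 2) * X * (2 * s\<^sup>2 * (D0 / r0 + 10 * \<beta> * k + 16 * \<beta> * (\<beta> + 1) * k\<^sup>2 * r0 / D0) + 48 * \<beta> * s + 8 * (64 * \<beta> * (\<beta> + 1) * r0 / D0 + 4 * \<beta> * r0))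
     \<le> 2 powr (\<beta> + 2) * X * ((2 * (k * \<beta>) + 20 * (\<beta> * k) + 32 * ((\<beta> + 1) * k) + 48 * \<beta> + 512 * ((\<beta> + 1) / k) + 32 / k) * Y)"
    using X by (intro mult_left_mono[OF le]) auto
  also have "\<dots> = curv_const k \<beta> * (s * (X * F) / D0)" by (simp add: curv_const_def Y_def mult_ac)
  finally show ?thesis .
qed

text \<open>Raising to the power \<beta> inverts the power p - 1, so that
  \<open>b * L powr (p - 1)\<close> exceeds the curvature constant and the zeroth-order terms by at
  least 1. The 3 in front of \<open>C0\<close> comes from (1 + s)^2 - 1 \<le> 3 s; the other term
  bounds \<Lambda> r0 / s, because r0 = s F / (k \<beta>) and F \<le> 1 + \<beta>.\<close>

definition lip_const :: "real \<Rightarrow> real \<Rightarrow> real \<Rightarrow> real \<Rightarrow> real \<Rightarrow> real" where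
  "lip_const p a b C0 \<Lambda> = (let \<beta> = 1 / (p - 1); k = 6 * p in
     max 1 (((a * curv_const k \<beta> + (3 * C0 + \<Lambda> * (1 + \<beta>) / (k * \<beta>)) + 1) / b) powr \<beta>))"

text \<open>Both the gain and all errors carry a factor s, which cancels and leaves
  \<open>b * Pn powr p \<le> Q0 + a * C1 * (Pn / D0)\<close>. On the other hand Pn \<ge> L D0 powr
  (-\<beta>), and \<beta> (p - 1) = 1 turns this into Pn powr (p - 1) \<ge> L powr (p - 1) / D0. The
  choice of L makes the two incompatible.\<close>

lemma lip_const_contradiction:
  fixes p a b C0 \<Lambda> :: real
  assumes p: "1 < p" and a: "0 < a" and b: "0 < b" and C0: "0 \<le> C0" and \<Lambda>: "0 \<le> \<Lambda>"
  defines "\<beta> \<equiv> 1 / (p - 1)" and "k \<equiv> 6 * p" and "L \<equiv> lip_const p a b C0 \<Lambda>"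
  assumes D0: "0 < D0" "D0 \<le> 1" and r0: "0 < r0" "k * r0 < 1"
  defines "X \<equiv> D0 powr (- \<beta> - 1)" and "F \<equiv> D0 + \<beta> * k * r0"
  defines "s \<equiv> k * \<beta> * r0 / F"
  defines "S \<equiv> 2 powr (\<beta> + 2) * X * (2 * s\<^sup>2 * (D0 / r0 + 10 * \<beta> * k + 16 * \<beta> * (\<beta> + 1) * k\<^sup>2 * r0 / D0)
      + 48 * \<beta> * s + 8 * (64 * \<beta> * (\<beta> + 1) * r0 / D0 + 4 * \<beta> * r0))"
  assumes P: "L * (X * F) - 2 * \<beta> * r0 * (L * X) \<le> nP"
    and A: "- C0 \<le> A" and AB: "B - A \<le> \<Lambda> * r0"
    and main: "(1 + s)\<^sup>2 * (b * nP powr p + A) \<le> b * (L * (X * F)) powr p + B + a * (L * S)"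
  shows False
proof -
  have \<beta>: "0 < \<beta>" and \<beta>p: "\<beta> * (p - 1) = 1" using p by (auto simp: \<beta>_def)
  have k: "0 < k" using p by (simp add: k_def)
  have X0: "0 < X" using D0 by (simp add: X_def)
  define C1 where "C1 = curv_const k \<beta>"
  define Q0 where "Q0 = 3 * C0 + \<Lambda> * (1 + \<beta>) / (k * \<beta>)"
  have C10: "0 \<le> C1" using k \<beta> by (simp add: C1_def curv_const_def)
  have Q00: "0 \<le> Q0" using C0 \<Lambda> \<beta> k by (simp add: Q0_def)
  have L1: "1 \<le> L" and Lp: "a * C1 + Q0 + 1 \<le> b * L powr (p - 1)"
  proof -
    have Le: "L = max 1 (((a * C1 + Q0 + 1) / b) powr \<beta>)"
      by (simp add: L_def lip_const_def Let_def \<beta>_def k_def C1_def Q0_def)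
    show "1 \<le> L" unfolding Le by simp
    have q: "0 < (a * C1 + Q0 + 1) / b" using a b C10 Q00 by (intro divide_pos_pos add_nonneg_pos) auto
    have "(a * C1 + Q0 + 1) / b = (((a * C1 + Q0 + 1) / b) powr \<beta>) powr (p - 1)"
      unfolding powr_powr \<beta>p by (rule powr_one[symmetric]) (use q in simp)
    also have "\<dots> \<le> L powr (p - 1)" unfolding Le using p by (intro powr_mono2) auto
    finally show "a * C1 + Q0 + 1 \<le> b * L powr (p - 1)" using b by (simp add: pos_divide_le_eq mult.commute)
  qed
  have F0: "0 < F" using D0 r0 k \<beta> by (simp add: F_def add_pos_pos)
  have FD: "D0 \<le> F" using r0 k \<beta> by (simp add: F_def)
  have Fr: "\<beta> * k * r0 \<le> F" using D0 by (simp add: F_def)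
  have F1: "F \<le> 1 + \<beta>"
  proof -
    have "\<beta> * (k * r0) \<le> \<beta> * 1" using r0 \<beta> by (intro mult_left_mono) auto
    then show ?thesis using D0 by (simp add: F_def mult.assoc)
  qed
  have s0: "0 < s" using F0 r0 k \<beta> by (simp add: s_def)
  have s1: "s \<le> 1" using Fr F0 by (simp add: s_def mult_ac)
  have sF: "s * F = k * \<beta> * r0" using F0 by (simp add: s_def)
  define Pn where "Pn = L * (X * F)"
  have Pn0: "0 < Pn" using L1 X0 F0 by (simp add: Pn_def)
  have SS: "L * S \<le> C1 * (s * Pn / D0)"
  proof -
    have "S \<le> C1 * (s * (X * F) / D0)" unfolding S_def s_def F_def C1_def by (rule curvature_bound) (use D0 r0 k \<beta> X0 in auto)
    then have "L * S \<le> L * (C1 * (s * (X * F) / D0))" using L1 by (intro mult_left_mono) auto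
    then show ?thesis by (simp add: Pn_def mult_ac)
  qed
  \<comment> \<open>Origin of k = 6 p: since s F = k \<beta> r0, the cut-off changes the gradient at
    x by a fraction 2 s / k = s / (3 p) at most, so its p-th power loses no more than s / 3.\<close>
  have nP: "Pn * (1 - s / (3 * p)) \<le> nP"
  proof -
    have "2 * \<beta> * r0 * (L * X) = Pn * (s / (3 * p))"
    proof -
      have "Pn * (s / (3 * p)) = L * X * (s * F) / (3 * p)" by (simp add: Pn_def mult_ac)
      also have "\<dots> = 2 * \<beta> * r0 * (L * X)" unfolding sF using p by (simp add: k_def field_simps)
      finally show ?thesis by simp
    qed
    then show ?thesis using P by (simp add: Pn_def right_diff_distrib)
  qed
  have t0: "0 < 1 - s / (3 * p)" using s1 p by (simp add: field_simps)
  have "Pn powr p * (1 - s / 3) \<le> nP powr p"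
  proof -
    have "1 + p * ((1 - s / (3 * p)) - 1) \<le> (1 - s / (3 * p)) powr p" by (rule powr_ge_tangent) (use p t0 s0 in auto)
    then have "1 - s / 3 \<le> (1 - s / (3 * p)) powr p" using p by simp
    then have "Pn powr p * (1 - s / 3) \<le> Pn powr p * (1 - s / (3 * p)) powr p" by (intro mult_left_mono) auto
    also have "\<dots> = (Pn * (1 - s / (3 * p))) powr p" using Pn0 t0 by (simp add: powr_mult)
    also have "\<dots> \<le> nP powr p" using nP Pn0 t0 p by (intro powr_mono2) auto
    finally show ?thesis .
  qed
  then have "(1 + s)\<^sup>2 * (b * (Pn powr p * (1 - s / 3))) \<le> (1 + s)\<^sup>2 * (b * nP powr p)" using b by (intro mult_left_mono) auto
  \<comment> \<open>Of the factor 2 s in (1 + s)^2 the gradient error takes s / 3; at least s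
    remains as the gain.\<close>
  moreover have "b * Pn powr p * (1 + s) \<le> (1 + s)\<^sup>2 * (b * (Pn powr p * (1 - s / 3)))"
  proof -
    have "s ^ 3 \<le> s\<^sup>2" using s0 s1 by (intro power_decreasing) auto
    moreover have "(1 + s)\<^sup>2 * (1 - s / 3) = 1 + 5 * s / 3 + (s\<^sup>2 - s ^ 3) / 3" by (simp add: power2_eq_square power3_eq_cube field_simps)
    moreover from calculation(1) have "0 \<le> (s\<^sup>2 - s ^ 3) / 3" by simp
    ultimately have "1 + s \<le> (1 + s)\<^sup>2 * (1 - s / 3)" using s0 by linarith
    then have "b * Pn powr p * (1 + s) \<le> b * Pn powr p * ((1 + s)\<^sup>2 * (1 - s / 3))" using b by (intro mult_left_mono) auto
    then show ?thesis by (simp only: mult_ac)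
  qed
  ultimately have "b * Pn powr p * (1 + s) + (1 + s)\<^sup>2 * A \<le> b * Pn powr p + B + a * (L * S)"
    using main by (simp add: distrib_left Pn_def)
  moreover have "(1 + s)\<^sup>2 * A = A + (2 * s + s\<^sup>2) * A" by (simp add: power2_eq_square algebra_simps)
  moreover have "- (3 * s * C0) \<le> (2 * s + s\<^sup>2) * A"
  proof -
    have ss: "s\<^sup>2 \<le> s" using s0 s1 by (simp add: power2_eq_square mult_left_le)
    have "(2 * s + s\<^sup>2) * (- A) \<le> (2 * s + s\<^sup>2) * C0" using A s0 by (intro mult_left_mono) auto
    also have "\<dots> \<le> (3 * s) * C0" using ss C0 by (intro mult_right_mono) auto
    finally show ?thesis by simp
  qed
  moreover have "b * Pn powr p * (1 + s) = b * Pn powr p + s * (b * Pn powr p)" by (simp add: algebra_simps)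
  moreover have "a * (L * S) \<le> s * (a * C1 * (Pn / D0))"
    using mult_left_mono[OF SS, of a] a by (simp add: mult_ac)
  moreover have "\<Lambda> * r0 \<le> s * (\<Lambda> * (1 + \<beta>) / (k * \<beta>))"
  proof -
    have "r0 = s * F / (k * \<beta>)" using sF k \<beta> by simp
    also have "\<dots> \<le> s * (1 + \<beta>) / (k * \<beta>)" using F1 s0 k \<beta> by (intro divide_right_mono mult_left_mono) auto
    finally have "\<Lambda> * r0 \<le> \<Lambda> * (s * (1 + \<beta>) / (k * \<beta>))" using \<Lambda> by (rule mult_left_mono)
    then show ?thesis by (simp add: mult_ac)
  qed
  ultimately have "s * (b * Pn powr p) \<le> s * (\<Lambda> * (1 + \<beta>) / (k * \<beta>)) + 3 * s * C0 + s * (a * C1 * (Pn / D0))"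
    using AB by linarith
  also have "\<dots> = s * (Q0 + a * C1 * (Pn / D0))" by (simp add: Q0_def algebra_simps)
  finally have "b * Pn powr p \<le> Q0 + a * C1 * (Pn / D0)" using s0 by simp
  moreover have "(a * C1 + Q0 + 1) * (Pn / D0) \<le> b * Pn powr p"
  proof -
    have XD: "X * D0 = D0 powr (- \<beta>)" using powr_add[of D0 "- \<beta> - 1" 1] D0 by (simp add: X_def)
    have "L * D0 powr (- \<beta>) \<le> Pn" unfolding Pn_def XD[symmetric] using L1 X0 FD by (intro mult_left_mono) auto
    then have "(L * D0 powr (- \<beta>)) powr (p - 1) \<le> Pn powr (p - 1)" using L1 p by (intro powr_mono2) auto
    moreover have "(L * D0 powr (- \<beta>)) powr (p - 1) = L powr (p - 1) / D0"
    proof -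
      have "- \<beta> * (p - 1) = - 1" using \<beta>p by simp
      then have "(D0 powr (- \<beta>)) powr (p - 1) = D0 powr (- 1)" by (simp only: powr_powr)
      also have "\<dots> = 1 / D0" using D0 by (simp add: powr_minus_divide)
      finally show ?thesis using L1 D0 by (simp add: powr_mult)
    qed
    ultimately have "b * L powr (p - 1) * (Pn / D0) \<le> b * (Pn powr (p - 1) * Pn)"
      using b Pn0 mult_left_mono[of "L powr (p - 1) / D0" "Pn powr (p - 1)" "b * Pn"] by (simp add: mult_ac)
    also have "Pn powr (p - 1) * Pn = Pn powr p" using powr_add[of Pn "p - 1" 1] Pn0 by simp
    finally have "b * L powr (p - 1) * (Pn / D0) \<le> b * Pn powr p" .
    moreover have "(a * C1 + Q0 + 1) * (Pn / D0) \<le> b * L powr (p - 1) * (Pn / D0)"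
      using Lp Pn0 D0 by (intro mult_right_mono) auto
    ultimately show ?thesis by linarith
  qed
  moreover have "1 \<le> Pn / D0"
  proof -
    have "D0 powr (- \<beta> - 1) * D0 = D0 powr (- \<beta>)" using powr_add[of D0 "- \<beta> - 1" 1] D0 by simp
    moreover have "1 \<le> D0 powr (- \<beta>)" using D0 \<beta> powr_mono2'[of "- \<beta>" D0 1] by simp
    ultimately have "1 \<le> X * D0" by (simp add: X_def)
    also have "\<dots> \<le> X * F" using X0 FD by (intro mult_left_mono) auto
    also have "\<dots> \<le> Pn" using L1 X0 F0 by (simp add: Pn_def)
    finally show ?thesis using D0 by (simp add: pos_le_divide_eq)
  qed
  then have "Q0 + 1 \<le> (Q0 + 1) * (Pn / D0)" using mult_left_mono[of 1 "Pn / D0" "Q0 + 1"] Q00 by simp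
  moreover have "(a * C1 + Q0 + 1) * (Pn / D0) = a * C1 * (Pn / D0) + (Q0 + 1) * (Pn / D0)" by (simp only: distrib_right add.assoc)
  ultimately show False by linarith
qed

subsection \<open>The Lipschitz estimate\<close>

text \<open>The domain E > 0 is not compact, and the penalty need not blow up as E tends to 0 near
  the diagonal. But where u x - u y \<ge> m > 0, a compact set off the diagonal, |x - y| is at least
  some d > 0. A value of \<Phi> above m therefore forces L d E powr (-\<beta>) to stay bounded,
  which keeps E away from 0.\<close>

lemma penalized_maximum_exists:
  assumes u: "continuous_on (closed_eball N 2) (u :: _ \<Rightarrow> real)" and k: "1 \<le> k" and \<beta>: "0 < \<beta>" and L: "0 < L" and m: "0 < m"
  defines "E \<equiv> \<lambda>x y. 1 - (enorm N x)\<^sup>2 - k * enorm N (\<lambda>i. x i - y i)"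
  defines "\<Phi> \<equiv> \<lambda>x y. u x - u y - L * (enorm N (\<lambda>i. x i - y i) * E x y powr (- \<beta>))"
  assumes x1: "\<forall>i\<ge>N. x1 i = 0" "\<forall>i\<ge>N. y1 i = 0" "0 < E x1 y1" "m \<le> \<Phi> x1 y1"
  shows "\<exists>x y. (\<forall>i\<ge>N. x i = 0) \<and> (\<forall>i\<ge>N. y i = 0) \<and> 0 < E x y \<and> m \<le> \<Phi> x y \<and>
    (\<forall>x' y'. (\<forall>i\<ge>N. x' i = 0) \<longrightarrow> (\<forall>i\<ge>N. y' i = 0) \<longrightarrow> 0 < E x' y' \<longrightarrow> \<Phi> x' y' \<le> \<Phi> x y)"
proof -
  \<comment> \<open>As k \<ge> 1, E > 0 forces |x| \<le> 1 and |x - y| \<le> 1; hence y stays in the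
    ball of radius 2.\<close>
  have dom: "x \<in> closed_eball N 2 \<and> y \<in> closed_eball N 2" if "\<forall>i\<ge>N. x i = 0" "\<forall>i\<ge>N. y i = 0" "0 < E x y" for x y
  proof -
    have "0 \<le> (k - 1) * enorm N (\<lambda>i. x i - y i)" using k by simp
    then have kr: "enorm N (\<lambda>i. x i - y i) \<le> k * enorm N (\<lambda>i. x i - y i)" by (simp add: algebra_simps)
    then have "(enorm N x)\<^sup>2 \<le> 1\<^sup>2" "enorm N (\<lambda>i. x i - y i) \<le> 1"
      using that(3) zero_le_power2[of "enorm N x"] enorm_nonneg[of N "\<lambda>i. x i - y i"] unfolding E_def by (simp, linarith)+
    moreover from this(1) have "enorm N x \<le> 1" by (rule power2_le_imp_le) simp
    moreover have "enorm N y \<le> enorm N x + enorm N (\<lambda>i. x i - y i)"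
      using enorm_le_add_diff[of N y x] by (simp only: enorm_minus_commute[of N y x])
    ultimately show ?thesis using that by (simp add: closed_eball_iff)
  qed
  let ?C = "closed_eball N 2 \<times> closed_eball N 2"
  have cC: "compact ?C" by (intro compact_Times compact_closed_eball)
  have cf: "continuous_on S (\<lambda>p. fst p i)" "continuous_on S (\<lambda>p. snd p i)" for S :: "((nat \<Rightarrow> real) \<times> (nat \<Rightarrow> real)) set" and i
    by (rule continuous_on_product_then_coordinatewise, rule continuous_on_fst continuous_on_snd, rule continuous_on_id)+
  have cuf: "continuous_on ?C (\<lambda>p. u (fst p))" "continuous_on ?C (\<lambda>p. u (snd p))"
    by (rule continuous_on_compose2[OF u continuous_on_fst[OF continuous_on_id]], force)
      (rule continuous_on_compose2[OF u continuous_on_snd[OF continuous_on_id]], force)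
  have cr: "continuous_on S (\<lambda>p. enorm N (\<lambda>i. fst p i - snd p i))" for S by (intro continuous_intros cf)
  have cE: "continuous_on S (\<lambda>p. E (fst p) (snd p))" for S unfolding E_def by (intro continuous_intros cf)
  obtain Mu where Mu: "\<And>x. x \<in> closed_eball N 2 \<Longrightarrow> \<bar>u x\<bar> \<le> Mu"
    using compact_imp_bounded[OF compact_continuous_image[OF u compact_closed_eball]] by (auto simp: bounded_iff)
  have Mu0: "0 \<le> Mu" using Mu[of "\<lambda>_. 0"] by (simp add: closed_eball_iff)
  define T where "T = {p \<in> ?C. m \<le> u (fst p) - u (snd p)}"
  have "closedin (top_of_set ?C) (?C \<inter> (\<lambda>p. u (fst p) - u (snd p)) -` {m..})"
    by (intro continuous_closedin_preimage continuous_intros cuf)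
  moreover have "?C \<inter> (\<lambda>p. u (fst p) - u (snd p)) -` {m..} = T" by (auto simp: T_def)
  ultimately have "closedin (top_of_set ?C) T" by simp
  then have cT: "compact T" using cC by (rule closedin_compact[rotated])
  have inT: "(x, y) \<in> T" if "\<forall>i\<ge>N. x i = 0" "\<forall>i\<ge>N. y i = 0" "0 < E x y" "m \<le> \<Phi> x y" for x y
  proof -
    have "0 \<le> L * (enorm N (\<lambda>i. x i - y i) * E x y powr (- \<beta>))" using L by simp
    then show ?thesis using dom[OF that(1-3)] that(4) by (simp add: T_def \<Phi>_def)
  qed
  have "T \<noteq> {}" using inT[OF x1] by blast
  then obtain p0 where p0: "p0 \<in> T" "\<And>p. p \<in> T \<Longrightarrow> enorm N (\<lambda>i. fst p0 i - snd p0 i) \<le> enorm N (\<lambda>i. fst p i - snd p i)"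
    using continuous_attains_inf[OF cT _ cr] by blast
  define d where "d = enorm N (\<lambda>i. fst p0 i - snd p0 i)"
  have d0: "0 < d"
  proof (rule ccontr)
    assume "\<not> 0 < d"
    then have "d = 0" using enorm_nonneg[of N "\<lambda>i. fst p0 i - snd p0 i"] by (simp add: d_def)
    then have "fst p0 i = snd p0 i" for i
      using abs_le_enorm[of i N "\<lambda>i. fst p0 i - snd p0 i"] p0(1)
      by (cases "i < N") (auto simp: d_def T_def closed_eball_iff)
    then have "fst p0 = snd p0" by auto
    then show False using p0(1) m by (simp add: T_def)
  qed
  \<comment> \<open>The smallest E compatible with L d E powr (-\<beta>) \<le> 2 Mu + 1, where Mu
    bounds |u|. It only enters the existence of the maximum, so the estimate remains independent of
    Mu.\<close>
  define \<epsilon>0 where "\<epsilon>0 = (L * d / (2 * Mu + 1)) powr (1 / \<beta>)"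
  have q0: "0 < L * d / (2 * Mu + 1)" using L d0 Mu0 by simp
  have \<epsilon>00: "0 < \<epsilon>0" unfolding \<epsilon>0_def powr_gt_zero using q0 by (rule less_imp_neq[symmetric])
  have Ege: "\<epsilon>0 \<le> E x y" if h: "\<forall>i\<ge>N. x i = 0" "\<forall>i\<ge>N. y i = 0" "0 < E x y" "m \<le> \<Phi> x y" for x y
  proof -
    have r: "d \<le> enorm N (\<lambda>i. x i - y i)" using p0(2)[OF inT[OF h]] by (simp add: d_def)
    have "L * (d * E x y powr (- \<beta>)) \<le> L * (enorm N (\<lambda>i. x i - y i) * E x y powr (- \<beta>))"
      using r L by (intro mult_left_mono mult_right_mono) auto
    also have "\<dots> \<le> u x - u y" using h(4) m by (simp add: \<Phi>_def)
    also have "\<dots> \<le> 2 * Mu + 1"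
    proof -
      have "\<bar>u x\<bar> \<le> Mu" "\<bar>u y\<bar> \<le> Mu" using dom[OF h(1-3)] by (auto intro: Mu)
      then show ?thesis by linarith
    qed
    finally have "(L * d) / E x y powr \<beta> \<le> 2 * Mu + 1"
      by (simp only: powr_minus divide_inverse mult.assoc)
    then have "L * d \<le> (2 * Mu + 1) * E x y powr \<beta>" using h(3)
      by (subst (asm) pos_divide_le_eq) simp_all
    then have "L * d / (2 * Mu + 1) \<le> E x y powr \<beta>" using Mu0 by (simp add: pos_divide_le_eq mult.commute)
    then have "\<epsilon>0 \<le> (E x y powr \<beta>) powr (1 / \<beta>)" unfolding \<epsilon>0_def using q0 \<beta> by (intro powr_mono2) auto
    then show ?thesis using \<beta> h(3) by (simp add: powr_powr)
  qed
  define S where "S = {p \<in> ?C. \<epsilon>0 \<le> E (fst p) (snd p)}"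
  have cS: "compact S"
  proof -
    have "closed {p. \<epsilon>0 \<le> E (fst p) (snd p)}" by (intro closed_Collect_le continuous_intros cE)
    then have "compact (?C \<inter> {p. \<epsilon>0 \<le> E (fst p) (snd p)})" by (rule compact_Int_closed[OF cC])
    moreover have "S = ?C \<inter> {p. \<epsilon>0 \<le> E (fst p) (snd p)}" unfolding S_def by blast
    ultimately show ?thesis by (simp only:)
  qed
  have "continuous_on S (\<lambda>p. \<Phi> (fst p) (snd p))" unfolding \<Phi>_def
    by (intro continuous_intros cr cE continuous_on_subset[OF cuf(1)] continuous_on_subset[OF cuf(2)])
      (use \<epsilon>00 in \<open>auto simp: S_def\<close>)
  moreover have x1S: "(x1, y1) \<in> S" using dom[OF x1(1-3)] Ege[OF x1] by (simp add: S_def)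
  ultimately obtain q where q: "q \<in> S" "\<And>p. p \<in> S \<Longrightarrow> \<Phi> (fst p) (snd p) \<le> \<Phi> (fst q) (snd q)"
    using continuous_attains_sup[OF cS, of "\<lambda>p. \<Phi> (fst p) (snd p)"] by blast
  have mq: "m \<le> \<Phi> (fst q) (snd q)" using q(2)[OF x1S] x1(4) by simp
  have "\<Phi> x' y' \<le> \<Phi> (fst q) (snd q)" if "\<forall>i\<ge>N. x' i = 0" "\<forall>i\<ge>N. y' i = 0" "0 < E x' y'" for x' y'
  proof (cases "m \<le> \<Phi> x' y'")
    case True
    then have "(x', y') \<in> S" using dom[OF that] Ege[OF that True] by (simp add: S_def)
    then show ?thesis using q(2)[of "(x', y')"] by simp
  qed (use mq in simp)
  then show ?thesis using q(1) mq \<epsilon>00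
    by (intro exI[of _ "fst q"] exI[of _ "snd q"]) (auto simp: S_def closed_eball_iff)
qed

text \<open>The penalty \<open>L |x - y| (1 - |x|\<^sup>2 - k |x - y|) powr - \<beta>\<close> blows up as fast as a viscosity solution
  can, so that no bound on \<open>u\<close> itself enters.\<close>

lemma penalized_difference_nonpos:
  assumes i: "i \<in> {1..N}" and a: "0 < a" and b: "0 < b" and p: "1 < p" and \<gamma>: "0 \<le> \<gamma>" and \<Lambda>: "0 \<le> \<Lambda>"
    and f: "\<And>x y. x \<in> closed_eball N 2 \<Longrightarrow> y \<in> closed_eball N 2 \<Longrightarrow> \<bar>f x - f y\<bar> \<le> \<Lambda> * edist N x y"
    and u: "continuous_on (closed_eball N 2) u"
    and visc: "viscosity_solution N (\<lambda>x r q X. - a * eigenvalue_nth i X + b * enorm N q powr p - f x + \<gamma> * r) (open_eball N 2) u"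
    and C0: "\<And>x. x \<in> closed_eball N 2 \<Longrightarrow> \<bar>f x\<bar> + \<gamma> * \<bar>u x\<bar> \<le> C0"
  defines "\<beta> \<equiv> 1 / (p - 1)" and "k \<equiv> 6 * p" and "L \<equiv> lip_const p a b C0 \<Lambda>"
  defines "E \<equiv> \<lambda>x y. 1 - (enorm N x)\<^sup>2 - k * enorm N (\<lambda>i. x i - y i)"
  assumes x1: "\<forall>i\<ge>N. x1 i = 0" "\<forall>i\<ge>N. y1 i = 0" "0 < E x1 y1"
  shows "u x1 - u y1 \<le> L * (enorm N (\<lambda>i. x1 i - y1 i) * E x1 y1 powr (- \<beta>))"
proof (rule ccontr)
  define \<Phi> where "\<Phi> x y = u x - u y - L * (enorm N (\<lambda>i. x i - y i) * E x y powr (- \<beta>))" for x y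
  assume "\<not> ?thesis"
  then have m: "0 < \<Phi> x1 y1" by (simp add: \<Phi>_def)
  have \<beta>: "0 < \<beta>" and k: "1 \<le> k" "0 < k" using p by (auto simp: \<beta>_def k_def)
  have L1: "1 \<le> L" by (simp add: L_def lip_const_def Let_def)
  obtain x y where xs: "\<forall>i\<ge>N. x i = 0" and ys: "\<forall>i\<ge>N. y i = 0" and E0: "0 < E x y" and m2: "\<Phi> x1 y1 \<le> \<Phi> x y"
    and mx: "\<And>x' y'. \<forall>i\<ge>N. x' i = 0 \<Longrightarrow> \<forall>i\<ge>N. y' i = 0 \<Longrightarrow> 0 < E x' y' \<Longrightarrow> \<Phi> x' y' \<le> \<Phi> x y"
    using penalized_maximum_exists[OF u k(1) \<beta> _ m, of L x1 y1] L1 x1 unfolding E_def \<Phi>_def by auto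
  define D0 where "D0 = E x y"
  define r0 where "r0 = enorm N (\<lambda>i. x i - y i)"
  have upos: "0 < u x - u y - L * (r0 * D0 powr (- \<beta>))" using m m2 by (simp add: \<Phi>_def D0_def r0_def)
  have r0: "0 < r0"
  proof (rule ccontr)
    assume "\<not> 0 < r0"
    then have "r0 = 0" using enorm_nonneg[of N "\<lambda>i. x i - y i"] by (simp add: r0_def)
    then have "x i = y i" for i
      using abs_le_enorm[of i N "\<lambda>i. x i - y i"] xs ys by (cases "i < N") (auto simp: r0_def)
    then have "x = y" by auto
    then show False using upos \<open>r0 = 0\<close> by simp
  qed
  have D0: "0 < D0" "D0 = 1 - (enorm N x)\<^sup>2 - k * r0" using E0 by (auto simp: D0_def E_def r0_def)
  have kr0: "0 < k * r0" using k r0 by simp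
  have D01: "D0 \<le> 1" "k * r0 < 1" using D0 kr0 zero_le_power2[of "enorm N x"] by linarith+
  have xn: "enorm N x < 1"
  proof -
    have "(enorm N x)\<^sup>2 < 1\<^sup>2" using D0 kr0 by simp
    then show ?thesis by (rule power2_less_imp_less) simp
  qed
  have "r0 \<le> k * r0" using k(1) r0 by simp
  then have yn: "enorm N y < 2"
    using enorm_le_add_diff[of N y x] xn D01 unfolding enorm_minus_commute[of N y x] r0_def[symmetric] by linarith
  have x2: "x \<in> open_eball N 2" "y \<in> open_eball N 2" "x \<in> closed_eball N 2" "y \<in> closed_eball N 2"
    using xs ys xn yn by (auto simp: open_eball_iff closed_eball_iff)
  define X where "X = D0 powr (- \<beta> - 1)"
  define F where "F = D0 + \<beta> * k * r0"
  have F0: "0 < F" using D0 r0 k \<beta> by (simp add: F_def add_pos_pos)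
  have X0: "0 < X" using D0 by (simp add: X_def)
  define s where "s = k * \<beta> * r0 / F"
  have s: "0 < s" "s \<le> 1"
  proof -
    show "0 < s" using k(2) \<beta> r0 F0 by (simp add: s_def)
    have "k * \<beta> * r0 \<le> F" using D0(1) by (simp add: F_def mult_ac)
    then show "s \<le> 1" using F0 by (simp add: s_def)
  qed
  define S where "S = 2 powr (\<beta> + 2) * X * (2 * s\<^sup>2 * (D0 / r0 + 10 * \<beta> * k + 16 * \<beta> * (\<beta> + 1) * k\<^sup>2 * r0 / D0)
      + 48 * \<beta> * s + 8 * (64 * \<beta> * (\<beta> + 1) * r0 / D0 + 4 * \<beta> * r0))"
  have S0: "0 \<le> S" using D0(1) r0 k(2) \<beta> s X0 by (simp add: S_def)
  define e where "e = (\<lambda>i. (x i - y i) / r0)"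
  have en: "enorm N e = 1" using enorm_scale[of N "1 / r0" "\<lambda>i. x i - y i"] r0 by (simp add: e_def r0_def)
  \<comment> \<open>The cut-off depends on x alone. So Q is parallel to e with norm exactly L X F,
    while P carries an extra term of length at most 2 \<beta> r0 L X.\<close>
  define P where "P = (\<lambda>i. L * (X * F * e i + 2 * \<beta> * r0 * X * x i))"
  define Q where "Q = (\<lambda>i. L * (X * F * e i))"
  obtain \<rho> K where \<rho>: "0 < \<rho>" and K: "0 \<le> K" and pen: "\<And>h l. enorm N h \<le> \<rho> \<Longrightarrow> enorm N l \<le> \<rho> \<Longrightarrow>
    0 < E (\<lambda>i. x i + h i) (\<lambda>i. y i + l i) \<and>
    enorm N (\<lambda>i. (x i + h i) - (y i + l i)) * E (\<lambda>i. x i + h i) (\<lambda>i. y i + l i) powr (- \<beta>)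
    \<le> r0 * D0 powr (- \<beta>) + ip N (\<lambda>i. X * F * e i + 2 * \<beta> * r0 * X * x i) h - ip N (\<lambda>i. X * F * e i) l
      + S / 2 * (enorm N l)\<^sup>2 + K * (enorm N (\<lambda>i. h i - (1 + s) * l i))\<^sup>2"
    using penalty_upper_bound[OF xn r0 r0_def k(2) \<beta> D0 s] unfolding E_def X_def F_def S_def e_def by blast
  have main: "(1 + s)\<^sup>2 * (b * enorm N P powr p - f x + \<gamma> * u x) \<le> b * enorm N Q powr p - f y + \<gamma> * u y + a * (L * S)"
  proof (rule viscosity_doubling[OF i a b p \<gamma> \<Lambda> f u visc x2(1,2) _ _ _ \<rho>])
    show "0 < 1 + s" using s by simp
    show "0 \<le> L * S" using L1 S0 by simp
    show "0 \<le> L * K" using L1 K by simp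
    fix h l assume hl: "h \<in> closed_eball N \<rho>" "l \<in> closed_eball N \<rho>"
    have n: "enorm N h \<le> \<rho>" "enorm N l \<le> \<rho>" using hl by (auto simp: closed_eball_iff)
    have "\<Phi> (\<lambda>i. x i + h i) (\<lambda>i. y i + l i) \<le> \<Phi> x y"
      by (rule mx) (use hl xs ys pen[OF n] in \<open>auto simp: closed_eball_iff\<close>)
    moreover have "L * (enorm N (\<lambda>i. (x i + h i) - (y i + l i)) * E (\<lambda>i. x i + h i) (\<lambda>i. y i + l i) powr (- \<beta>))
      \<le> L * (r0 * D0 powr (- \<beta>) + ip N (\<lambda>i. X * F * e i + 2 * \<beta> * r0 * X * x i) h - ip N (\<lambda>i. X * F * e i) l
      + S / 2 * (enorm N l)\<^sup>2 + K * (enorm N (\<lambda>i. h i - (1 + s) * l i))\<^sup>2)"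
      using pen[OF n] L1 by (intro mult_left_mono) auto
    moreover have "L * (r0 * D0 powr (- \<beta>) + ip N (\<lambda>i. X * F * e i + 2 * \<beta> * r0 * X * x i) h - ip N (\<lambda>i. X * F * e i) l
      + S / 2 * (enorm N l)\<^sup>2 + K * (enorm N (\<lambda>i. h i - (1 + s) * l i))\<^sup>2)
      = L * (r0 * D0 powr (- \<beta>)) + ip N P h - ip N Q l + L * S / 2 * (enorm N l)\<^sup>2 + L * K * (enorm N (\<lambda>i. h i - (1 + s) * l i))\<^sup>2"
      unfolding P_def Q_def ip_scale_left[of N L] by (simp add: distrib_left right_diff_distrib)
    ultimately show "u (\<lambda>i. x i + h i) - u (\<lambda>i. y i + l i) \<le> u x - u y + ip N P h - ip N Q l
         + L * S / 2 * (enorm N l)\<^sup>2 + L * K * (enorm N (\<lambda>i. h i - (1 + s) * l i))\<^sup>2"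
      unfolding \<Phi>_def D0_def[symmetric] r0_def[symmetric] by linarith
  qed
  have Qn: "enorm N Q = L * (X * F)"
  proof -
    have "Q = (\<lambda>i. (L * (X * F)) * e i)" by (auto simp: Q_def)
    then have "enorm N Q = \<bar>L * (X * F)\<bar> * enorm N e" by (simp only: enorm_scale)
    then show ?thesis using en L1 X0 F0 by simp
  qed
  have Pn: "L * (X * F) - 2 * \<beta> * r0 * (L * X) \<le> enorm N P"
  proof -
    have "enorm N (\<lambda>i. Q i - P i) = 2 * \<beta> * r0 * (L * X) * enorm N x"
    proof -
      have "(\<lambda>i. Q i - P i) = (\<lambda>i. (- (2 * \<beta> * r0 * (L * X))) * x i)" by (auto simp: P_def Q_def algebra_simps)
      then have "enorm N (\<lambda>i. Q i - P i) = \<bar>- (2 * \<beta> * r0 * (L * X))\<bar> * enorm N x" by (simp only: enorm_scale)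
      moreover have "0 \<le> 2 * \<beta> * r0 * (L * X)" using \<beta> r0 L1 X0 by simp
      ultimately show ?thesis by (simp only: abs_minus_cancel abs_of_nonneg)
    qed
    also have "\<dots> \<le> 2 * \<beta> * r0 * (L * X) * 1" using xn \<beta> r0 L1 X0 by (intro mult_left_mono) auto
    finally show ?thesis using enorm_le_add_diff[of N Q P] Qn by simp
  qed
  have fg: "- C0 \<le> - f x + \<gamma> * u x"
  proof -
    have "\<gamma> * (- u x) \<le> \<gamma> * \<bar>u x\<bar>" using \<gamma> by (intro mult_left_mono) auto
    then have "- (\<gamma> * u x) \<le> \<gamma> * \<bar>u x\<bar>" by (simp only: mult_minus_right)
    then show ?thesis using C0[OF x2(3)] abs_ge_self[of "f x"] by linarith
  qed
  have diff: "(- f y + \<gamma> * u y) - (- f x + \<gamma> * u x) \<le> \<Lambda> * r0"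
  proof -
    have "0 \<le> L * (r0 * D0 powr (- \<beta>))" using L1 r0 by simp
    \<comment> \<open>The positive maximum gives u x > u y, so the difference of the \<gamma> terms
      has the favourable sign and only the Lipschitz bound for f is left.\<close>
    then have "\<gamma> * u y \<le> \<gamma> * u x" using upos \<gamma> by (intro mult_left_mono) auto
    then show ?thesis using f[OF x2(3,4)] unfolding edist_eq r0_def[symmetric] by linarith
  qed
  have "0 \<le> \<gamma> * \<bar>u x\<bar>" using \<gamma> by simp
  then have C00: "0 \<le> C0" using C0[OF x2(3)] abs_ge_zero[of "f x"] by linarith
  show False
  proof (rule lip_const_contradiction[OF p a b C00 \<Lambda>, folded \<beta>_def k_def L_def, OF D0(1) D01(1) r0 D01(2), folded X_def F_def, folded s_def, folded S_def])
    show "L * (X * F) - 2 * \<beta> * r0 * (L * X) \<le> enorm N P" by (rule Pn)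
    show "- C0 \<le> - f x + \<gamma> * u x" by (rule fg)
    show "(- f y + \<gamma> * u y) - (- f x + \<gamma> * u x) \<le> \<Lambda> * r0" by (rule diff)
    show "(1 + s)\<^sup>2 * (b * enorm N P powr p + (- f x + \<gamma> * u x)) \<le> b * (L * (X * F)) powr p + (- f y + \<gamma> * u y) + a * (L * S)"
      using main unfolding Qn by (simp add: algebra_simps)
  qed
qed

text \<open>The hypothesis covers only pairs that are close compared with 1 / k. The segment is cut
  into n \<ge> 2 k pieces; its points satisfy |z|^2 \<le> 1 / 4 and neighbours satisfy k |z - z'|
  \<le> 1 / 2, so E \<ge> 1 / 4, which is where the factor 4 powr \<beta> comes from.\<close>

lemma lipschitz_on_half_ball:
  assumes L: "0 \<le> L" and k: "6 \<le> k" and \<beta>: "0 < (\<beta>::real)"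
    and le: "\<And>x y. \<forall>i\<ge>N. x i = 0 \<Longrightarrow> \<forall>i\<ge>N. y i = 0 \<Longrightarrow> 0 < 1 - (enorm N x)\<^sup>2 - k * enorm N (\<lambda>i. x i - y i) \<Longrightarrow>
      u x - u y \<le> L * (enorm N (\<lambda>i. x i - y i) * (1 - (enorm N x)\<^sup>2 - k * enorm N (\<lambda>i. x i - y i)) powr (- \<beta>))"
    and x: "x \<in> open_eball N (1 / 2)" and y: "y \<in> open_eball N (1 / 2)"
  shows "u x - u y \<le> L * 4 powr \<beta> * edist N x y"
proof -
  define n where "n = nat \<lceil>2 * k\<rceil>"
  have n: "2 * k \<le> real n" unfolding n_def by linarith
  have n0: "0 < real n" using n k by simp
  define r where "r = enorm N (\<lambda>i. x i - y i)"
  have r: "0 \<le> r" "r \<le> 1" using enorm_diff_le[of N x y] x y by (auto simp: r_def open_eball_iff)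
  define z where "z j = (\<lambda>i. (1 - real j / n) * x i + (real j / n) * y i)" for j
  have zs: "\<forall>i\<ge>N. z j i = 0" for j using x y by (auto simp: z_def open_eball_iff)
  have zn: "enorm N (z j) \<le> 1 / 2" if "j \<le> n" for j
  proof -
    have j: "0 \<le> real j / n" "real j / n \<le> 1" using that n0 by (auto simp: divide_le_eq)
    have "enorm N (z j) \<le> \<bar>1 - real j / n\<bar> * enorm N x + \<bar>real j / n\<bar> * enorm N y"
      using enorm_triangle[of N "\<lambda>i. (1 - real j / n) * x i" "\<lambda>i. (real j / n) * y i"]
      unfolding z_def enorm_scale .
    also have "\<dots> = (1 - real j / n) * enorm N x + (real j / n) * enorm N y"
      using j by (simp only: abs_of_nonneg diff_ge_0_iff_ge)
    also have "\<dots> \<le> (1 - real j / n) * (1 / 2) + (real j / n) * (1 / 2)"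
      using x y j by (intro add_mono mult_left_mono) (auto simp: open_eball_iff)
    finally show ?thesis by (simp add: algebra_simps)
  qed
  have zd: "enorm N (\<lambda>i. z j i - z (Suc j) i) = r / n" for j
  proof -
    have "(\<lambda>i. z j i - z (Suc j) i) = (\<lambda>i. (1 / real n) * (x i - y i))"
      using n0 by (auto simp: z_def field_simps)
    then show ?thesis by (simp only: enorm_scale) (simp add: r_def)
  qed
  have step: "u (z j) - u (z (Suc j)) \<le> L * 4 powr \<beta> * (r / n)" if j: "j < n" for j
  proof -
    have "(enorm N (z j))\<^sup>2 \<le> (1 / 2)\<^sup>2" using zn[of j] j by (intro power_mono) auto
    then have a: "(enorm N (z j))\<^sup>2 \<le> 1 / 4" by (simp add: power2_eq_square)
    have "k * (r / n) \<le> k * (1 / (2 * k))"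
    proof (rule mult_left_mono)
      have "r / n \<le> 1 / n" using r n0 by (simp add: divide_right_mono)
      also have "\<dots> \<le> 1 / (2 * k)" using n k by (intro divide_left_mono) auto
      finally show "r / n \<le> 1 / (2 * k)" .
    qed (use k in auto)
    then have b: "k * (r / n) \<le> 1 / 2" using k by simp
    define E where "E = 1 - (enorm N (z j))\<^sup>2 - k * enorm N (\<lambda>i. z j i - z (Suc j) i)"
    have E: "1 / 4 \<le> E" using a b unfolding E_def zd by linarith
    have "u (z j) - u (z (Suc j)) \<le> L * (r / n * E powr (- \<beta>))"
    proof -
      have "0 < E" using E by linarith
      from le[OF zs zs this[unfolded E_def]] show ?thesis unfolding E_def zd .
    qed
    also have "\<dots> \<le> L * (r / n * 4 powr \<beta>)"
    proof -
      have "E powr (- \<beta>) \<le> (1 / 4) powr (- \<beta>)" using E \<beta> by (intro powr_mono2') auto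
      also have "\<dots> = 4 powr \<beta>" by (simp add: powr_divide powr_minus)
      finally show ?thesis using L r n0 by (intro mult_left_mono) auto
    qed
    finally show ?thesis by (simp add: mult_ac)
  qed
  have "u (z 0) - u (z j) \<le> real j * (L * 4 powr \<beta> * (r / n))" if "j \<le> n" for j
    using that
  proof (induction j)
    case (Suc j)
    then have "u (z 0) - u (z j) \<le> real j * (L * 4 powr \<beta> * (r / n))" "u (z j) - u (z (Suc j)) \<le> L * 4 powr \<beta> * (r / n)"
      using step[of j] by simp_all
    moreover have "real (Suc j) * c = real j * c + c" for c by (simp add: distrib_right)
    ultimately show ?case by (smt (verit))
  qed simp
  from this[of n] have "u (z 0) - u (z n) \<le> L * 4 powr \<beta> * r" using n0 by simp
  moreover have "z 0 = x" "z n = y" using n0 by (auto simp: z_def)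
  ultimately show ?thesis by (simp add: edist_eq r_def)
qed

lemma abs_le_sup_norm_on:
  assumes "continuous_on S g" "compact S" "x \<in> S"
  shows "\<bar>g x\<bar> \<le> sup_norm_on S g"
proof -
  have "bdd_above ((\<lambda>x. \<bar>g x\<bar>) ` S)"
    using compact_imp_bounded[OF compact_continuous_image[OF continuous_on_rabs[OF assms(1)] assms(2)]]
    by (rule bounded_imp_bdd_above)
  then show ?thesis unfolding sup_norm_on_def using assms(3) by (rule cSUP_upper[rotated])
qed

theorem proposition2p7:
  shows "\<exists>L0 :: real \<Rightarrow> real \<Rightarrow> real \<Rightarrow> real \<Rightarrow> real \<Rightarrow> real \<Rightarrow> real.
    \<forall>(N::nat) (i::nat) (a::real) (b::real) (p::real) (\<gamma>::real) (\<Lambda>::real)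
      (f :: (nat \<Rightarrow> real) \<Rightarrow> real) (u :: (nat \<Rightarrow> real) \<Rightarrow> real).
      i \<in> {1..N} \<longrightarrow> a > 0 \<longrightarrow> b > 0 \<longrightarrow> p > 1 \<longrightarrow> \<gamma> \<ge> 0 \<longrightarrow> \<Lambda> \<ge> 0 \<longrightarrow>
      (\<forall>x\<in>closed_eball N 2. \<forall>y\<in>closed_eball N 2. \<bar>f x - f y\<bar> \<le> \<Lambda> * edist N x y) \<longrightarrow>
      continuous_on (closed_eball N 2) u \<longrightarrow>
      viscosity_solution N
        (\<lambda>x r q X. - a * eigenvalue_nth i X + b * enorm N q powr p - f x + \<gamma> * r)
        (open_eball N 2) u \<longrightarrow>
      (\<forall>x\<in>open_eball N (1/2). \<forall>y\<in>open_eball N (1/2).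
        \<bar>u x - u y\<bar> \<le> L0 (\<gamma> * sup_norm_on (closed_eball N 2) u) p a b
                         (sup_norm_on (closed_eball N 2) f) \<Lambda> * edist N x y)"
\<comment> \<open>The two sup norms enter only through their sum \<open>m0 + mu\<close>, a bound for
  |f| + \<gamma> |u| on the closed ball.\<close>
proof (intro exI[of _ "\<lambda>mu p a b m0 \<Lambda>. lip_const p a b (m0 + mu) \<Lambda> * 4 powr (1 / (p - 1))"] allI impI ballI)
  fix N i :: nat and a b p \<gamma> \<Lambda> :: real and f u :: "(nat \<Rightarrow> real) \<Rightarrow> real" and x y
  assume i: "i \<in> {1..N}" and a: "a > 0" and b: "b > 0" and p: "p > 1" and \<gamma>: "\<gamma> \<ge> 0" and \<Lambda>: "\<Lambda> \<ge> 0"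
    and f: "\<forall>x\<in>closed_eball N 2. \<forall>y\<in>closed_eball N 2. \<bar>f x - f y\<bar> \<le> \<Lambda> * edist N x y"
    and u: "continuous_on (closed_eball N 2) u"
    and visc: "viscosity_solution N (\<lambda>x r q X. - a * eigenvalue_nth i X + b * enorm N q powr p - f x + \<gamma> * r) (open_eball N 2) u"
    and x: "x \<in> open_eball N (1/2)" and y: "y \<in> open_eball N (1/2)"
  \<comment> \<open>Continuity of f makes its supremum finite; otherwise \<open>sup_norm_on\<close>
    would not bound |f|.\<close>
  have fc: "continuous_on (closed_eball N 2) f"
    by (rule continuous_on_enorm_lipschitz[where L = \<Lambda> and N = N]) (use f in \<open>auto simp: edist_eq\<close>)
  define C0 where "C0 = sup_norm_on (closed_eball N 2) f + \<gamma> * sup_norm_on (closed_eball N 2) u"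
  have C0: "\<bar>f x\<bar> + \<gamma> * \<bar>u x\<bar> \<le> C0" if "x \<in> closed_eball N 2" for x
    unfolding C0_def
    by (intro add_mono mult_left_mono abs_le_sup_norm_on fc u compact_closed_eball that \<gamma>)
  define L where "L = lip_const p a b C0 \<Lambda>"
  have L1: "0 \<le> L" by (simp add: L_def lip_const_def Let_def)
  have le: "u x - u y \<le> L * (enorm N (\<lambda>i. x i - y i) * (1 - (enorm N x)\<^sup>2 - 6 * p * enorm N (\<lambda>i. x i - y i)) powr (- (1 / (p - 1))))"
    if "\<forall>i\<ge>N. x i = 0" "\<forall>i\<ge>N. y i = 0" "0 < 1 - (enorm N x)\<^sup>2 - 6 * p * enorm N (\<lambda>i. x i - y i)" for x y
    unfolding L_def
    by (rule penalized_difference_nonpos[OF i a b p \<gamma> \<Lambda> _ u visc C0 that]) (use f in auto)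
  have lip: "u x - u y \<le> L * 4 powr (1 / (p - 1)) * edist N x y"
    if "x \<in> open_eball N (1/2)" "y \<in> open_eball N (1/2)" for x y
    by (rule lipschitz_on_half_ball[where k = "6 * p", OF L1 _ _ le that]) (use p in auto)
  have "edist N y x = edist N x y" unfolding edist_eq by (rule enorm_minus_commute)
  then have "\<bar>u x - u y\<bar> \<le> L * 4 powr (1 / (p - 1)) * edist N x y"
    using lip[OF x y] lip[OF y x] by (simp add: abs_le_iff)
  then show "\<bar>u x - u y\<bar> \<le> lip_const p a b (sup_norm_on (closed_eball N 2) f + \<gamma> * sup_norm_on (closed_eball N 2) u) \<Lambda>
      * 4 powr (1 / (p - 1)) * edist N x y"
    by (simp add: L_def C0_def)
qed

end
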